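(* Let $m\ge0$ and $\theta\in(-\frac{\pi}{2},\frac{\pi}{2})$. Then $$\sigma(H_\theta)=\big\{-\sqrt{2n+m^2},\ \sqrt{2n+m^2}\big\}_{n=0}^{\infty}.$$
   Context: Pauli matrices: $\sigma_1=\begin{pmatrix}0&1\\1&0\end{pmatrix}$, $\sigma_2=\begin{pmatrix}0&-i\\i&0\end{pmatrix}$, $\sigma_3=\begin{pmatrix}1&0\\0&-1\end{pmatrix}$; Dirac matrices $\alpha_k=\begin{pmatrix}0&\sigma_k\\\sigma_k&0\end{pmatrix}$, $k=1,2,3$. For $m\ge0$ and $|\theta|<\frac{\pi}{2}$, the operator $H_\theta$ acts in $L^2(\mathbb{R})^4=L^2(\mathbb{R};\mathbb{C}^4)$ by $$H_\theta=-i\alpha_1e^{-i\theta/2}\partial_x-\alpha_2e^{i\theta/2}x+m\alpha_3,\qquad \mathsf{D}(H_\theta)=\mathcal{D}^4,\quad \mathcal{D}=H^1(\mathbb{R})\cap L^2(\mathbb{R},x^2\,dx).$$ *)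

theory Defs
  imports "HOL-Analysis.Analysis"
begin

text \<open>
  Elements of $L^2$ are represented by square-integrable functions, without passing to the
  quotient; equality of elements of $L^2$ is therefore equality almost everywhere and is written
  out as such wherever it occurs.
\<close>

definition L2 :: "'a measure \<Rightarrow> ('a \<Rightarrow> 'b::{banach, second_countable_topology}) set" where
  "L2 M = {f \<in> borel_measurable M. integrable M (\<lambda>x. (norm (f x))\<^sup>2)}"

definition L2_norm :: "'a measure \<Rightarrow> ('a \<Rightarrow> 'b::{banach, second_countable_topology}) \<Rightarrow> real" where
  "L2_norm M f = sqrt (\<integral>x. (norm (f x))\<^sup>2 \<partial>M)"

text \<open>
  An operator in $L^2(M)^n$ is a domain \<open>D\<close> together with an action \<open>A\<close> on
  representatives that is meaningful on \<open>D\<close> only. A number \<open>z\<close> is in the resolvent set if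
  \<open>A - z\<close> is injective on \<open>D\<close>, maps onto $L^2(M)^n$, and has a bounded inverse.
\<close>

definition resolvent_set ::
    "'a measure \<Rightarrow> ('a \<Rightarrow> complex^'n) set \<Rightarrow> (('a \<Rightarrow> complex^'n) \<Rightarrow> 'a \<Rightarrow> complex^'n) \<Rightarrow> complex set"
  where
  "resolvent_set M D A = {z.
     (\<forall>f\<in>D. \<forall>g\<in>D. (AE x in M. A f x - z *s f x = A g x - z *s g x) \<longrightarrow> (AE x in M. f x = g x)) \<and>
     (\<forall>h\<in>L2 M. \<exists>f\<in>D. AE x in M. A f x - z *s f x = h x) \<and>
     (\<exists>C. \<forall>f\<in>D. L2_norm M f \<le> C * L2_norm M (\<lambda>x. A f x - z *s f x))}"

definition spectrum ::
    "'a measure \<Rightarrow> ('a \<Rightarrow> complex^'n) set \<Rightarrow> (('a \<Rightarrow> complex^'n) \<Rightarrow> 'a \<Rightarrow> complex^'n) \<Rightarrow> complex set"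
  where
  "spectrum M D A = - resolvent_set M D A"

definition test_function :: "(real \<Rightarrow> real) \<Rightarrow> bool" where
  "test_function \<phi> \<longleftrightarrow>
     (\<forall>k x. (deriv ^^ k) \<phi> differentiable (at x)) \<and> compact (closure {x. \<phi> x \<noteq> 0})"

text \<open>
  Used for square-integrable \<open>u\<close> and \<open>v\<close> only, so that both integrals converge.
\<close>

definition has_weak_deriv :: "(real \<Rightarrow> complex) \<Rightarrow> (real \<Rightarrow> complex) \<Rightarrow> bool" where
  "has_weak_deriv u v \<longleftrightarrow>
     (\<forall>\<phi>. test_function \<phi> \<longrightarrow>
        (\<integral>x. u x * complex_of_real (deriv \<phi> x) \<partial>lborel) =
        - (\<integral>x. v x * complex_of_real (\<phi> x) \<partial>lborel))"

definition H1 :: "(real \<Rightarrow> complex) set" where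
  "H1 = {u \<in> L2 lborel. \<exists>v\<in>L2 lborel. has_weak_deriv u v}"

text \<open>
  For \<open>u\<close> in $H^1$ the weak derivative is unique up to equality almost everywhere.
\<close>

definition weak_deriv :: "(real \<Rightarrow> complex) \<Rightarrow> real \<Rightarrow> complex" where
  "weak_deriv u = (SOME v. v \<in> L2 lborel \<and> has_weak_deriv u v)"

definition pauli1 :: "complex^2^2" where
  "pauli1 = vector [vector [0, 1], vector [1, 0]]"

definition pauli2 :: "complex^2^2" where
  "pauli2 = vector [vector [0, - \<i>], vector [\<i>, 0]]"

definition pauli3 :: "complex^2^2" where
  "pauli3 = vector [vector [1, 0], vector [0, - 1]]"

definition off_diagonal :: "complex^2^2 \<Rightarrow> complex^4^4" where
  "off_diagonal S = vector
     [vector [0, 0, S$1$1, S$1$2],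
      vector [0, 0, S$2$1, S$2$2],
      vector [S$1$1, S$1$2, 0, 0],
      vector [S$2$1, S$2$2, 0, 0]]"

definition dirac1 :: "complex^4^4" where "dirac1 = off_diagonal pauli1"
definition dirac2 :: "complex^4^4" where "dirac2 = off_diagonal pauli2"
definition dirac3 :: "complex^4^4" where "dirac3 = off_diagonal pauli3"

definition dirac_domain :: "(real \<Rightarrow> complex^4) set" where
  "dirac_domain =
     {f. \<forall>k. (\<lambda>x. f x $ k) \<in> H1 \<inter> L2 (density lborel (\<lambda>x. ennreal (x\<^sup>2)))}"

definition dirac_op :: "real \<Rightarrow> real \<Rightarrow> (real \<Rightarrow> complex^4) \<Rightarrow> real \<Rightarrow> complex^4" where
  "dirac_op m \<theta> f = (\<lambda>x.
     (- \<i> * exp (- \<i> * complex_of_real \<theta> / 2)) *s (dirac1 *v (\<chi> k. weak_deriv (\<lambda>y. f y $ k) x))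
     - (exp (\<i> * complex_of_real \<theta> / 2) * complex_of_real x) *s (dirac2 *v f x)
     + complex_of_real m *s (dirac3 *v f x))"

end

theory Submission
  imports Defs
begin

text \<open>
  Put $c = e^{-i\theta/2}$, $s = \bar c$, $a = c\,\partial_x + s x$ and $b = -c\,\partial_x + s x$, so
  that $ab - ba = 2$. Then $H_\theta^2 - m^2$ is diagonal with entries $ba, ab, ba, ab$, and
  $(H_\theta - z)^{-1} = (H_\theta + z)(H_\theta^2 - z^2)^{-1}$; the claim reduces to the spectrum
  $\{0, 2, 4, \dots\}$ of $ba$.

  Eigenfunctions come from the Gaussian $e^{-s^2 x^2/2}$ in the kernel of $a$ by applying powers
  of $b$. For the converse, $\mathrm{Re}\,\langle (ba + 1) u, u\rangle =
  \cos\theta\,(\|u'\|^2 + \|x u\|^2)$, so $ba - w$ is bounded below when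
  $\mathrm{Re}\,w < -1$. At $w = -2$ the operator is $ab$ and is inverted by solving two
  first-order equations; Neumann series carry this to the whole half-plane; and
  $(ba - w)^{-1} = w^{-1} (b\,(ab - w)^{-1} a - 1)$ together with $ab - w = ba - (w - 2)$ moves
  it to the right in steps of $2$, for as long as $w \neq 0$. Injectivity and boundedness of the
  inverse for $H_\theta - z$ follow from bounded solvability, since $H_\theta$ is similar to its
  own transpose.

  Elements of the domain are handled through their absolutely continuous representatives.
\<close>

section \<open>Test functions and the fundamental lemma of the calculus of variations\<close>

text \<open>For \<theta> \<noteq> 0 the operator \<open>ba\<close> is not normal: neither an
  orthonormal basis of eigenfunctions nor the distance to the spectrum controls its inverse, so
  solvability is established by hand. Only |c| = 1 and Re c^2 = cos \<theta> > 0 enter. The point -2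
  serves as the start because the operator factors there in the favourable order: \<open>a\<close>
  is onto, and its kernel, the Gaussian, supplies exactly the freedom needed to meet the one
  orthogonality condition for the range of \<open>b\<close>. Pairings are bilinear, since
  \<open>a\<close> and \<open>b\<close> are transposes of each other, whereas adjoints would turn
  \<theta> into -\<theta>. Second-order equations are kept as pairs of first-order ones, so no
  second derivative appears; in exchange every solution of a first-order equation has to be shown to
  lie in the domain. This is the main analytic task, done by weighted estimates on bounded intervals
  with constants independent of the interval.\<close>

definition flat_exp :: "nat \<Rightarrow> real \<Rightarrow> real" where
  "flat_exp j x = (if x > 0 then exp (- 1 / x) / x ^ j else 0)"

lemma power_le_fact_exp:
  fixes t :: real assumes "0 \<le> t"
  shows "t ^ n \<le> fact n * exp t"
proof -
  have "t ^ n / fact n = (\<Sum>k\<in>{n}. inverse (fact k) *\<^sub>R t ^ k)"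
    by (simp add: field_simps)
  also have "\<dots> \<le> (\<Sum>k. inverse (fact k) *\<^sub>R t ^ k)"
    by (rule sum_le_suminf[OF summable_exp_generic]) (use assms in auto)
  also have "\<dots> = exp t" by (simp add: exp_def)
  finally show ?thesis by (simp add: field_simps)
qed

text \<open>The term of order \<open>j + 2\<close> in the series of \<open>exp (1 / x)\<close>
  outweighs \<open>1 / x ^ j\<close> and leaves a factor \<open>x\<^sup>2\<close>, one power more
  than continuity at 0 would need.\<close>

lemma flat_exp_le: "\<bar>flat_exp j x\<bar> \<le> fact (j + 2) * x\<^sup>2"
proof (cases "x > 0")
  case True
  have "(1 / x) ^ (j + 2) \<le> fact (j + 2) * exp (1 / x)"
    by (rule power_le_fact_exp) (use True in auto)
  hence "1 / (x ^ j * x\<^sup>2) \<le> fact (j + 2) * exp (1 / x)"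
    by (simp add: power_divide power_add del: fact_Suc add_2_eq_Suc')
  hence "exp (- 1 / x) / x ^ j \<le> fact (j + 2) * x\<^sup>2"
    using True by (simp add: exp_minus field_simps)
  thus ?thesis using True by (simp add: flat_exp_def)
qed (auto simp: flat_exp_def)

text \<open>The family is closed under differentiation up to linear combinations, which is why the
  power of \<open>x\<close> is a parameter. At 0 the quadratic bound sends the difference quotient
  to 0.\<close>

lemma flat_exp_deriv:
  "(flat_exp j has_real_derivative (flat_exp (j + 2) x - of_nat j * flat_exp (j + 1) x)) (at x)"
proof -
  consider "x > 0" | "x < 0" | "x = 0" by linarith
  then show ?thesis
  proof cases
    case 1
    have "((\<lambda>x. exp (- 1 / x) / x ^ j) has_real_derivative
        (flat_exp (j + 2) x - of_nat j * flat_exp (j + 1) x)) (at x)"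
    proof (cases j)
      case 0
      thus ?thesis using 1
        by (auto intro!: derivative_eq_intros simp: flat_exp_def field_simps power2_eq_square)
    next
      case (Suc i)
      show ?thesis unfolding Suc using 1
        by (auto intro!: derivative_eq_intros simp del: of_nat_Suc simp: flat_exp_def divide_simps power2_eq_square)
          (cases i, auto simp: algebra_simps)
    qed
    thus ?thesis
      by (rule DERIV_cong_ev[THEN iffD1, rotated 3])
         (use 1 eventually_nhds_in_open[of "{0<..}" x] in \<open>auto simp: flat_exp_def elim!: eventually_mono\<close>)
  next
    case 2
    have "((\<lambda>x. 0) has_real_derivative 0) (at x)" by simp
    hence "(flat_exp j has_real_derivative 0) (at x)"
      by (rule DERIV_cong_ev[THEN iffD1, rotated 3])
         (use 2 eventually_nhds_in_open[of "{..<0}" x] in \<open>auto simp: flat_exp_def elim!: eventually_mono\<close>)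
    thus ?thesis using 2 by (simp add: flat_exp_def)
  next
    case 3
    have "((\<lambda>h. flat_exp j h / h) \<longlongrightarrow> 0) (at 0)"
    proof (rule Lim_null_comparison)
      show "\<forall>\<^sub>F h in at 0. norm (flat_exp j h / h) \<le> fact (j + 2) * \<bar>h\<bar>"
      proof (intro always_eventually allI)
        fix h :: real
        have "\<bar>flat_exp j h\<bar> \<le> (fact (j + 2) * \<bar>h\<bar>) * \<bar>h\<bar>"
          using flat_exp_le[of j h] by (simp add: power2_eq_square mult.assoc del: fact_Suc add_2_eq_Suc')
        thus "norm (flat_exp j h / h) \<le> fact (j + 2) * \<bar>h\<bar>"
          by (cases "h = 0") (auto simp: divide_le_eq simp del: fact_Suc add_2_eq_Suc')
      qed
      have "((\<lambda>h. fact (j + 2) * \<bar>h\<bar>) \<longlongrightarrow> fact (j + 2) * \<bar>0::real\<bar>) (at 0)"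
        by (intro tendsto_intros)
      thus "((\<lambda>h. fact (j + 2) * \<bar>h\<bar>) \<longlongrightarrow> (0::real)) (at 0)" by simp
    qed
    thus ?thesis using 3 by (simp add: DERIV_def flat_exp_def)
  qed
qed

text \<open>A class closed under differentiation, so that one induction settles all the iterated
  derivatives in \<open>test_function\<close>. Products of two flat factors facing each other have
  compact support.\<close>

inductive_set bump_algebra :: "(real \<Rightarrow> real) set" where
  const: "(\<lambda>_. c) \<in> bump_algebra"
| flat: "(\<lambda>x. flat_exp j (p * x + q)) \<in> bump_algebra"
| add: "f \<in> bump_algebra \<Longrightarrow> g \<in> bump_algebra \<Longrightarrow> (\<lambda>x. f x + g x) \<in> bump_algebra"
| mult: "f \<in> bump_algebra \<Longrightarrow> g \<in> bump_algebra \<Longrightarrow> (\<lambda>x. f x * g x) \<in> bump_algebra"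

lemma bump_algebra_deriv:
  assumes "f \<in> bump_algebra"
  shows "\<exists>f'\<in>bump_algebra. \<forall>x. (f has_real_derivative f' x) (at x)"
  using assms
proof induction
  case (const c)
  show ?case by (rule bexI[OF _ bump_algebra.const[of 0]]) simp
next
  case (flat j p q)
  let ?f = "\<lambda>x. (flat_exp (j + 2) (p * x + q) + (- real j) * flat_exp (j + 1) (p * x + q)) * p"
  have "?f \<in> bump_algebra"
    by (intro bump_algebra.intros)
  moreover have "((\<lambda>x. flat_exp j (p * x + q)) has_real_derivative ?f x) (at x)" for x
    by (rule DERIV_chain2[OF flat_exp_deriv, THEN DERIV_cong]) (auto intro!: derivative_eq_intros)
  ultimately show ?case by (intro bexI[of _ ?f]) auto
next
  case (add f g)
  then obtain f' g' where "f' \<in> bump_algebra" "g' \<in> bump_algebra"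
    "\<And>x. (f has_real_derivative f' x) (at x)" "\<And>x. (g has_real_derivative g' x) (at x)" by blast
  thus ?case by (intro bexI[of _ "\<lambda>x. f' x + g' x"] bump_algebra.intros) (auto intro: DERIV_add)
next
  case (mult f g)
  then obtain f' g' where "f' \<in> bump_algebra" "g' \<in> bump_algebra"
    "\<And>x. (f has_real_derivative f' x) (at x)" "\<And>x. (g has_real_derivative g' x) (at x)" by blast
  thus ?case using mult.hyps by (intro bexI[of _ "\<lambda>x. f' x * g x + g' x * f x"] bump_algebra.intros) (auto intro: DERIV_mult)
qed

lemma bump_algebra_iter_deriv: "f \<in> bump_algebra \<Longrightarrow> (deriv ^^ k) f \<in> bump_algebra"
proof (induction k)
  case (Suc k)
  then obtain g where "g \<in> bump_algebra" "\<And>x. ((deriv ^^ k) f has_real_derivative g x) (at x)"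
    using bump_algebra_deriv by blast
  moreover from this have "deriv ((deriv ^^ k) f) = g" by (auto intro: DERIV_imp_deriv)
  ultimately show ?case by simp
qed auto

lemma bump_algebra_differentiable: "f \<in> bump_algebra \<Longrightarrow> (deriv ^^ k) f differentiable (at x)"
  using bump_algebra_deriv[OF bump_algebra_iter_deriv]
  by (meson real_differentiable_def)

lemma compact_support_iff:
  fixes f :: "real \<Rightarrow> real"
  shows "compact (closure {x. f x \<noteq> 0}) \<longleftrightarrow> (\<exists>R>0. \<forall>x. \<bar>x\<bar> > R \<longrightarrow> f x = 0)"
proof -
  have "bounded {x. f x \<noteq> 0} \<longleftrightarrow> (\<exists>R>0. \<forall>x. \<bar>x\<bar> > R \<longrightarrow> f x = 0)"
    unfolding bounded_pos by (auto simp: not_less[symmetric])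
  thus ?thesis by (metis bounded_closure bounded_subset closed_closure closure_subset compact_eq_bounded_closed)
qed

lemma test_function_bump:
  assumes "f \<in> bump_algebra" "\<And>x. \<bar>x\<bar> > R \<Longrightarrow> f x = 0"
  shows "test_function f"
proof -
  have "\<exists>R>0. \<forall>x. \<bar>x\<bar> > R \<longrightarrow> f x = 0"
    by (intro exI[of _ "max R 1"]) (use assms(2) in auto)
  thus ?thesis
    unfolding test_function_def compact_support_iff
    using bump_algebra_differentiable[OF assms(1)] by blast
qed

text \<open>For antiderivatives of bumps: the function itself may leave \<open>bump_algebra\<close>,
  but all its derivatives from the first on belong to it.\<close>

lemma test_function_antideriv:
  assumes "f \<in> bump_algebra" "\<And>x. (\<phi> has_real_derivative f x) (at x)" "\<And>x. \<bar>x\<bar> > R \<Longrightarrow> \<phi> x = 0"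
  shows "test_function \<phi>"
proof -
  have d: "deriv \<phi> = f" using assms(2) by (auto intro: DERIV_imp_deriv)
  have "(deriv ^^ k) \<phi> differentiable (at x)" for k x
  proof (cases k)
    case 0 thus ?thesis using assms(2) by (auto simp: real_differentiable_def)
  next
    case (Suc j)
    have "(deriv ^^ k) \<phi> = (deriv ^^ j) f"
      unfolding Suc funpow_Suc_right using d by simp
    thus ?thesis using bump_algebra_differentiable[OF assms(1)] by simp
  qed
  moreover have "\<exists>R>0. \<forall>x. \<bar>x\<bar> > R \<longrightarrow> \<phi> x = 0"
    by (intro exI[of _ "max R 1"]) (use assms(3) in auto)
  ultimately show ?thesis unfolding test_function_def compact_support_iff by blast
qed

lemma test_function_props:
  assumes "test_function \<phi>"
  obtains R where "R > 0" "\<And>x. \<bar>x\<bar> \<ge> R \<Longrightarrow> \<phi> x = 0" "\<And>x. \<bar>x\<bar> \<ge> R \<Longrightarrow> deriv \<phi> x = 0"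
    "\<And>x. (\<phi> has_real_derivative deriv \<phi> x) (at x)" "continuous_on UNIV (deriv \<phi>)"
    "continuous_on UNIV \<phi>"
proof -
  from assms obtain R where R: "R > 0" "\<And>x. \<bar>x\<bar> > R \<Longrightarrow> \<phi> x = 0"
    unfolding test_function_def compact_support_iff by blast
  have d: "(deriv ^^ k) \<phi> differentiable (at x)" for k x using assms by (simp add: test_function_def)
  have 1: "(\<phi> has_real_derivative deriv \<phi> x) (at x)" for x
    using d[of 0 x] by (simp add: DERIV_deriv_iff_real_differentiable)
  have 2: "continuous_on UNIV (deriv \<phi>)"
    using d[of 1] by (auto intro!: differentiable_imp_continuous_on simp: differentiable_on_def
        intro: differentiable_at_withinI)
  have 3: "continuous_on UNIV \<phi>"
    using d[of 0] by (auto intro!: differentiable_imp_continuous_on simp: differentiable_on_def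
        intro: differentiable_at_withinI)
  have 4: "deriv \<phi> x = 0" if "\<bar>x\<bar> \<ge> R + 1" for x
  proof -
    have "((\<lambda>x. 0) has_real_derivative 0) (at x)" by simp
    hence "(\<phi> has_real_derivative 0) (at x)"
      by (rule DERIV_cong_ev[THEN iffD1, rotated 3])
         (use that R eventually_nhds_in_open[of "{x. \<bar>x\<bar> > R}" x] in
           \<open>auto simp: open_Collect_less continuous_intros elim!: eventually_mono\<close>)
    thus ?thesis by (rule DERIV_imp_deriv)
  qed
  show thesis by (rule that[of "R + 1"]) (use R 1 2 3 4 in auto)
qed

definition loc_integrable :: "(real \<Rightarrow> complex) \<Rightarrow> bool" where
  "loc_integrable f \<longleftrightarrow> f \<in> borel_measurable borel \<and> (\<forall>a b. set_integrable lborel {a..b} f)"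

lemma integral_Iic_eq_interval:
  fixes f :: "real \<Rightarrow> complex"
  shows "(LBINT x:{..a}. indicator {- r..r} x *\<^sub>R f x) = (LBINT x:{- r..min a r}. f x)"
  unfolding set_lebesgue_integral_def
  by (intro Bochner_Integration.integral_cong) (auto simp: indicator_def)

text \<open>After truncation to a bounded interval, the sets over which the integral vanishes form a
  Dynkin system containing the half-lines, which are stable under intersection and generate the
  Borel sets.\<close>

lemma AE_zero_if_interval_integrals_zero:
  assumes f: "loc_integrable f" and z: "\<And>a b. a \<le> b \<Longrightarrow> (LBINT x:{a..b}. f x) = 0"
  shows "AE x in lborel. f x = 0"
proof -
  have "AE x in lborel. indicator {- real n..real n} x *\<^sub>R f x = 0" for n
  proof (rule sigma_finite_measure.density_zero[OF sigma_finite_lborel])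
    let ?g = "\<lambda>x. indicator {- real n..real n} x *\<^sub>R f x"
    show g: "integrable lborel ?g" using f by (auto simp: loc_integrable_def set_integrable_def)
    have atm: "(LBINT x:{..a}. ?g x) = 0" for a
    proof (cases "- real n \<le> min a (real n)")
      case True thus ?thesis unfolding integral_Iic_eq_interval by (rule z)
    next
      case False thus ?thesis unfolding integral_Iic_eq_interval by (simp add: set_lebesgue_integral_def)
    qed
    have tot: "(LINT x|lborel. ?g x) = 0"
      using z[of "- real n" "real n"] by (simp add: set_lebesgue_integral_def)
    have gA: "set_integrable lborel A ?g" if "A \<in> sets borel" for A
      using integrable_mult_indicator[of A lborel ?g] g that by (simp add: set_integrable_def)
    fix A assume "A \<in> sets (lborel::real measure)"
    hence A: "A \<in> sigma_sets UNIV (range (\<lambda>a::real. {..a}))"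
      by (simp add: borel_eq_atMost)
    have "Int_stable (range (\<lambda>a::real. {..a}))" by (auto simp: Int_stable_def)
    moreover have "range (\<lambda>a::real. {..a}) \<subseteq> Pow UNIV" by simp
    ultimately show "(LINT x:A|lborel. ?g x) = 0"
      using A
    proof (induction rule: sigma_sets_induct_disjoint)
      case (basic A) thus ?case using atm by auto
    next
      case empty thus ?case by (simp add: set_lebesgue_integral_def)
    next
      case (compl A)
      have A: "A \<in> sets borel" using compl.hyps by (simp add: borel_eq_atMost)
      have "(LINT x:A \<union> (UNIV - A)|lborel. ?g x) = (LINT x:A|lborel. ?g x) + (LINT x:(UNIV - A)|lborel. ?g x)"
        by (rule set_integral_Un) (use A gA in auto)
      thus ?case using compl tot by (simp add: set_lebesgue_integral_def)
    next
      case (union A)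
      have A: "A i \<in> sets borel" for i using union.hyps(2) by (auto simp: borel_eq_atMost)
      have "(LINT x:(\<Union>i. A i)|lborel. ?g x) = (\<Sum>i. (LINT x:(A i)|lborel. ?g x))"
        by (rule lebesgue_integral_countable_add) (use A gA union.hyps(1) in \<open>auto simp: disjoint_family_on_def\<close>)
      thus ?case using union by simp
    qed
  qed
  hence "AE x in lborel. \<forall>n. indicator {- real n..real n} x *\<^sub>R f x = 0" unfolding AE_all_countable by blast
  thus ?thesis
  proof eventually_elim
    case (elim x)
    obtain n where "\<bar>x\<bar> \<le> real n" using real_arch_simple by blast
    thus ?case using elim[rule_format, of n] by (auto simp: indicator_def split: if_splits)
  qed
qed

text \<open>The bumps \<open>\<phi> n\<close>, which equal exp(-1/(n(x-a))) exp(-1/(n(b-x))) on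
  (a,b) and 0 elsewhere, tend boundedly to the indicator of the interval. Testing only against
  \<open>bump_algebra\<close> matters later, where the test function is corrected within the algebra
  before it is integrated.\<close>

lemma fundamental_lemma:
  assumes f: "loc_integrable f"
    and z: "\<And>\<phi>. \<phi> \<in> bump_algebra \<Longrightarrow> test_function \<phi> \<Longrightarrow> (LBINT x. f x * complex_of_real (\<phi> x)) = 0"
  shows "AE x in lborel. f x = 0"
proof (rule AE_zero_if_interval_integrals_zero[OF f])
  fix a b :: real assume "a \<le> b"
  define \<phi> where "\<phi> n x = flat_exp 0 (real n * x + (- real n * a)) * flat_exp 0 ((- real n) * x + real n * b)" for n x
  have supp: "\<phi> n x = 0" if "x \<notin> {a..b}" for n x
    using that by (auto simp: \<phi>_def flat_exp_def zero_less_mult_iff simp flip: right_diff_distrib)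
  have B: "\<phi> n \<in> bump_algebra" for n
    unfolding \<phi>_def by (intro bump_algebra.intros)
  have T: "test_function (\<phi> n)" for n
    by (rule test_function_bump[OF B, of "max \<bar>a\<bar> \<bar>b\<bar>"]) (rule supp, auto)
  have bd1: "0 \<le> flat_exp 0 x \<and> flat_exp 0 x \<le> 1" for x by (auto simp: flat_exp_def)
  have bd: "\<bar>\<phi> n x\<bar> \<le> 1" for n x
    using bd1 by (auto simp: \<phi>_def abs_mult intro!: mult_le_one)
  have lim1: "(\<lambda>n. flat_exp 0 (real n * y)) \<longlonglongrightarrow> 1" if "y > 0" for y
  proof -
    have "(\<lambda>n. exp (inverse (real n) * (- 1 / y))) \<longlonglongrightarrow> exp (0 * (- 1 / y))"
      by (intro tendsto_intros lim_inverse_n)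
    hence "(\<lambda>n. exp (- 1 / (real n * y))) \<longlonglongrightarrow> 1" by (simp add: field_simps)
    moreover have "eventually (\<lambda>n. flat_exp 0 (real n * y) = exp (- 1 / (real n * y))) sequentially"
      using eventually_gt_at_top[of 0] by eventually_elim (use that in \<open>auto simp: flat_exp_def\<close>)
    ultimately show ?thesis by (simp add: tendsto_cong)
  qed
  have lim: "(\<lambda>n. \<phi> n x) \<longlonglongrightarrow> 1" if "a < x" "x < b" for x
  proof -
    have "(\<lambda>n. flat_exp 0 (real n * (x - a)) * flat_exp 0 (real n * (b - x))) \<longlonglongrightarrow> 1 * 1"
      by (intro tendsto_mult lim1) (use that in auto)
    thus ?thesis by (simp add: \<phi>_def algebra_simps)
  qed
  have [measurable]: "f \<in> borel_measurable borel" using f by (simp add: loc_integrable_def)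
  have cont: "continuous_on UNIV (\<phi> n)" for n using test_function_props[OF T] by blast
  have [measurable]: "\<phi> n \<in> borel_measurable borel" for n
    by (rule borel_measurable_continuous_onI[OF cont])
  have "(\<lambda>n. LBINT x. f x * complex_of_real (\<phi> n x)) \<longlonglongrightarrow> (LBINT x. indicator {a..b} x *\<^sub>R f x)"
  proof (rule integral_dominated_convergence[where w = "\<lambda>x. norm (indicator {a..b} x *\<^sub>R f x)"])
    show "integrable lborel (\<lambda>x. norm (indicator {a..b} x *\<^sub>R f x))"
      using f by (intro integrable_norm) (simp add: loc_integrable_def set_integrable_def)
    have "AE x in lborel. x \<noteq> a \<and> x \<noteq> b" by (intro AE_conjI AE_lborel_singleton)
    thus "AE x in lborel. (\<lambda>n. f x * complex_of_real (\<phi> n x)) \<longlonglongrightarrow> indicator {a..b} x *\<^sub>R f x"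
    proof eventually_elim
      case (elim x)
      show ?case
      proof (cases "x \<in> {a..b}")
        case True
        hence "(\<lambda>n. f x * complex_of_real (\<phi> n x)) \<longlonglongrightarrow> f x * complex_of_real 1"
          by (intro tendsto_intros lim) (use elim in auto)
        thus ?thesis using True by simp
      qed (simp add: supp)
    qed
    show "AE x in lborel. norm (f x * complex_of_real (\<phi> n x)) \<le> norm (indicator {a..b} x *\<^sub>R f x)" for n
      using bd[of n] supp[of _ n] by (intro AE_I2) (auto simp: norm_mult indicator_def mult_left_le)
  qed auto
  moreover have "(LBINT x. f x * complex_of_real (\<phi> n x)) = 0" for n by (rule z[OF B T])
  ultimately have "(\<lambda>n::nat. 0) \<longlonglongrightarrow> (LBINT x:{a..b}. f x)" by (simp add: set_lebesgue_integral_def)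
  thus "(LBINT x:{a..b}. f x) = 0" by (simp add: LIMSEQ_const_iff)
qed

section \<open>Absolutely continuous functions and weak derivatives\<close>

lemma loc_integrable_set: "loc_integrable f \<Longrightarrow> set_integrable lborel {a..b} f"
  by (simp add: loc_integrable_def)

lemma loc_integrable_measurable: "loc_integrable f \<Longrightarrow> f \<in> borel_measurable borel"
  by (simp add: loc_integrable_def)

lemma loc_integrable_continuous:
  assumes "continuous_on UNIV f" shows "loc_integrable f"
  unfolding loc_integrable_def
proof (intro conjI allI)
  show "f \<in> borel_measurable borel" using assms by (rule borel_measurable_continuous_onI)
  show "set_integrable lborel {a..b} f" for a b
    unfolding set_integrable_def
    by (rule borel_integrable_compact) (auto intro: continuous_on_subset[OF assms])
qed

lemma loc_integrable_mult_continuous: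
  assumes f: "loc_integrable f" and g: "continuous_on UNIV g"
  shows "loc_integrable (\<lambda>x. f x * g x)"
  unfolding loc_integrable_def
proof (intro conjI allI)
  have [measurable]: "f \<in> borel_measurable borel" "g \<in> borel_measurable borel"
    using f g borel_measurable_continuous_onI by (auto simp: loc_integrable_def)
  show "(\<lambda>x. f x * g x) \<in> borel_measurable borel" by measurable
  fix a b :: real
  have "bounded (g ` {a..b})"
    by (intro compact_imp_bounded compact_continuous_image continuous_on_subset[OF g]) auto
  then obtain K where K: "\<And>x. x \<in> {a..b} \<Longrightarrow> norm (g x) \<le> K" unfolding bounded_iff by blast
  have "set_integrable lborel {a..b} (\<lambda>x. of_real K * f x)"
    using f by (auto simp: loc_integrable_def)
  thus "set_integrable lborel {a..b} (\<lambda>x. f x * g x)"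
  proof (rule set_integrable_bound)
    show "set_borel_measurable lborel {a..b} (\<lambda>x. f x * g x)"
      unfolding set_borel_measurable_def by measurable
    show "AE x in lborel. x \<in> {a..b} \<longrightarrow> norm (f x * g x) \<le> norm (of_real K * f x)"
    proof (intro AE_I2 impI)
      fix x assume "x \<in> {a..b}"
      hence "norm (g x) \<le> \<bar>K\<bar>" using K[of x] by linarith
      thus "norm (f x * g x) \<le> norm (of_real K * f x)"
        by (simp add: norm_mult mult.commute[of "norm (f x)"] mult_right_mono)
    qed
  qed
qed

lemma loc_integrable_add: "loc_integrable f \<Longrightarrow> loc_integrable g \<Longrightarrow> loc_integrable (\<lambda>x. f x + g x)"
  by (auto simp: loc_integrable_def)

lemma loc_integrable_diff: "loc_integrable f \<Longrightarrow> loc_integrable g \<Longrightarrow> loc_integrable (\<lambda>x. f x - g x)"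
  by (auto simp: loc_integrable_def)

lemma loc_integrable_cmult: "loc_integrable f \<Longrightarrow> loc_integrable (\<lambda>x. c * f x)"
  by (auto simp: loc_integrable_def)

lemma interval_lborel_integral_combine:
  assumes "loc_integrable f" "a \<le> b" "b \<le> c"
  shows "(LBINT x:{a..c}. f x) = (LBINT x:{a..b}. f x) + (LBINT x:{b..c}. f x)"
proof -
  have i: "set_integrable lborel {p..q} f" for p q using assms by (rule_tac loc_integrable_set)
  have j: "f integrable_on {p..q}" "(LBINT x:{p..q}. f x) = integral {p..q} f" for p q
    using set_borel_integral_eq_integral[OF i] by auto
  show ?thesis unfolding j(2) using Henstock_Kurzweil_Integration.integral_combine[OF assms(2,3) j(1)] by simp
qed

text \<open>Absolute continuity in integrated form: \<open>u\<close> is fixed at every point,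
  \<open>v\<close> only up to null sets. Calculus then rests on integral identities and never on
  pointwise differentiation almost everywhere.\<close>

definition has_ac_deriv :: "(real \<Rightarrow> complex) \<Rightarrow> (real \<Rightarrow> complex) \<Rightarrow> bool" where
  "has_ac_deriv u v \<longleftrightarrow> loc_integrable v \<and> (\<forall>a b. a \<le> b \<longrightarrow> (LBINT x:{a..b}. v x) = u b - u a)"

lemma has_ac_derivD:
  assumes "has_ac_deriv u v"
  shows "loc_integrable v" "a \<le> b \<Longrightarrow> (LBINT x:{a..b}. v x) = u b - u a"
  using assms by (auto simp: has_ac_deriv_def)

lemma has_ac_deriv_integral:
  assumes "has_ac_deriv u v" "a \<le> x"
  shows "v integrable_on {a..x}" "u x = u a + integral {a..x} v"
  using set_borel_integral_eq_integral[OF loc_integrable_set[OF has_ac_derivD(1)[OF assms(1)], of a x]]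
    has_ac_derivD(2)[OF assms] by (auto simp: algebra_simps)

lemma has_ac_deriv_continuous:
  assumes "has_ac_deriv u v"
  shows "continuous_on UNIV u"
proof -
  have "isCont u x" for x
  proof -
    let ?a = "x - 1" and ?b = "x + 1"
    have "continuous_on {?a..?b} (\<lambda>y. u ?a + integral {?a..y} v)"
      by (intro continuous_intros indefinite_integral_continuous_1 has_ac_deriv_integral[OF assms]) auto
    hence "continuous_on {?a..?b} u"
      by (rule continuous_on_eq) (rule has_ac_deriv_integral(2)[OF assms, symmetric], auto)
    thus ?thesis by (rule continuous_on_interior) auto
  qed
  thus ?thesis by (simp add: continuous_on_eq_continuous_at)
qed

lemma has_ac_deriv_vector_derivative:
  assumes "has_ac_deriv u v" "continuous_on UNIV v"
  shows "(u has_vector_derivative v x) (at x)"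
proof -
  let ?a = "x - 1" and ?b = "x + 1"
  have "((\<lambda>y. u ?a + integral {?a..y} v) has_vector_derivative (0 + v x)) (at x within {?a..?b})"
    by (intro has_vector_derivative_add has_vector_derivative_const integral_has_vector_derivative
         continuous_on_subset[OF assms(2)]) auto
  hence "(u has_vector_derivative v x) (at x within {?a..?b})"
    by (rule has_vector_derivative_transform[rotated 2, THEN has_vector_derivative_eq_rhs])
       (auto intro!: has_ac_deriv_integral(2)[OF assms(1)])
  thus ?thesis by (simp add: at_within_Icc_at)
qed

lemma has_ac_deriv_C1:
  assumes "\<And>x. (u has_vector_derivative v x) (at x)" "continuous_on UNIV v"
  shows "has_ac_deriv u v"
  unfolding has_ac_deriv_def
proof (intro conjI allI impI)
  show l: "loc_integrable v" by (rule loc_integrable_continuous) fact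
  fix a b :: real assume "a \<le> b"
  have "(LBINT x:{a..b}. v x) = integral {a..b} v"
    by (rule set_borel_integral_eq_integral[OF loc_integrable_set[OF l]])
  also have "\<dots> = u b - u a"
    by (rule integral_unique, rule fundamental_theorem_of_calculus[OF \<open>a \<le> b\<close>])
       (auto intro: has_vector_derivative_at_within assms)
  finally show "(LBINT x:{a..b}. v x) = u b - u a" .
qed

lemma has_ac_deriv_const: "has_ac_deriv (\<lambda>_. c) (\<lambda>_. 0)"
  by (rule has_ac_deriv_C1) auto

lemma has_ac_deriv_of_real: "has_ac_deriv (\<lambda>x. of_real x) (\<lambda>_. 1)"
  by (rule has_ac_deriv_C1) (auto intro!: derivative_eq_intros)

lemma has_ac_deriv_add:
  assumes "has_ac_deriv u v" "has_ac_deriv w z" shows "has_ac_deriv (\<lambda>x. u x + w x) (\<lambda>x. v x + z x)"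
  using assms by (auto simp: has_ac_deriv_def loc_integrable_add loc_integrable_set)

lemma has_ac_deriv_cmult:
  assumes "has_ac_deriv u v" shows "has_ac_deriv (\<lambda>x. c * u x) (\<lambda>x. c * v x)"
  using assms by (auto simp: has_ac_deriv_def loc_integrable_cmult right_diff_distrib)

lemma has_ac_deriv_cnj:
  assumes "has_ac_deriv u v" shows "has_ac_deriv (\<lambda>x. cnj (u x)) (\<lambda>x. cnj (v x))"
proof -
  have [measurable]: "v \<in> borel_measurable borel" using has_ac_derivD(1)[OF assms] by (simp add: loc_integrable_def)
  have e: "indicator {a..b} x *\<^sub>R cnj (v x) = cnj (indicator {a..b} x *\<^sub>R v x)" for a b x
    by simp
  have "set_integrable lborel {a..b} (\<lambda>x. cnj (v x))" for a b
    using has_ac_derivD(1)[OF assms] unfolding loc_integrable_def set_integrable_def e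
    by (simp del: complex_cnj_scaleR)
  moreover have "(LBINT x:{a..b}. cnj (v x)) = cnj (LBINT x:{a..b}. v x)" for a b
    unfolding set_lebesgue_integral_def e by (simp del: complex_cnj_scaleR)
  moreover have "(\<lambda>x. cnj (v x)) \<in> borel_measurable borel"
    by (rule measurable_compose[OF _ borel_measurable_continuous_onI]) (auto intro: continuous_intros)
  ultimately show ?thesis
    using assms by (auto simp: has_ac_deriv_def loc_integrable_def)
qed

lemma has_ac_deriv_cong_AE:
  assumes "has_ac_deriv u v" "AE x in lborel. v x = w x" "w \<in> borel_measurable borel"
  shows "has_ac_deriv u w"
proof -
  have [measurable]: "v \<in> borel_measurable borel" using has_ac_derivD(1)[OF assms(1)] by (simp add: loc_integrable_def)
  note [measurable] = assms(3)
  have "set_integrable lborel {a..b} w" for a b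
    using loc_integrable_set[OF has_ac_derivD(1)[OF assms(1)], of a b]
    by (subst set_integrable_cong_AE[of w _ v])
       (use assms(2) in \<open>auto elim!: eventually_mono\<close>)
  moreover have "(LBINT x:{a..b}. w x) = (LBINT x:{a..b}. v x)" for a b
    by (rule set_lebesgue_integral_cong_AE) (use assms in \<open>auto elim!: eventually_mono\<close>)
  ultimately show ?thesis
    using assms by (auto simp: has_ac_deriv_def loc_integrable_def)
qed

lemma ac_antiderivative:
  assumes "loc_integrable v"
  obtains u where "has_ac_deriv u v" "u 0 = 0"
proof -
  define u where "u x = (if 0 \<le> x then LBINT t:{0..x}. v t else - (LBINT t:{x..0}. v t))" for x
  have "has_ac_deriv u v"
    unfolding has_ac_deriv_def
  proof (intro conjI allI impI)
    fix a b :: real assume ab: "a \<le> b"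
    consider "0 \<le> a" | "a < 0" "0 \<le> b" | "b < 0" by linarith
    thus "(LBINT x:{a..b}. v x) = u b - u a"
    proof cases
      case 1
      thus ?thesis using ab interval_lborel_integral_combine[OF assms, of 0 a b] by (simp add: u_def)
    next
      case 2
      thus ?thesis using ab interval_lborel_integral_combine[OF assms, of a 0 b] by (simp add: u_def)
    next
      case 3
      thus ?thesis using ab interval_lborel_integral_combine[OF assms, of a b 0] by (simp add: u_def)
    qed
  qed (rule assms)
  moreover have "u 0 = 0"
    using has_ac_derivD(2)[OF \<open>has_ac_deriv u v\<close>, of 0 0] by (simp add: u_def)
  ultimately show thesis by (rule that)
qed

lemma integrable_tensor:
  fixes f g :: "real \<Rightarrow> complex"
  assumes f: "integrable lborel f" and g: "integrable lborel g"
  shows "integrable (lborel \<Otimes>\<^sub>M lborel) (\<lambda>(x, y). f x * g y)"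
proof -
  have [measurable]: "f \<in> borel_measurable borel" "g \<in> borel_measurable borel"
    using f g by (auto dest: borel_measurable_integrable)
  show ?thesis
    by (rule lborel_pair.Fubini_integrable) (use f g in \<open>auto simp: norm_mult intro!: integrable_mult_left\<close>)
qed

text \<open>By Fubini: the product of the increments of \<open>u\<close> and \<open>w\<close> is the
  integral of f(x) g(y) over a square. Cutting along the diagonal and integrating each triangle in
  its inner variable first gives the two terms.\<close>

lemma has_ac_deriv_mult:
  assumes u: "has_ac_deriv u f" and w: "has_ac_deriv w g"
  shows "has_ac_deriv (\<lambda>x. u x * w x) (\<lambda>x. f x * w x + g x * u x)"
  unfolding has_ac_deriv_def
proof (intro conjI allI impI)
  note fl = has_ac_derivD(1)[OF u] and gl = has_ac_derivD(1)[OF w]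
  note cu = has_ac_deriv_continuous[OF u] and cw = has_ac_deriv_continuous[OF w]
  have fw: "loc_integrable (\<lambda>x. f x * w x)" and gu: "loc_integrable (\<lambda>x. g x * u x)"
    by (intro loc_integrable_mult_continuous fl gl cu cw)+
  thus "loc_integrable (\<lambda>x. f x * w x + g x * u x)" by (rule loc_integrable_add)
  fix a b :: real assume ab: "a \<le> b"
  have [measurable]: "f \<in> borel_measurable borel" "g \<in> borel_measurable borel"
    using fl gl by (auto simp: loc_integrable_def)
  define f1 where "f1 x = indicator {a..b} x *\<^sub>R f x" for x
  define g1 where "g1 x = indicator {a..b} x *\<^sub>R g x" for x
  have [measurable]: "f1 \<in> borel_measurable borel" "g1 \<in> borel_measurable borel"
    unfolding f1_def g1_def by measurable
  have f1: "integrable lborel f1" and g1: "integrable lborel g1"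
    using fl gl by (auto simp: loc_integrable_def set_integrable_def f1_def[abs_def] g1_def[abs_def])
  have F1: "(LBINT x. f1 x) = u b - u a" and G1: "(LBINT x. g1 x) = w b - w a"
    using has_ac_derivD(2)[OF u ab] has_ac_derivD(2)[OF w ab] by (auto simp: f1_def g1_def set_lebesgue_integral_def)
  let ?I = "\<lambda>x y. if y \<le> x then f1 x * g1 y else 0"
  let ?J = "\<lambda>x y. if y \<le> x then 0 else f1 x * g1 y"
  have T: "integrable (lborel \<Otimes>\<^sub>M lborel) (\<lambda>(x, y). f1 x * g1 y)" by (rule integrable_tensor[OF f1 g1])
  have I: "integrable (lborel \<Otimes>\<^sub>M lborel) (case_prod ?I)"
    by (rule Bochner_Integration.integrable_bound[OF T]) auto
  have J: "integrable (lborel \<Otimes>\<^sub>M lborel) (case_prod ?J)"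
    by (rule Bochner_Integration.integrable_bound[OF T]) auto
  have i1: "(LBINT y. ?I x y) = f1 x * (w x - w a)" for x
  proof (cases "x \<in> {a..b}")
    case True
    have "(LBINT y. ?I x y) = (LBINT y. f1 x * (indicator {a..x} y *\<^sub>R g y))"
      using True by (intro Bochner_Integration.integral_cong) (auto simp: g1_def indicator_def)
    also have "\<dots> = f1 x * (LBINT y:{a..x}. g y)"
      unfolding set_lebesgue_integral_def by (rule integral_mult_right_zero)
    also have "(LBINT y:{a..x}. g y) = w x - w a" using True by (intro has_ac_derivD(2)[OF w]) auto
    finally show ?thesis .
  next
    case False
    thus ?thesis by (simp add: f1_def cong: if_cong)
  qed
  have j1: "(LBINT x. ?J x y) = g1 y * (u y - u a)" for y
  proof (cases "y \<in> {a..b}")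
    case True
    have "(LBINT x. ?J x y) = (LBINT x. g1 y * (indicator {a..y} x *\<^sub>R f x))"
    proof (rule integral_cong_AE)
      \<comment> \<open>The second triangle omits the diagonal, whereas \<open>{a..y}\<close>
        contains its endpoint; the two integrands differ at most at x = y.\<close>
      have "AE x in lborel. x \<noteq> y" by (rule AE_lborel_singleton)
      thus "AE x in lborel. ?J x y = g1 y * (indicator {a..y} x *\<^sub>R f x)"
        by eventually_elim (use True in \<open>auto simp: f1_def indicator_def\<close>)
    qed auto
    also have "\<dots> = g1 y * (LBINT x:{a..y}. f x)"
      unfolding set_lebesgue_integral_def by (rule integral_mult_right_zero)
    also have "(LBINT x:{a..y}. f x) = u y - u a" using True by (intro has_ac_derivD(2)[OF u]) auto
    finally show ?thesis .
  next
    case False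
    thus ?thesis by (simp add: g1_def cong: if_cong)
  qed
  have fwi: "integrable lborel (\<lambda>x. f1 x * w x)" and gui: "integrable lborel (\<lambda>x. g1 x * u x)"
    using loc_integrable_set[OF fw, of a b] loc_integrable_set[OF gu, of a b]
    by (auto simp: set_integrable_def f1_def g1_def)
  have "(u b - u a) * (w b - w a) = (LBINT x. (LBINT y. f1 x * g1 y))"
    using F1 G1 by simp
  also have "\<dots> = (LBINT x. (LBINT y. ?I x y + ?J x y))"
    by (intro Bochner_Integration.integral_cong) auto
  also have "\<dots> = (\<integral>p. (case_prod ?I p + case_prod ?J p) \<partial>(lborel \<Otimes>\<^sub>M lborel))"
    by (subst lborel_pair.integral_fst'[symmetric]) (use I J in auto)
  also have "\<dots> = (LBINT x. (LBINT y. ?I x y)) + (LBINT y. (LBINT x. ?J x y))"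
    using lborel_pair.integral_fst[OF I] lborel_pair.integral_snd[OF J] I J by simp
  also have "\<dots> = (LBINT x. f1 x * (w x - w a)) + (LBINT x. g1 x * (u x - u a))"
    by (simp only: i1 j1)
  also have "\<dots> = (LBINT x. f1 x * w x) - (u b - u a) * w a + ((LBINT x. g1 x * u x) - (w b - w a) * u a)"
    using f1 g1 fwi gui F1 G1 by (simp add: right_diff_distrib)
  also have "\<dots> = (LBINT x:{a..b}. f x * w x + g x * u x) - (u b - u a) * w a - (w b - w a) * u a"
    unfolding set_integral_add(2)[OF loc_integrable_set[OF fw] loc_integrable_set[OF gu]]
    by (simp add: set_lebesgue_integral_def f1_def g1_def)
  finally show "(LBINT x:{a..b}. f x * w x + g x * u x) = u b * w b - u a * w a"
    by (simp add: algebra_simps)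
qed

section \<open>Weak derivatives and absolutely continuous representatives\<close>

lemma integral_eq_interval_integral:
  fixes f :: "real \<Rightarrow> complex"
  assumes "\<And>x. x \<notin> {a..b} \<Longrightarrow> f x = 0"
  shows "(LBINT x. f x) = (LBINT x:{a..b}. f x)"
  unfolding set_lebesgue_integral_def
  by (intro Bochner_Integration.integral_cong) (use assms in \<open>auto simp: indicator_def\<close>)

lemma integrable_if_supported:
  assumes "loc_integrable f" "\<And>x. x \<notin> {a..b} \<Longrightarrow> f x = 0"
  shows "integrable lborel f"
proof -
  have "integrable lborel (\<lambda>x. indicator {a..b} x *\<^sub>R f x)"
    using loc_integrable_set[OF assms(1)] by (simp add: set_integrable_def)
  moreover have "(\<lambda>x. indicator {a..b} x *\<^sub>R f x) = f" using assms(2) by (auto simp: indicator_def fun_eq_iff)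
  ultimately show ?thesis by simp
qed

lemma test_function_ac:
  assumes "test_function \<phi>"
  shows "has_ac_deriv (\<lambda>x. of_real (\<phi> x)) (\<lambda>x. of_real (deriv \<phi> x))"
proof (rule has_ac_deriv_C1)
  obtain "\<And>x. (\<phi> has_real_derivative deriv \<phi> x) (at x)" "continuous_on UNIV (deriv \<phi>)"
    using test_function_props[OF assms] by metis
  thus "((\<lambda>x. of_real (\<phi> x)) has_vector_derivative of_real (deriv \<phi> x)) (at x)"
    "continuous_on UNIV (\<lambda>x. complex_of_real (deriv \<phi> x))" for x
    by (auto intro!: has_vector_derivative_of_real continuous_intros
      simp: has_real_derivative_iff_has_vector_derivative)
qed

lemma integrable_mult_test_function:
  assumes "test_function \<phi>" "loc_integrable u"
  shows "integrable lborel (\<lambda>x. u x * of_real (\<phi> x))" "integrable lborel (\<lambda>x. u x * of_real (deriv \<phi> x))"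
proof -
  obtain R where R: "R > 0" "\<And>x. \<bar>x\<bar> \<ge> R \<Longrightarrow> \<phi> x = 0" "\<And>x. \<bar>x\<bar> \<ge> R \<Longrightarrow> deriv \<phi> x = 0"
    "continuous_on UNIV (deriv \<phi>)" "continuous_on UNIV \<phi>"
    using test_function_props[OF assms(1)] by metis
  show "integrable lborel (\<lambda>x. u x * of_real (\<phi> x))"
    by (rule integrable_if_supported[where a="-R" and b=R, OF loc_integrable_mult_continuous])
       (use assms R in \<open>auto intro!: continuous_intros\<close>)
  show "integrable lborel (\<lambda>x. u x * of_real (deriv \<phi> x))"
    by (rule integrable_if_supported[where a="-R" and b=R, OF loc_integrable_mult_continuous])
       (use assms R in \<open>auto intro!: continuous_intros\<close>)
qed

lemma has_ac_deriv_imp_has_weak_deriv: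
  assumes "has_ac_deriv u v" shows "has_weak_deriv u v"
  unfolding has_weak_deriv_def
proof (intro allI impI)
  fix \<phi> assume T: "test_function \<phi>"
  obtain R where R: "R > 0" "\<And>x. \<bar>x\<bar> \<ge> R \<Longrightarrow> \<phi> x = 0" "\<And>x. \<bar>x\<bar> \<ge> R \<Longrightarrow> deriv \<phi> x = 0"
    using test_function_props[OF T] by metis
  note i = integrable_mult_test_function[OF T]
  have "has_ac_deriv (\<lambda>x. u x * of_real (\<phi> x)) (\<lambda>x. v x * of_real (\<phi> x) + of_real (deriv \<phi> x) * u x)"
    by (intro has_ac_deriv_mult assms test_function_ac T)
  from has_ac_derivD(2)[OF this, of "-R" R]
  have "0 = (LBINT x:{-R..R}. v x * of_real (\<phi> x) + of_real (deriv \<phi> x) * u x)"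
    using R by simp
  also have "\<dots> = (LBINT x. v x * of_real (\<phi> x) + of_real (deriv \<phi> x) * u x)"
    by (rule integral_eq_interval_integral[symmetric]) (use R in auto)
  also have "\<dots> = (LBINT x. v x * of_real (\<phi> x)) + (LBINT x. u x * of_real (deriv \<phi> x))"
    using i(1)[OF has_ac_derivD(1)[OF assms]]
      i(2)[OF loc_integrable_continuous[OF has_ac_deriv_continuous[OF assms]]]
    by (simp add: mult.commute)
  finally show "(LBINT x. u x * of_real (deriv \<phi> x)) = - (LBINT x. v x * of_real (\<phi> x))"
    by (simp add: eq_neg_iff_add_eq_0 add.commute)
qed

lemma has_weak_deriv_unique:
  assumes "has_weak_deriv u v" "has_weak_deriv u w" "loc_integrable v" "loc_integrable w"
  shows "AE x in lborel. v x = w x"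
proof -
  have "AE x in lborel. v x - w x = 0"
  proof (rule fundamental_lemma[OF loc_integrable_diff[OF assms(3,4)]])
    fix \<phi> assume T: "test_function \<phi>"
    show "(LBINT x. (v x - w x) * of_real (\<phi> x)) = 0"
      using assms(1,2) T integrable_mult_test_function(1)[OF T] assms(3,4)
      by (auto simp: has_weak_deriv_def left_diff_distrib)
  qed
  thus ?thesis by eventually_elim simp
qed

text \<open>The vanishing integral is what makes the antiderivative compactly supported on the right
  as well as on the left.\<close>

lemma integral_bump_antiderivative:
  assumes R: "R > 0" and f: "f \<in> bump_algebra" and supp: "\<And>x. \<bar>x\<bar> > R \<Longrightarrow> f x = 0"
    and z: "(LBINT x. complex_of_real (f x)) = 0"
  obtains \<phi> where "test_function \<phi>" "deriv \<phi> = f"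
proof -
  obtain f' where "\<And>x. (f has_real_derivative f' x) (at x)" using bump_algebra_deriv[OF f] by blast
  hence cf: "continuous_on UNIV f" by (meson DERIV_isCont continuous_at_imp_continuous_on)
  hence cc: "continuous_on UNIV (\<lambda>x. complex_of_real (f x))" by (intro continuous_intros)
  obtain U where U: "has_ac_deriv U (\<lambda>x. complex_of_real (f x))"
    using ac_antiderivative[OF loc_integrable_continuous[OF cc]] by blast
  \<comment> \<open>The base point \<open>- R - 1\<close> lies to the left of the support of
    \<open>f\<close>, so the antiderivative vanishes there. \<open>U\<close> is complex-valued,
    hence the real part.\<close>
  define \<phi> where "\<phi> x = Re (U x) - Re (U (- R - 1))" for x
  have d: "(\<phi> has_real_derivative f x) (at x)" for x
  proof -
    have "((\<lambda>x. Re (U x)) has_vector_derivative Re (of_real (f x))) (at x)"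
      by (rule bounded_linear.has_vector_derivative[OF bounded_linear_Re has_ac_deriv_vector_derivative[OF U cc]])
    hence "((\<lambda>x. Re (U x)) has_real_derivative f x) (at x)"
      by (simp add: has_real_derivative_iff_has_vector_derivative)
    from DERIV_diff[OF this DERIV_const] show ?thesis by (simp add: \<phi>_def[abs_def])
  qed
  have s: "\<phi> x = 0" if "\<bar>x\<bar> > R + 1" for x
  proof -
    have "U x = U (- R - 1)"
    proof (cases "x > 0")
      case True
      have "U x - U (- R - 1) = (LBINT x:{- R - 1..x}. complex_of_real (f x))"
        using that True R by (intro has_ac_derivD(2)[OF U, symmetric]) auto
      also have "\<dots> = 0" using that True
        by (subst integral_eq_interval_integral[symmetric]) (auto intro!: supp simp: z simp del: integral_complex_of_real)
      finally show ?thesis by simp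
    next
      case False
      have "U (- R - 1) - U x = (LBINT y:{x..- R - 1}. complex_of_real (f y))"
        using that False by (intro has_ac_derivD(2)[OF U, symmetric]) auto
      also have "\<dots> = (LBINT y:{x..- R - 1}. 0)" using that False R
        by (intro set_lebesgue_integral_cong) (auto intro!: supp)
      finally show ?thesis by simp
    qed
    thus ?thesis by (simp add: \<phi>_def)
  qed
  show thesis
    by (rule that[of \<phi>]) (use test_function_antideriv[OF f d s] d in \<open>auto intro: DERIV_imp_deriv\<close>)
qed

text \<open>The du Bois-Reymond argument: \<open>u\<close> minus an antiderivative of
  \<open>v\<close> annihilates all derivatives of test functions. Every bump minus a multiple of a
  fixed bump \<open>\<eta>\<close> is such a derivative, so the difference is constant almost
  everywhere.\<close>

lemma has_weak_deriv_imp_has_ac_deriv: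
  assumes u: "loc_integrable u" and v: "loc_integrable v" and w: "has_weak_deriv u v"
  obtains U where "has_ac_deriv U v" "AE x in lborel. u x = U x"
proof -
  obtain U0 where U0: "has_ac_deriv U0 v" using ac_antiderivative[OF v] by blast
  have U0l: "loc_integrable U0" by (intro loc_integrable_continuous has_ac_deriv_continuous[OF U0])
  define g where "g x = u x - U0 x" for x
  have gl: "loc_integrable g" unfolding g_def by (intro loc_integrable_diff u U0l)
  have gz: "(LBINT x. g x * of_real (deriv \<phi> x)) = 0" if T: "test_function \<phi>" for \<phi>
    using w has_ac_deriv_imp_has_weak_deriv[OF U0] T integrable_mult_test_function(2)[OF T] u U0l
    by (auto simp: g_def has_weak_deriv_def left_diff_distrib)
  define \<eta> where "\<eta> x = flat_exp 0 (1 * x + 0) * flat_exp 0 ((-1) * x + 1)" for x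
  have eB: "\<eta> \<in> bump_algebra" unfolding \<eta>_def by (intro bump_algebra.intros)
  have es: "\<eta> x = 0" if "\<bar>x\<bar> > 1" for x using that by (auto simp: \<eta>_def flat_exp_def)
  have eT: "test_function \<eta>" by (rule test_function_bump[OF eB es])
  define \<kappa> where "\<kappa> = (LBINT x. complex_of_real (\<eta> x))"
  have "\<kappa> \<noteq> 0"
  proof
    assume "\<kappa> = 0"
    hence z: "(LBINT x. \<eta> x) = 0" by (simp add: \<kappa>_def)
    have i: "integrable lborel \<eta>"
      using integrable_mult_test_function(1)[OF eT loc_integrable_continuous[OF continuous_on_const[of _ 1]]]
      by (simp add: complex_of_real_integrable_eq)
    have "AE x in lborel. \<eta> x = 0"
      using integral_nonneg_eq_0_iff_AE[OF i] z by (auto simp: \<eta>_def flat_exp_def)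
    hence "AE x in lborel. x \<notin> {0<..<1::real}" by eventually_elim (auto simp: \<eta>_def flat_exp_def)
    hence "emeasure lborel {0<..<1::real} = 0"
      by (subst (asm) AE_iff_measurable[of "{0<..<1}"]) (auto simp del: emeasure_lborel_Ioo)
    moreover have "emeasure lborel {0<..<1::real} = 1" by simp
    ultimately show False by simp
  qed
  \<comment> \<open>The only constant that can come out: its pairing with \<open>\<eta>\<close> has
    to agree with that of \<open>g\<close>.\<close>
  define C where "C = (LBINT x. g x * of_real (\<eta> x)) / \<kappa>"
  have "AE x in lborel. g x - C = 0"
  proof (rule fundamental_lemma)
    show "loc_integrable (\<lambda>x. g x - C)"
      by (intro loc_integrable_diff gl loc_integrable_continuous continuous_intros)
    fix \<phi> assume B: "\<phi> \<in> bump_algebra" and T: "test_function \<phi>"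
    obtain R where R: "R > 0" "\<And>x. \<bar>x\<bar> \<ge> R \<Longrightarrow> \<phi> x = 0" using test_function_props[OF T] by metis
    have i1: "integrable lborel (\<lambda>x. complex_of_real (\<phi> x))" if "test_function \<phi>" for \<phi>
      using integrable_mult_test_function(1)[OF that loc_integrable_continuous[OF continuous_on_const[of _ 1]]]
      by simp
    define r where "r = (LBINT x. \<phi> x) / (LBINT x. \<eta> x)"
    have r: "of_real r * \<kappa> = (LBINT x. complex_of_real (\<phi> x))"
      using \<open>\<kappa> \<noteq> 0\<close> by (simp add: r_def \<kappa>_def)
    have "(\<lambda>x. \<phi> x + (- r) * \<eta> x) \<in> bump_algebra" by (intro bump_algebra.intros B eB)
    moreover have "\<phi> x + (- r) * \<eta> x = 0" if "\<bar>x\<bar> > max R 1" for x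
      using that R es[of x] by auto
    moreover have "(LBINT x. complex_of_real (\<phi> x + (- r) * \<eta> x)) = 0"
      using i1[OF T] i1[OF eT] r by (simp add: \<kappa>_def)
    ultimately obtain \<psi> where psi: "test_function \<psi>" "deriv \<psi> = (\<lambda>x. \<phi> x + (- r) * \<eta> x)"
      by (rule integral_bump_antiderivative[of "max R 1", rotated]) auto
    note i2 = integrable_mult_test_function(1)[OF T gl] integrable_mult_test_function(1)[OF eT gl] i1[OF T]
    have "0 = (LBINT x. g x * of_real (\<phi> x) - of_real r * (g x * of_real (\<eta> x)))"
      using gz[OF psi(1)] unfolding psi(2) by (simp add: algebra_simps)
    also have "\<dots> = (LBINT x. g x * of_real (\<phi> x)) - of_real r * (LBINT x. g x * of_real (\<eta> x))"
      using i2 by simp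
    also have "\<dots> = (LBINT x. g x * of_real (\<phi> x)) - C * (LBINT x. complex_of_real (\<phi> x))"
      using \<open>\<kappa> \<noteq> 0\<close> unfolding r[symmetric] by (simp add: C_def)
    also have "\<dots> = (LBINT x. (g x - C) * of_real (\<phi> x))"
      using i2 by (simp add: left_diff_distrib)
    finally show "(LBINT x. (g x - C) * of_real (\<phi> x)) = 0" by simp
  qed
  hence "AE x in lborel. u x = U0 x + C" by eventually_elim (simp add: g_def algebra_simps)
  moreover have "has_ac_deriv (\<lambda>x. U0 x + C) v"
    using has_ac_deriv_add[OF U0 has_ac_deriv_const[of C]] by simp
  ultimately show thesis by (rule that[rotated])
qed

section \<open>Square-integrable functions\<close>

text \<open>The squared norm replaces the norm throughout; the triangle inequality then takes the
  form of \<open>L2_add\<close> with factors 2, and the norm returns only in the final resolvent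
  bound.\<close>

definition energy :: "(real \<Rightarrow> 'b::{banach, second_countable_topology}) \<Rightarrow> real" where
  "energy f = (LBINT x. (norm (f x))\<^sup>2)"

lemma energy_nonneg: "0 \<le> energy f"
  by (simp add: energy_def)

lemma L2_measurable: "f \<in> L2 lborel \<Longrightarrow> f \<in> borel_measurable borel"
  by (simp add: L2_def)

lemma L2_integrable: "f \<in> L2 lborel \<Longrightarrow> integrable lborel (\<lambda>x. (norm (f x))\<^sup>2)"
  by (simp add: L2_def)

lemma L2I: "f \<in> borel_measurable borel \<Longrightarrow> integrable lborel (\<lambda>x. (norm (f x))\<^sup>2) \<Longrightarrow> f \<in> L2 lborel"
  by (simp add: L2_def)

lemma norm_add_sq_le:
  fixes a b :: "'b::real_normed_vector"
  shows "(norm (a + b))\<^sup>2 \<le> 2 * (norm a)\<^sup>2 + 2 * (norm b)\<^sup>2"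
proof -
  have "(norm (a + b))\<^sup>2 \<le> (norm a + norm b)\<^sup>2" by (intro power_mono norm_triangle_ineq) auto
  also have "\<dots> \<le> 2 * (norm a)\<^sup>2 + 2 * (norm b)\<^sup>2"
    using zero_le_power2[of "norm a - norm b"] by (simp add: power2_eq_square algebra_simps)
  finally show ?thesis .
qed

lemma L2_bound:
  assumes "integrable lborel g" "f \<in> borel_measurable borel" "\<And>x. (norm (f x))\<^sup>2 \<le> g x"
  shows "f \<in> L2 lborel"
proof (rule L2I[OF assms(2)])
  note [measurable] = assms(2)
  show "integrable lborel (\<lambda>x. (norm (f x))\<^sup>2)"
    by (rule Bochner_Integration.integrable_bound[OF assms(1)])
       (use assms(3) order.trans[OF _ abs_ge_self] in auto)
qed

lemma L2_add:
  assumes "f \<in> L2 lborel" "g \<in> L2 lborel"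
  shows "(\<lambda>x. f x + g x) \<in> L2 lborel" "energy (\<lambda>x. f x + g x) \<le> 2 * energy f + 2 * energy g"
proof -
  note [measurable] = assms[THEN L2_measurable]
  have i: "integrable lborel (\<lambda>x. 2 * (norm (f x))\<^sup>2 + 2 * (norm (g x))\<^sup>2)"
    using assms[THEN L2_integrable] by auto
  show l: "(\<lambda>x. f x + g x) \<in> L2 lborel" by (rule L2_bound[OF i]) (auto intro: norm_add_sq_le)
  have "energy (\<lambda>x. f x + g x) \<le> (LBINT x. 2 * (norm (f x))\<^sup>2 + 2 * (norm (g x))\<^sup>2)"
    unfolding energy_def by (rule integral_mono[OF L2_integrable[OF l] i norm_add_sq_le])
  also have "\<dots> = 2 * energy f + 2 * energy g" using assms[THEN L2_integrable] by (simp add: energy_def)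
  finally show "energy (\<lambda>x. f x + g x) \<le> 2 * energy f + 2 * energy g" .
qed

lemma energy_cmult: "energy (\<lambda>x. c * f x) = (norm c)\<^sup>2 * energy f" for c :: complex
  by (simp add: energy_def norm_mult power_mult_distrib)

lemma L2_cmult: "f \<in> L2 lborel \<Longrightarrow> (\<lambda>x. c * f x) \<in> L2 lborel" for c :: complex
  by (auto simp: L2_def norm_mult power_mult_distrib)

lemma L2_minus: "f \<in> L2 lborel \<Longrightarrow> (\<lambda>x. - f x) \<in> L2 lborel" for f :: "real \<Rightarrow> complex"
  using L2_cmult[of f "-1"] by simp

lemma L2_diff:
  fixes f g :: "real \<Rightarrow> complex"
  assumes "f \<in> L2 lborel" "g \<in> L2 lborel" shows "(\<lambda>x. f x - g x) \<in> L2 lborel"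
  using L2_add(1)[OF assms(1) L2_minus[OF assms(2)]] by simp

lemma energy_diff_le:
  fixes f g :: "real \<Rightarrow> complex"
  assumes "f \<in> L2 lborel" "g \<in> L2 lborel"
  shows "energy (\<lambda>x. f x - g x) \<le> 2 * energy f + 2 * energy g"
  using L2_add(2)[OF assms(1) L2_minus[OF assms(2)]] by (simp add: energy_def)

lemma L2_cnj: "f \<in> L2 lborel \<Longrightarrow> (\<lambda>x. cnj (f x)) \<in> L2 lborel"
proof (rule L2I)
  assume f: "f \<in> L2 lborel"
  show "(\<lambda>x. cnj (f x)) \<in> borel_measurable borel"
    by (rule measurable_compose[OF L2_measurable[OF f] borel_measurable_continuous_onI]) (auto intro: continuous_intros)
qed (use L2_integrable in auto)

lemma energy_cnj: "energy (\<lambda>x. cnj (f x)) = energy f"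
  by (simp add: energy_def)

lemma L2_zero: "(\<lambda>x. 0) \<in> L2 lborel" by (simp add: L2_def)

lemma young_mult:
  fixes a b :: complex assumes "\<eta> > 0"
  shows "norm (a * b) \<le> (\<eta> * (norm a)\<^sup>2 + (norm b)\<^sup>2 / \<eta>) / 2"
proof -
  have "0 \<le> (\<eta> * norm a - norm b)\<^sup>2 / (2 * \<eta>)" using assms by auto
  also have "\<dots> = (\<eta> * (norm a)\<^sup>2 + (norm b)\<^sup>2 / \<eta>) / 2 - norm a * norm b"
    using assms by (simp add: field_simps power2_eq_square)
  finally show ?thesis by (simp add: norm_mult)
qed

lemma L2_mult_integrable:
  fixes f g :: "real \<Rightarrow> complex"
  assumes "f \<in> L2 lborel" "g \<in> L2 lborel"
  shows "integrable lborel (\<lambda>x. f x * g x)"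
proof (rule Bochner_Integration.integrable_bound)
  note [measurable] = assms[THEN L2_measurable]
  show "integrable lborel (\<lambda>x. (1 * (norm (f x))\<^sup>2 + (norm (g x))\<^sup>2 / 1) / 2)"
    using assms[THEN L2_integrable] by auto
  show "AE x in lborel. norm (f x * g x) \<le> norm ((1 * (norm (f x))\<^sup>2 + (norm (g x))\<^sup>2 / 1) / 2)"
    using young_mult[of 1] by (intro AE_I2) (auto intro: order.trans[OF _ abs_ge_self])
qed (use assms[THEN L2_measurable] in auto)

text \<open>Young's inequality with a free weight takes the place of Cauchy-Schwarz; each use
  chooses \<open>\<eta>\<close> to balance the two terms.\<close>

lemma L2_mult_integral_le:
  fixes f g :: "real \<Rightarrow> complex"
  assumes "f \<in> L2 lborel" "g \<in> L2 lborel" "\<eta> > 0"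
  shows "norm (LBINT x. f x * g x) \<le> (\<eta> * energy f + energy g / \<eta>) / 2"
proof -
  have "norm (LBINT x. f x * g x) \<le> (LBINT x. (\<eta> * (norm (f x))\<^sup>2 + (norm (g x))\<^sup>2 / \<eta>) / 2)"
    by (rule Bochner_Integration.integral_norm_bound_integral)
       (use assms assms(1,2)[THEN L2_integrable] young_mult in \<open>auto intro!: L2_mult_integrable\<close>)
  also have "\<dots> = (\<eta> * energy f + energy g / \<eta>) / 2"
    using assms(1,2)[THEN L2_integrable] by (simp add: energy_def)
  finally show ?thesis .
qed

lemma L2_loc_integrable:
  assumes "f \<in> L2 lborel" shows "loc_integrable f"
  unfolding loc_integrable_def
proof (intro conjI allI L2_measurable[OF assms])
  fix a b :: real
  have "(\<lambda>x. indicator {a..b} x :: complex) \<in> L2 lborel"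
    by (rule L2_bound[of "indicator {a..b}"]) (rule integrable_real_indicator, auto simp: indicator_def emeasure_lborel_Icc_eq)
  from L2_mult_integrable[OF assms this] show "set_integrable lborel {a..b} f"
    unfolding set_integrable_def by (rule Bochner_Integration.integrable_cong[THEN iffD1, rotated 2])
       (auto simp: indicator_def)
qed

lemma energy_eq_0_imp:
  assumes "f \<in> L2 lborel" "energy f = 0" shows "AE x in lborel. f x = 0"
proof -
  have "AE x in lborel. (norm (f x))\<^sup>2 = 0"
    using integral_nonneg_eq_0_iff_AE[OF L2_integrable[OF assms(1)]] assms(2) by (simp add: energy_def)
  thus ?thesis by eventually_elim simp
qed

lemma energy_cong_AE:
  fixes f g :: "real \<Rightarrow> 'b::{banach, second_countable_topology}"
  assumes "AE x in lborel. f x = g x" "f \<in> borel_measurable borel" "g \<in> borel_measurable borel"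
  shows "energy f = energy g"
proof -
  note [measurable] = assms(2,3)
  show ?thesis unfolding energy_def
    by (rule integral_cong_AE) (use assms(1) in \<open>auto elim!: eventually_mono\<close>)
qed

lemma L2_cong_AE:
  assumes "f \<in> L2 lborel" "AE x in lborel. f x = g x" "g \<in> borel_measurable borel"
  shows "g \<in> L2 lborel"
proof (rule L2I[OF assms(3)])
  note [measurable] = assms(3) L2_measurable[OF assms(1)]
  show "integrable lborel (\<lambda>x. (norm (g x))\<^sup>2)"
    by (rule integrable_cong_AE_imp[OF L2_integrable[OF assms(1)]])
       (use assms(2) in \<open>auto elim!: eventually_mono\<close>)
qed

text \<open>Monotone convergence. This turns the estimates on bounded intervals below into
  membership in $L^2$.\<close>

lemma integrable_if_interval_integrals_bounded:
  fixes f :: "real \<Rightarrow> real"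
  assumes [measurable]: "f \<in> borel_measurable borel" and nn: "\<And>x. 0 \<le> f x"
    and i: "\<And>N. N > 0 \<Longrightarrow> set_integrable lborel {-N..N} f"
    and bd: "\<And>N. N > 0 \<Longrightarrow> (LBINT x:{-N..N}. f x) \<le> B"
  shows "integrable lborel f"
proof -
  let ?g = "\<lambda>n x. indicator {- real (Suc n)..real (Suc n)} x *\<^sub>R f x"
  have inc: "incseq (\<lambda>n. LBINT x. ?g n x)"
    using i unfolding set_integrable_def
    by (intro incseq_SucI integral_mono) (auto simp: indicator_def nn simp del: of_nat_Suc)
  moreover have "(LBINT x. ?g n x) \<le> B" for n
    using bd[of "real (Suc n)"] by (simp add: set_lebesgue_integral_def)
  ultimately obtain l where l: "(\<lambda>n. LBINT x. ?g n x) \<longlonglongrightarrow> l"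
    using incseq_convergent by blast
  show ?thesis
  proof (rule integrable_monotone_convergence[OF _ _ _ l])
    show "integrable lborel (?g n)" for n using i[of "real (Suc n)"] by (simp add: set_integrable_def)
    show "AE x in lborel. mono (\<lambda>n. ?g n x)"
      by (intro AE_I2 monoI) (auto simp: indicator_def nn)
    show "AE x in lborel. (\<lambda>n. ?g n x) \<longlonglongrightarrow> f x"
    proof (intro AE_I2 tendsto_eventually)
      fix x :: real
      obtain m where m: "\<bar>x\<bar> \<le> real m" using real_arch_simple by blast
      show "\<forall>\<^sub>F n in sequentially. ?g n x = f x"
        using eventually_ge_at_top[of m] by eventually_elim (use m in \<open>auto simp: indicator_def\<close>)
    qed
  qed auto
qed

text \<open>The cutoff $1 - x^2/n^2$ on $[-n, n]$ avoids discussing the limits of $p$ at infinity.\<close>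

lemma has_ac_deriv_cutoff: "has_ac_deriv (\<lambda>x. of_real (1 - (x / r)\<^sup>2)) (\<lambda>x. of_real (- 2 * x / r\<^sup>2))"
proof (rule has_ac_deriv_C1)
  have "((\<lambda>x. 1 - (x * inverse r)\<^sup>2) has_real_derivative (- 2 * x / r\<^sup>2)) (at x)" for x
    by (auto intro!: derivative_eq_intros simp: power2_eq_square divide_inverse)
  hence "((\<lambda>x. 1 - (x / r)\<^sup>2) has_real_derivative (- 2 * x / r\<^sup>2)) (at x)" for x
    by (simp add: divide_inverse)
  thus "((\<lambda>x. complex_of_real (1 - (x / r)\<^sup>2)) has_vector_derivative of_real (- 2 * x / r\<^sup>2)) (at x)" for x
    by (intro has_vector_derivative_of_real) (simp add: has_real_derivative_iff_has_vector_derivative)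
qed (auto intro!: continuous_intros simp: divide_inverse)

text \<open>The cutoff vanishes at the ends of [-n, n], so the product with \<open>p\<close> has no
  boundary terms. The slope of the cutoff is at most 2/n there; its contribution tends to 0 because
  \<open>p\<close> is integrable.\<close>

lemma has_ac_deriv_integral_zero:
  assumes p: "has_ac_deriv p h" and ip: "integrable lborel p" and ih: "integrable lborel h"
  shows "(LBINT x. h x) = 0"
proof -
  note [measurable] = borel_measurable_integrable[OF ip] borel_measurable_integrable[OF ih]
  define A where "A n x = indicator {- real n..real n} x *\<^sub>R (h x * of_real (1 - (x / real n)\<^sup>2))" for n x
  define B where "B n x = indicator {- real n..real n} x *\<^sub>R (of_real (- 2 * x / (real n)\<^sup>2) * p x)" for n x
  have bound: "\<bar>1 - (x / real n)\<^sup>2\<bar> \<le> 1" if "x \<in> {- real n..real n}" for x n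
  proof (cases "n = 0")
    case False
    hence "\<bar>x / real n\<bar> \<le> 1" using that by (auto simp: abs_le_iff field_simps)
    hence "(x / real n)\<^sup>2 \<le> 1" by (simp add: abs_square_le_1)
    thus ?thesis by simp
  qed auto
  have bA: "norm (A n x) \<le> norm (h x)" for n x
    using bound[of x n] by (auto simp: A_def norm_mult indicator_def mult_left_le simp del: of_real_diff of_real_power of_real_divide)
  have bB0: "norm (B n x) \<le> 2 / real n * norm (p x)" for n x
  proof (cases "n = 0")
    case False
    hence "\<bar>x\<bar> / (real n)\<^sup>2 \<le> 1 / real n" if "x \<in> {- real n..real n}"
      using that by (auto simp: field_simps power2_eq_square abs_le_iff)
    thus ?thesis using mult_right_mono[of "2 * (\<bar>x\<bar> / (real n)\<^sup>2)" "2 / real n" "norm (p x)"]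
      by (auto simp: B_def norm_mult norm_divide indicator_def norm_power)
  qed (auto simp: B_def)
  have bB: "norm (B n x) \<le> 2 * norm (p x)" for n x
  proof (cases "n = 0")
    case False
    have "2 / real n * norm (p x) \<le> 2 * norm (p x)"
      by (rule mult_right_mono) (use False in \<open>auto simp: field_simps\<close>)
    thus ?thesis using bB0[of n x] by linarith
  qed (auto simp: B_def)
  have [measurable]: "A n \<in> borel_measurable borel" "B n \<in> borel_measurable borel" for n
    unfolding A_def B_def by measurable
  have iA: "integrable lborel (A n)" for n
    by (rule Bochner_Integration.integrable_bound[OF ih]) (use bA in auto)
  have iB: "integrable lborel (B n)" for n
    by (rule Bochner_Integration.integrable_bound[of _ "\<lambda>x. 2 * norm (p x)"]) (use bB ip in auto)
  have limA: "(\<lambda>n. LBINT x. A n x) \<longlonglongrightarrow> (LBINT x. h x)"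
  proof (rule integral_dominated_convergence[where w="\<lambda>x. norm (h x)"])
    show "AE x in lborel. (\<lambda>n. A n x) \<longlonglongrightarrow> h x"
    proof (intro AE_I2)
      fix x :: real
      have "(\<lambda>n. h x * of_real (1 - (x * inverse (real n))\<^sup>2)) \<longlonglongrightarrow> h x * of_real (1 - (x * 0)\<^sup>2)"
        by (intro tendsto_intros lim_inverse_n)
      moreover obtain m where m: "\<bar>x\<bar> \<le> real m" using real_arch_simple by blast
      have "\<forall>\<^sub>F n in sequentially. A n x = h x * of_real (1 - (x * inverse (real n))\<^sup>2)"
        using eventually_ge_at_top[of m]
        by eventually_elim (use m in \<open>auto simp: indicator_def A_def divide_inverse\<close>)
      ultimately show "(\<lambda>n. A n x) \<longlonglongrightarrow> h x" by (simp add: tendsto_cong)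
    qed
  qed (use ih bA in auto)
  have limB: "(\<lambda>n. LBINT x. B n x) \<longlonglongrightarrow> integral\<^sup>L lborel (\<lambda>x::real. 0)"
  proof (rule integral_dominated_convergence[where w="\<lambda>x. 2 * norm (p x)" and f="\<lambda>x. 0"])
    show "AE x in lborel. (\<lambda>n. B n x) \<longlonglongrightarrow> 0"
    proof (intro AE_I2)
      fix x :: real
      have "(\<lambda>n. 2 * inverse (real n) * norm (p x)) \<longlonglongrightarrow> 2 * 0 * norm (p x)"
        by (intro tendsto_intros lim_inverse_n)
      hence "(\<lambda>n. 2 / real n * norm (p x)) \<longlonglongrightarrow> 0" by (simp add: divide_inverse)
      thus "(\<lambda>n. B n x) \<longlonglongrightarrow> 0"
        by (rule Lim_null_comparison[rotated]) (use bB0 in auto)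
    qed
  qed (use ip bB in auto)
  have "(LBINT x. A n x) = - (LBINT x. B n x)" if "n > 0" for n
  proof -
    have "has_ac_deriv (\<lambda>x. p x * of_real (1 - (x / real n)\<^sup>2))
        (\<lambda>x. h x * of_real (1 - (x / real n)\<^sup>2) + of_real (- 2 * x / (real n)\<^sup>2) * p x)"
      by (rule has_ac_deriv_mult[OF p has_ac_deriv_cutoff])
    from has_ac_derivD(2)[OF this, of "- real n" "real n"]
    have "0 = (LBINT x:{- real n..real n}.
        h x * of_real (1 - (x / real n)\<^sup>2) + of_real (- 2 * x / (real n)\<^sup>2) * p x)"
      using that by simp
    also have "\<dots> = (LBINT x. A n x + B n x)"
      by (simp only: set_lebesgue_integral_def A_def B_def scaleR_add_right)
    also have "\<dots> = (LBINT x. A n x) + (LBINT x. B n x)" using iA iB by simp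
    finally show ?thesis by (simp add: eq_neg_iff_add_eq_0)
  qed
  hence "\<forall>\<^sub>F n in sequentially. (LBINT x. A n x) = - (LBINT x. B n x)"
    using eventually_gt_at_top[of 0] by (rule eventually_mono[rotated])
  hence "(\<lambda>n. - (LBINT x. B n x)) \<longlonglongrightarrow> (LBINT x. h x)"
    using limA by (simp add: tendsto_cong)
  from LIMSEQ_unique[OF this tendsto_minus[OF limB]] show ?thesis by simp
qed

section \<open>Integration by parts on the domain\<close>

definition dom_deriv :: "(real \<Rightarrow> complex) \<Rightarrow> (real \<Rightarrow> complex) \<Rightarrow> bool" where
  "dom_deriv u v \<longleftrightarrow> has_ac_deriv u v \<and> u \<in> L2 lborel \<and> v \<in> L2 lborel \<and> (\<lambda>x. of_real x * u x) \<in> L2 lborel"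

lemma dom_derivD:
  assumes "dom_deriv u v"
  shows "has_ac_deriv u v" "u \<in> L2 lborel" "v \<in> L2 lborel" "(\<lambda>x. of_real x * u x) \<in> L2 lborel"
  using assms by (auto simp: dom_deriv_def)

lemma dom_deriv_add: "dom_deriv u v \<Longrightarrow> dom_deriv w z \<Longrightarrow> dom_deriv (\<lambda>x. u x + w x) (\<lambda>x. v x + z x)"
  by (auto simp: dom_deriv_def distrib_left intro: has_ac_deriv_add L2_add)

lemma dom_deriv_cmult: "dom_deriv u v \<Longrightarrow> dom_deriv (\<lambda>x. c * u x) (\<lambda>x. c * v x)"
  unfolding dom_deriv_def by (auto intro: has_ac_deriv_cmult L2_cmult simp: mult.left_commute[of _ c])

lemma dom_deriv_cnj:
  assumes "dom_deriv u v" shows "dom_deriv (\<lambda>x. cnj (u x)) (\<lambda>x. cnj (v x))"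
  unfolding dom_deriv_def using dom_derivD[OF assms] L2_cnj[OF dom_derivD(4)[OF assms]]
  by (auto intro: has_ac_deriv_cnj L2_cnj)

lemma dom_deriv_cong_AE:
  assumes "dom_deriv u v" "AE x in lborel. v x = w x" "w \<in> borel_measurable borel"
  shows "dom_deriv u w"
  using assms has_ac_deriv_cong_AE L2_cong_AE unfolding dom_deriv_def by blast

lemma dom_deriv_parts:
  assumes u: "dom_deriv u v" and w: "dom_deriv w z"
  shows "(LBINT x. v x * w x) = - (LBINT x. u x * z x)"
proof -
  note i = L2_mult_integrable[OF dom_derivD(3)[OF u] dom_derivD(2)[OF w]]
    L2_mult_integrable[OF dom_derivD(3)[OF w] dom_derivD(2)[OF u]]
  have "(LBINT x. v x * w x + z x * u x) = 0"
    by (rule has_ac_deriv_integral_zero[OF has_ac_deriv_mult[OF dom_derivD(1)[OF u] dom_derivD(1)[OF w]]])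
       (use i L2_mult_integrable[OF dom_derivD(2)[OF u] dom_derivD(2)[OF w]] in auto)
  thus ?thesis using i by (simp add: eq_neg_iff_add_eq_0 mult.commute)
qed

text \<open>The integral of the derivative of x u w vanishes. The weight x can always be attached to
  \<open>u\<close> or to \<open>w\<close>, so all products are integrable; the term without weight
  is the source of \<open>- energy u\<close> in \<open>energy_identity\<close>.\<close>

lemma dom_deriv_virial:
  assumes u: "dom_deriv u v" and w: "dom_deriv w z"
  shows "(LBINT x. of_real x * (v x * w x + u x * z x)) = - (LBINT x. u x * w x)"
proof -
  note i = L2_mult_integrable[OF dom_derivD(3)[OF u] dom_derivD(4)[OF w]]
    L2_mult_integrable[OF dom_derivD(3)[OF w] dom_derivD(4)[OF u]]
    L2_mult_integrable[OF dom_derivD(2)[OF u] dom_derivD(2)[OF w]]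
    L2_mult_integrable[OF dom_derivD(4)[OF u] dom_derivD(2)[OF w]]
  have d: "has_ac_deriv (\<lambda>x. of_real x * (u x * w x)) (\<lambda>x. 1 * (u x * w x) + (v x * w x + z x * u x) * of_real x)"
    by (intro has_ac_deriv_mult has_ac_deriv_of_real dom_derivD(1)[OF u] dom_derivD(1)[OF w])
  have j: "integrable lborel (\<lambda>x. of_real x * (v x * w x + u x * z x))"
    using Bochner_Integration.integrable_add[OF i(1,2)] by (simp add: algebra_simps)
  have "(LBINT x. 1 * (u x * w x) + (v x * w x + z x * u x) * of_real x) = 0"
    by (rule has_ac_deriv_integral_zero[OF d])
       (use i j Bochner_Integration.integrable_add[OF i(3) j] in \<open>auto simp: algebra_simps\<close>)
  hence "(LBINT x. u x * w x + of_real x * (v x * w x + u x * z x)) = 0"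
    by (simp add: algebra_simps)
  thus ?thesis using i(3) j by (simp add: add_eq_0_iff)
qed

text \<open>The integrand is the derivative of k |u|^2. A real weight is singled out because the
  cross term of |f|^2 has the form x Re(v cnj(u)), which such a derivative absorbs up to a multiple
  of |u|^2.\<close>

lemma weighted_norm_sq_integral:
  assumes u: "has_ac_deriv u v" and k: "\<And>x. (k has_real_derivative k' x) (at x)" "continuous_on UNIV k'"
    and ab: "a \<le> b"
  shows "set_integrable lborel {a..b} (\<lambda>x. k' x * (norm (u x))\<^sup>2 + 2 * k x * Re (v x * cnj (u x)))"
    "(LBINT x:{a..b}. k' x * (norm (u x))\<^sup>2 + 2 * k x * Re (v x * cnj (u x))) =
      k b * (norm (u b))\<^sup>2 - k a * (norm (u a))\<^sup>2"
proof -
  let ?r = "\<lambda>x. k' x * (norm (u x))\<^sup>2 + 2 * k x * Re (v x * cnj (u x))"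
  have "has_ac_deriv (\<lambda>x. complex_of_real (k x)) (\<lambda>x. of_real (k' x))"
    by (rule has_ac_deriv_C1)
       (use k in \<open>auto intro!: continuous_intros has_vector_derivative_of_real simp: has_real_derivative_iff_has_vector_derivative\<close>)
  from has_ac_deriv_mult[OF this has_ac_deriv_mult[OF u has_ac_deriv_cnj[OF u]]]
  have "has_ac_deriv (\<lambda>x. of_real (k x) * (u x * cnj (u x)))
    (\<lambda>x. of_real (k' x) * (u x * cnj (u x)) + (v x * cnj (u x) + cnj (v x) * u x) * of_real (k x))" .
  moreover have "of_real (k' x) * (u x * cnj (u x)) + (v x * cnj (u x) + cnj (v x) * u x) * of_real (k x)
     = complex_of_real (?r x)" for x
    by (simp only: cmod_power2, simp add: complex_eq_iff algebra_simps power2_eq_square)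
  moreover have "of_real (k x) * (u x * cnj (u x)) = complex_of_real (k x * (norm (u x))\<^sup>2)" for x
    by (simp add: complex_norm_square del: of_real_power)
  ultimately have A: "has_ac_deriv (\<lambda>x. complex_of_real (k x * (norm (u x))\<^sup>2)) (\<lambda>x. complex_of_real (?r x))"
    by simp
  show I: "set_integrable lborel {a..b} ?r"
    using loc_integrable_set[OF has_ac_derivD(1)[OF A], of a b]
    unfolding set_integrable_def by (simp add: scaleR_conv_of_real complex_of_real_integrable_eq flip: of_real_mult of_real_add)
  have "complex_of_real (LBINT x:{a..b}. ?r x) = (LBINT x:{a..b}. complex_of_real (?r x))"
    by (rule set_integral_complex_of_real[symmetric])
  also have "\<dots> = complex_of_real (k b * (norm (u b))\<^sup>2 - k a * (norm (u a))\<^sup>2)"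
    using has_ac_derivD(2)[OF A ab] by simp
  finally show "(LBINT x:{a..b}. ?r x) = k b * (norm (u b))\<^sup>2 - k a * (norm (u a))\<^sup>2"
    unfolding of_real_eq_iff .
qed

section \<open>Ladder operators of the rotated oscillator\<close>

text \<open>All that the analysis retains of the angle: Re(c^2) is cos \<theta>. The angle itself
  comes back only when \<open>dirac_op\<close> does.\<close>

locale rotated_oscillator =
  fixes c :: complex
  assumes norm_c: "norm c = 1" and Re_c2: "Re (c\<^sup>2) > 0"
begin

definition s :: complex where "s = cnj c"

text \<open>In terms of the angle, \<open>\<rho>\<close> is cos \<theta>, the coercivity constant of
  the form of \<open>ba + 1\<close>, and \<open>\<delta>\<close> is 1 - |sin \<theta>|, the one left
  for a single first-order operator after its cross term is estimated.\<close>

definition \<rho> :: real where "\<rho> = Re (c\<^sup>2)"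
definition \<delta> :: real where "\<delta> = 1 - \<bar>Im (c\<^sup>2)\<bar>"

lemma c_s: "c * s = 1" "s * c = 1"
  using norm_c complex_norm_square[of c] by (auto simp: s_def mult.commute)

lemma norm_s: "norm s = 1"
  using norm_c by (simp add: s_def)

lemma Re_s2: "Re (s\<^sup>2) = \<rho>" by (simp add: s_def \<rho>_def power2_eq_square)

lemma rho_pos: "\<rho> > 0" and rho_le: "\<rho> \<le> 1" and delta_pos: "\<delta> > 0"
proof -
  have n: "norm (c\<^sup>2) = 1" using norm_c by (simp add: norm_power)
  show "\<rho> > 0" using Re_c2 by (simp add: \<rho>_def)
  show "\<rho> \<le> 1" using complex_Re_le_cmod[of "c\<^sup>2"] n by (simp add: \<rho>_def)
  have "(Re (c\<^sup>2))\<^sup>2 + (Im (c\<^sup>2))\<^sup>2 = 1" using n cmod_power2[of "c\<^sup>2"] by simp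
  moreover have "(Re (c\<^sup>2))\<^sup>2 > 0" using Re_c2 by simp
  ultimately have "(Im (c\<^sup>2))\<^sup>2 < 1" by linarith
  hence "\<bar>Im (c\<^sup>2)\<bar> < 1" by (simp add: abs_square_less_1)
  thus "\<delta> > 0" by (simp add: \<delta>_def)
qed

text \<open>
  \<open>ladder 1 u f\<close> states $f = (c\,\partial_x + s x) u$ and \<open>ladder (-1) u f\<close> states
  $f = (-c\,\partial_x + s x) u$, with \<open>u\<close> the continuous representative of an element of the
  domain; the equation is solved for the derivative, so that it holds everywhere.
\<close>

definition ladder_deriv :: "real \<Rightarrow> (real \<Rightarrow> complex) \<Rightarrow> (real \<Rightarrow> complex) \<Rightarrow> real \<Rightarrow> complex" where
  "ladder_deriv \<sigma> u f x = of_real \<sigma> * s * (f x - s * of_real x * u x)"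

definition ladder :: "real \<Rightarrow> (real \<Rightarrow> complex) \<Rightarrow> (real \<Rightarrow> complex) \<Rightarrow> bool" where
  "ladder \<sigma> u f \<longleftrightarrow> dom_deriv u (ladder_deriv \<sigma> u f)"

lemma ladder_deriv_solve:
  assumes "\<sigma>\<^sup>2 = 1" shows "f x = of_real \<sigma> * c * ladder_deriv \<sigma> u f x + s * of_real x * u x"
proof -
  have "of_real \<sigma> * c * ladder_deriv \<sigma> u f x = of_real (\<sigma>\<^sup>2) * (c * s) * (f x - s * of_real x * u x)"
    by (simp add: ladder_deriv_def power2_eq_square)
  thus ?thesis using assms c_s by simp
qed

lemma ladder_dom_deriv: "ladder \<sigma> u f \<Longrightarrow> dom_deriv u (ladder_deriv \<sigma> u f)"
  by (simp add: ladder_def)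

lemma ladder_L2:
  assumes "ladder \<sigma> u f" "\<sigma>\<^sup>2 = 1"
  shows "u \<in> L2 lborel" "f \<in> L2 lborel" "(\<lambda>x. of_real x * u x) \<in> L2 lborel"
proof -
  note d = dom_derivD[OF ladder_dom_deriv[OF assms(1)]]
  show "u \<in> L2 lborel" "(\<lambda>x. of_real x * u x) \<in> L2 lborel" using d by auto
  have "(\<lambda>x. (of_real \<sigma> * c) * ladder_deriv \<sigma> u f x + s * (of_real x * u x)) \<in> L2 lborel"
    by (intro L2_add L2_cmult d)
  moreover have "(\<lambda>x. (of_real \<sigma> * c) * ladder_deriv \<sigma> u f x + s * (of_real x * u x)) = f"
    using ladder_deriv_solve[OF assms(2), of f _ u] by (simp add: fun_eq_iff mult.assoc)
  ultimately show "f \<in> L2 lborel" by simp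
qed

lemma ladder_of_dom_deriv:
  assumes "dom_deriv u v" "\<sigma>\<^sup>2 = 1"
  shows "ladder \<sigma> u (\<lambda>x. of_real \<sigma> * c * v x + s * of_real x * u x)"
proof -
  have "ladder_deriv \<sigma> u (\<lambda>x. of_real \<sigma> * c * v x + s * of_real x * u x) x = of_real (\<sigma>\<^sup>2) * (s * c) * v x" for x
    by (simp add: ladder_deriv_def power2_eq_square)
  hence "ladder_deriv \<sigma> u (\<lambda>x. of_real \<sigma> * c * v x + s * of_real x * u x) = v"
    using assms(2) c_s by (simp add: fun_eq_iff)
  thus ?thesis using assms(1) by (simp add: ladder_def)
qed

lemma ladder_add: "ladder \<sigma> u f \<Longrightarrow> ladder \<sigma> w g \<Longrightarrow> ladder \<sigma> (\<lambda>x. u x + w x) (\<lambda>x. f x + g x)"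
  unfolding ladder_def using dom_deriv_add[of u "ladder_deriv \<sigma> u f" w "ladder_deriv \<sigma> w g"]
  by (simp add: ladder_deriv_def[abs_def] algebra_simps)

lemma ladder_cmult: "ladder \<sigma> u f \<Longrightarrow> ladder \<sigma> (\<lambda>x. a * u x) (\<lambda>x. a * f x)"
  unfolding ladder_def using dom_deriv_cmult[of u "ladder_deriv \<sigma> u f" a]
  by (simp add: ladder_deriv_def[abs_def] algebra_simps)

lemma ladder_diff: "ladder \<sigma> u f \<Longrightarrow> ladder \<sigma> w g \<Longrightarrow> ladder \<sigma> (\<lambda>x. u x - w x) (\<lambda>x. f x - g x)"
  using ladder_add[of \<sigma> u f "\<lambda>x. -1 * w x" "\<lambda>x. -1 * g x"] ladder_cmult[of \<sigma> w g "-1"] by simp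

lemma ladder_cong_AE:
  assumes "ladder \<sigma> u f" "AE x in lborel. f x = g x" "g \<in> borel_measurable borel"
  shows "ladder \<sigma> u g"
  unfolding ladder_def
proof (rule dom_deriv_cong_AE[OF ladder_dom_deriv[OF assms(1)]])
  show "AE x in lborel. ladder_deriv \<sigma> u f x = ladder_deriv \<sigma> u g x"
    using assms(2) by eventually_elim (simp add: ladder_deriv_def)
  have [measurable]: "u \<in> borel_measurable borel"
    using dom_derivD(2)[OF ladder_dom_deriv[OF assms(1)]] by (rule L2_measurable)
  note [measurable] = assms(3)
  show "ladder_deriv \<sigma> u g \<in> borel_measurable borel" unfolding ladder_deriv_def[abs_def] by measurable
qed

text \<open>The sum of the two ladder operators is multiplication by 2 s x, so knowing one image of
  \<open>u\<close> gives the other.\<close>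

lemma ladder_other:
  assumes "ladder \<sigma> u f"
  shows "ladder (- \<sigma>) u (\<lambda>x. 2 * s * of_real x * u x - f x)"
proof -
  have "ladder_deriv (- \<sigma>) u (\<lambda>x. 2 * s * of_real x * u x - f x) = ladder_deriv \<sigma> u f"
    by (simp add: ladder_deriv_def[abs_def] algebra_simps)
  thus ?thesis using assms by (simp add: ladder_def)
qed

section \<open>A priori estimates for one first-order equation\<close>

text \<open>The cross term of |f|^2 is 2 \<sigma> Re(c^2 X) with X = x v cnj(u), because c cnj(s) =
  c^2. Its part with Re X is kept, being a derivative up to a multiple of |u|^2; the part with Im X
  has no sign and is absorbed by Young's inequality, which lowers the constant from 1 to
  \<open>\<delta>\<close>.\<close>

lemma ladder_norm_sq_ge:
  fixes u f :: "real \<Rightarrow> complex"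
  assumes "\<sigma>\<^sup>2 = 1"
  defines "v \<equiv> ladder_deriv \<sigma> u f"
  shows "\<delta> * ((norm (v x))\<^sup>2 + x\<^sup>2 * (norm (u x))\<^sup>2) + \<sigma> * \<rho> * (2 * x * Re (v x * cnj (u x))) \<le> (norm (f x))\<^sup>2"
proof -
  define X where "X = of_real x * v x * cnj (u x)"
  have "f x = (of_real \<sigma> * c) * v x + (s * of_real x) * u x"
    unfolding v_def using ladder_deriv_solve[OF assms(1)] by (simp add: mult.assoc)
  moreover have "(norm (a * p + b * q))\<^sup>2 = (norm a)\<^sup>2 * (norm p)\<^sup>2 + (norm b)\<^sup>2 * (norm q)\<^sup>2 + 2 * Re (a * cnj b * p * cnj q)" for a b p q
    unfolding cmod_power2 by (simp add: power2_eq_square algebra_simps)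
  ultimately have "(norm (f x))\<^sup>2 = \<sigma>\<^sup>2 * (norm (v x))\<^sup>2 + x\<^sup>2 * (norm (u x))\<^sup>2
      + 2 * Re (of_real \<sigma> * c * cnj (s * of_real x) * v x * cnj (u x))"
    by (simp add: norm_mult norm_c norm_s power_mult_distrib)
  also have "of_real \<sigma> * c * cnj (s * of_real x) * v x * cnj (u x) = of_real \<sigma> * (c\<^sup>2 * X)"
    by (simp add: X_def s_def power2_eq_square)
  also have "Re (of_real \<sigma> * (c\<^sup>2 * X)) = \<sigma> * \<rho> * Re X - \<sigma> * Im (c\<^sup>2) * Im X"
    by (simp add: \<rho>_def algebra_simps)
  finally have eq: "(norm (f x))\<^sup>2 = (norm (v x))\<^sup>2 + x\<^sup>2 * (norm (u x))\<^sup>2 + 2 * (\<sigma> * \<rho> * Re X - \<sigma> * Im (c\<^sup>2) * Im X)"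
    using assms(1) by simp
  have "\<bar>\<sigma>\<bar> = 1" using assms(1) by (simp add: power2_eq_1_iff) auto
  hence "\<bar>\<sigma> * Im (c\<^sup>2) * Im X\<bar> \<le> \<bar>Im (c\<^sup>2)\<bar> * norm X"
    by (simp add: abs_mult mult_left_mono abs_Im_le_cmod)
  moreover have "norm X \<le> ((norm (v x))\<^sup>2 + x\<^sup>2 * (norm (u x))\<^sup>2) / 2"
    using young_mult[of 1 "v x" "of_real x * cnj (u x)"]
    by (simp add: X_def norm_mult power_mult_distrib mult.left_commute mult.assoc)
  ultimately have "\<bar>\<sigma> * Im (c\<^sup>2) * Im X\<bar> \<le> \<bar>Im (c\<^sup>2)\<bar> * (((norm (v x))\<^sup>2 + x\<^sup>2 * (norm (u x))\<^sup>2) / 2)"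
    by (meson abs_ge_zero mult_left_mono order_trans)
  moreover have "Re X = x * Re (v x * cnj (u x))" by (simp add: X_def algebra_simps)
  ultimately show ?thesis unfolding eq \<delta>_def
    by (simp add: algebra_simps abs_le_iff)
qed

lemma set_integrable_L2_norm_sq:
  fixes f :: "real \<Rightarrow> complex" shows
  "f \<in> L2 lborel \<Longrightarrow> set_integrable lborel {a..b} (\<lambda>x. (norm (f x))\<^sup>2)"
  using integrable_mult_indicator[OF _ L2_integrable, of "{a..b}" f] by (simp add: set_integrable_def)

lemma set_integrable_continuous:
  fixes f :: "real \<Rightarrow> real"
  assumes "continuous_on UNIV f" shows "set_integrable lborel {a..b} f"
  unfolding set_integrable_def
  by (rule borel_integrable_compact) (auto intro: continuous_on_subset[OF assms])

lemma set_integrable_deriv_norm_sq: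
  assumes u: "has_ac_deriv u (ladder_deriv \<sigma> u f)" and f: "f \<in> L2 lborel"
  shows "set_integrable lborel {a..b} (\<lambda>x. (norm (ladder_deriv \<sigma> u f x))\<^sup>2)"
proof (rule set_integrable_bound)
  note cu = has_ac_deriv_continuous[OF u]
  have [measurable]: "ladder_deriv \<sigma> u f \<in> borel_measurable borel"
    using has_ac_derivD(1)[OF u] by (rule loc_integrable_measurable)
  show "set_borel_measurable lborel {a..b} (\<lambda>x. (norm (ladder_deriv \<sigma> u f x))\<^sup>2)"
    unfolding set_borel_measurable_def by measurable
  show "set_integrable lborel {a..b} (\<lambda>x. \<sigma>\<^sup>2 * (2 * (norm (f x))\<^sup>2 + 2 * (x\<^sup>2 * (norm (u x))\<^sup>2)))"
    by (intro set_integrable_mult_right set_integral_add set_integrable_L2_norm_sq f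
        set_integrable_continuous continuous_intros cu)
  have "(norm (ladder_deriv \<sigma> u f x))\<^sup>2 \<le> \<sigma>\<^sup>2 * (2 * (norm (f x))\<^sup>2 + 2 * (x\<^sup>2 * (norm (u x))\<^sup>2))" for x
    using norm_add_sq_le[of "f x" "- (s * of_real x * u x)"]
    by (auto simp: ladder_deriv_def norm_mult norm_s power_mult_distrib intro!: mult_left_mono)
  thus "AE x in lborel. x \<in> {a..b} \<longrightarrow> norm ((norm (ladder_deriv \<sigma> u f x))\<^sup>2) \<le>
      norm (\<sigma>\<^sup>2 * (2 * (norm (f x))\<^sup>2 + 2 * (x\<^sup>2 * (norm (u x))\<^sup>2)))"
    by (auto intro: order.trans[OF _ abs_ge_self])
qed

text \<open>Elliptic regularity: the pointwise lower bound is integrated with a weight vanishing at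
  the ends of an interval. The cross term becomes the derivative of k |u|^2, which integrates to 0,
  at the price of a bounded multiple of |u|^2. The resulting bound does not depend on the
  interval.\<close>

lemma ladder_regularity:
  assumes \<sigma>: "\<sigma>\<^sup>2 = 1" and ac: "has_ac_deriv u (ladder_deriv \<sigma> u f)"
    and u: "u \<in> L2 lborel" and f: "f \<in> L2 lborel"
  shows "ladder \<sigma> u f"
proof -
  define v where "v = ladder_deriv \<sigma> u f"
  define T where "T x = (norm (v x))\<^sup>2 + x\<^sup>2 * (norm (u x))\<^sup>2" for x
  note cu = has_ac_deriv_continuous[OF ac]
  have vm: "v \<in> borel_measurable borel"
    using has_ac_derivD(1)[OF ac] by (simp add: v_def loc_integrable_def)
  note [measurable] = vm L2_measurable[OF u] L2_measurable[OF f]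
  have iT: "set_integrable lborel {a..b} T" for a b
    unfolding T_def[abs_def] v_def
    by (intro set_integral_add set_integrable_deriv_norm_sq ac f set_integrable_continuous continuous_intros cu)
  have "(LBINT x:{-N..N}. T x) \<le> 2 / \<delta> * (energy f + 2 * energy u)" if N: "N > 0" for N
  proof -
    \<comment> \<open>The cutoff lives on an interval twice as long, so that it is at least 1/2 on
      the inner one.\<close>
    define M where "M = 2 * N"
    have M: "M > 0" using N by (simp add: M_def)
    define \<kappa> where "\<kappa> x = 1 - (x / M)\<^sup>2" for x
    define k where "k x = x * \<kappa> x" for x
    \<comment> \<open>\<open>k'\<close> is the derivative of \<open>k\<close>; it lies between -2
      and 1 on [-M, M], whence the factor 2 in front of |u|^2 in \<open>main\<close>.\<close>
    define k' where "k' x = 1 - 3 * (x / M)\<^sup>2" for x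
    have k1: "(k has_real_derivative k' x) (at x)" for x
      unfolding k_def \<kappa>_def k'_def using M
      by (auto intro!: derivative_eq_intros simp: power2_eq_square field_simps)
    have k2: "continuous_on UNIV k'" unfolding k'_def using M by (auto intro!: continuous_intros)
    define r where "r x = k' x * (norm (u x))\<^sup>2 + 2 * k x * Re (v x * cnj (u x))" for x
    have r: "set_integrable lborel {-M..M} r" "(LBINT x:{-M..M}. r x) = 0"
      using weighted_norm_sq_integral[OF ac k1 k2, of "-M" M] M
      by (auto simp: r_def[abs_def] v_def k_def \<kappa>_def)
    have sq: "0 \<le> (x / M)\<^sup>2" "(x / M)\<^sup>2 \<le> 1" if "x \<in> {-M..M}" for x
    proof -
      have "\<bar>x / M\<bar> \<le> 1" using that M by (auto simp: abs_le_iff field_simps)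
      thus "(x / M)\<^sup>2 \<le> 1" by (simp add: abs_square_le_1)
    qed auto
    have sq2: "(x / M)\<^sup>2 \<le> 1 / 2" if "x \<in> {-N..N}" for x
    proof -
      have "\<bar>x / M\<bar> \<le> 1 / 2" using that N by (auto simp: M_def abs_le_iff field_simps)
      hence "\<bar>x / M\<bar>\<^sup>2 \<le> (1 / 2)\<^sup>2" by (intro power_mono) auto
      hence "(x / M)\<^sup>2 \<le> 1 / 4" unfolding power2_abs by (simp only: power_divide, simp)
      thus ?thesis by linarith
    qed
    have main: "indicator {-N..N} x * (\<delta> / 2 * T x) + indicator {-M..M} x * (\<sigma> * \<rho> * r x)
       \<le> (norm (f x))\<^sup>2 + 2 * (norm (u x))\<^sup>2" for x
    proof (cases "x \<in> {-M..M}")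
      case True
      note b = sq[OF True]
      have T0: "0 \<le> T x" by (simp add: T_def)
      have \<kappa>: "0 \<le> \<kappa> x" "\<kappa> x \<le> 1" using b by (auto simp: \<kappa>_def)
      have "\<kappa> x * (\<delta> * T x + \<sigma> * \<rho> * (2 * x * Re (v x * cnj (u x)))) \<le> \<kappa> x * (norm (f x))\<^sup>2"
        using ladder_norm_sq_ge[OF \<sigma>, of u f x] \<kappa>(1) by (intro mult_left_mono) (auto simp: T_def v_def)
      also have "\<dots> \<le> (norm (f x))\<^sup>2" using \<kappa> by (intro mult_left_le_one_le) auto
      finally have 1: "\<kappa> x * (\<delta> * T x) + \<sigma> * \<rho> * (2 * k x * Re (v x * cnj (u x))) \<le> (norm (f x))\<^sup>2"
        by (simp add: k_def algebra_simps)
      have "\<bar>\<sigma>\<bar> = 1" using \<sigma> by (simp add: power2_eq_1_iff) auto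
      hence "\<bar>\<sigma> * \<rho> * k' x\<bar> \<le> 1 * 2"
        unfolding abs_mult using rho_pos rho_le b order.trans[OF _ mult_nonneg_nonneg[OF _ b(1), of 3], of "- 1"]
        by (intro mult_mono) (auto simp: k'_def abs_le_iff)
      hence "(\<sigma> * \<rho> * k' x) * (norm (u x))\<^sup>2 \<le> 2 * (norm (u x))\<^sup>2"
        by (intro mult_right_mono) auto
      hence 2: "\<sigma> * \<rho> * (k' x * (norm (u x))\<^sup>2) \<le> 2 * (norm (u x))\<^sup>2" by (simp add: mult_ac)
      have 3: "indicator {-N..N} x * (\<delta> / 2 * T x) \<le> \<kappa> x * (\<delta> * T x)"
      proof (cases "x \<in> {-N..N}")
        case True
        hence "1 / 2 \<le> \<kappa> x" using sq2[OF True] by (simp add: \<kappa>_def)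
        hence "1 / 2 * (\<delta> * T x) \<le> \<kappa> x * (\<delta> * T x)"
          using T0 delta_pos by (intro mult_right_mono) auto
        thus ?thesis using True by simp
      qed (use T0 \<kappa> delta_pos in auto)
      show ?thesis using 1 2 3 True by (simp add: r_def distrib_left)
    next
      case False
      hence "x \<notin> {-N..N}" using N by (auto simp: M_def)
      thus ?thesis using False by simp
    qed
    have i1: "integrable lborel (\<lambda>x. indicator {-N..N} x * (\<delta> / 2 * T x))"
      using integrable_mult_right[OF iT[unfolded set_integrable_def, of "-N" N], of "\<delta> / 2"] by (simp add: mult_ac)
    have i2: "integrable lborel (\<lambda>x. indicator {-M..M} x * (\<sigma> * \<rho> * r x))"
      using integrable_mult_right[OF r(1)[unfolded set_integrable_def], of "\<sigma> * \<rho>"] by (simp add: mult_ac)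
    have "(LBINT x. indicator {-N..N} x * (\<delta> / 2 * T x) + indicator {-M..M} x * (\<sigma> * \<rho> * r x))
      \<le> (LBINT x. (norm (f x))\<^sup>2 + 2 * (norm (u x))\<^sup>2)"
      by (rule integral_mono[OF _ _ main]) (use i1 i2 L2_integrable[OF u] L2_integrable[OF f] in auto)
    moreover have "(LBINT x. (norm (f x))\<^sup>2 + 2 * (norm (u x))\<^sup>2) = energy f + 2 * energy u"
      using L2_integrable[OF u] L2_integrable[OF f] by (simp add: energy_def)
    moreover have "(LBINT x. indicator {-N..N} x * (\<delta> / 2 * T x)) = \<delta> / 2 * (LBINT x:{-N..N}. T x)"
      unfolding set_lebesgue_integral_def by (simp add: mult.left_commute)
    moreover have "(LBINT x. indicator {-M..M} x * (\<sigma> * \<rho> * r x)) = \<sigma> * \<rho> * (LBINT x:{-M..M}. r x)"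
      unfolding set_lebesgue_integral_def by (simp add: mult.left_commute)
    ultimately have "\<delta> / 2 * (LBINT x:{-N..N}. T x) \<le> energy f + 2 * energy u"
      using i1 i2 r(2) by simp
    thus ?thesis using delta_pos by (simp add: field_simps)
  qed
  moreover have [measurable]: "T \<in> borel_measurable borel" unfolding T_def by measurable
  ultimately have T: "integrable lborel T"
    by (intro integrable_if_interval_integrals_bounded[where f=T] iT) (auto simp: T_def)
  have "v \<in> L2 lborel" by (rule L2_bound[OF T vm]) (simp add: T_def)
  moreover have "(\<lambda>x. of_real x * u x) \<in> L2 lborel"
    by (rule L2_bound[OF T]) (auto simp: T_def norm_mult power_mult_distrib)
  ultimately show ?thesis using ac u by (simp add: ladder_def dom_deriv_def v_def)
qed

text \<open>The same identity with k(x) = x and without a cutoff, since square-integrability of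
  \<open>u\<close> is now the conclusion. The boundary term carries the sign
  \<open>\<sigma>\<close>: for \<sigma> = 1 it helps and K = 0 will do, for \<sigma> = -1 the growth
  hypothesis has to control it.\<close>

lemma ladder_growth_imp_L2:
  assumes \<sigma>: "\<sigma>\<^sup>2 = 1" and ac: "has_ac_deriv u (ladder_deriv \<sigma> u f)" and f: "f \<in> L2 lborel"
    and K: "\<And>N. N > 0 \<Longrightarrow> - \<sigma> * (N * ((norm (u N))\<^sup>2 + (norm (u (- N)))\<^sup>2)) \<le> K"
  shows "u \<in> L2 lborel"
proof -
  define v where "v = ladder_deriv \<sigma> u f"
  note cu = has_ac_deriv_continuous[OF ac]
  have um: "u \<in> borel_measurable borel" by (rule borel_measurable_continuous_onI[OF cu])
  \<comment> \<open>Outside [-R, R] the confining term \<delta> x^2 |u|^2 exceeds 2 \<rho> |u|^2;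
    inside, |u|^2 is integrable by continuity.\<close>
  define R where "R = sqrt (2 * \<rho> / \<delta>)"
  have R: "\<delta> * R\<^sup>2 = 2 * \<rho>" using rho_pos delta_pos by (simp add: R_def)
  have R0: "R \<ge> 0" using rho_pos delta_pos by (simp add: R_def)
  let ?n = "\<lambda>x. (norm (u x))\<^sup>2"
  have iu: "set_integrable lborel {a..b} ?n" for a b
    by (intro set_integrable_continuous continuous_intros cu)
  have abs1: "\<bar>\<sigma>\<bar> = 1" using \<sigma> by (simp add: power2_eq_1_iff) auto
  define B where "B = (energy f + \<rho> * \<bar>K\<bar> + 2 * \<rho> * (LBINT x:{-R..R}. ?n x)) / \<rho>"
  have bd: "(LBINT x:{-N..N}. ?n x) \<le> B" if N: "N > 0" for N
  proof -
    define r where "r x = 1 * ?n x + 2 * x * Re (v x * cnj (u x))" for x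
    have r: "set_integrable lborel {-N..N} r" "(LBINT x:{-N..N}. r x) = N * (?n N + ?n (-N))"
      using weighted_norm_sq_integral[OF ac, of "\<lambda>x. x" "\<lambda>x. 1" "-N" N] N
      by (auto simp: r_def[abs_def] v_def algebra_simps)
    have main: "\<rho> * ?n x + \<sigma> * \<rho> * r x \<le> (norm (f x))\<^sup>2 + 2 * \<rho> * (indicator {-R..R} x * ?n x)" for x
    proof -
      have 1: "\<delta> * (x\<^sup>2 * ?n x) + \<sigma> * \<rho> * (2 * x * Re (v x * cnj (u x))) \<le> (norm (f x))\<^sup>2"
      proof -
        have "0 \<le> \<delta> * (norm (v x))\<^sup>2" using delta_pos by simp
        thus ?thesis using ladder_norm_sq_ge[OF \<sigma>, of u f x] by (simp add: v_def distrib_left)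
      qed
      have 2: "\<sigma> * \<rho> * ?n x \<le> \<rho> * ?n x"
        using abs1 rho_pos by (intro mult_right_mono) (auto simp: abs_if split: if_splits)
      have 3: "2 * \<rho> * ?n x \<le> \<delta> * (x\<^sup>2 * ?n x) + 2 * \<rho> * (indicator {-R..R} x * ?n x)"
      proof (cases "x \<in> {-R..R}")
        case False
        hence "R \<le> \<bar>x\<bar>" by auto
        hence "R\<^sup>2 \<le> x\<^sup>2" using R0 by (metis power2_abs power_mono)
        hence "\<delta> * R\<^sup>2 \<le> \<delta> * x\<^sup>2" using delta_pos by (intro mult_left_mono) auto
        hence "2 * \<rho> * ?n x \<le> \<delta> * x\<^sup>2 * ?n x" unfolding R by (intro mult_right_mono) auto
        thus ?thesis using False by (simp add: mult.assoc)
      qed (use delta_pos in auto)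
      show ?thesis using 1 2 3 by (simp add: r_def distrib_left)
    qed
    define G where "G x = (norm (f x))\<^sup>2 + 2 * \<rho> * (indicator {-R..R} x * ?n x)" for x
    have G: "integrable lborel G"
      unfolding G_def using iu[of "-R" R] L2_integrable[OF f] by (simp add: set_integrable_def)
    have iG: "set_integrable lborel {-N..N} G"
      unfolding set_integrable_def by (rule integrable_mult_indicator) (use G in auto)
    have "(LBINT x:{-N..N}. \<rho> * ?n x + \<sigma> * \<rho> * r x) \<le> (LBINT x:{-N..N}. G x)"
    proof (rule set_integral_mono[OF _ iG])
      show "set_integrable lborel {-N..N} (\<lambda>x. \<rho> * ?n x + \<sigma> * \<rho> * r x)"
        by (intro set_integral_add set_integrable_mult_right iu r)
    qed (use main in \<open>auto simp: G_def\<close>)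
    also have "(LBINT x:{-N..N}. \<rho> * ?n x + \<sigma> * \<rho> * r x) =
      \<rho> * (LBINT x:{-N..N}. ?n x) + \<sigma> * \<rho> * (N * (?n N + ?n (-N)))"
      using iu r by (simp add: set_integral_add)
    also have "(LBINT x:{-N..N}. G x) \<le> (LBINT x. G x)"
      unfolding set_lebesgue_integral_def
      by (rule integral_mono[OF iG[unfolded set_integrable_def] G])
         (use rho_pos in \<open>auto simp: indicator_def G_def\<close>)
    also have "\<dots> = energy f + 2 * \<rho> * (LBINT x:{-R..R}. ?n x)"
      using iu[of "-R" R] L2_integrable[OF f]
      by (simp add: G_def[abs_def] energy_def set_integrable_def set_lebesgue_integral_def)
    finally have "\<rho> * (LBINT x:{-N..N}. ?n x) \<le> energy f + \<rho> * (- \<sigma> * (N * (?n N + ?n (-N))))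
        + 2 * \<rho> * (LBINT x:{-R..R}. ?n x)"
      by (simp add: algebra_simps)
    also have "\<rho> * (- \<sigma> * (N * (?n N + ?n (-N)))) \<le> \<rho> * \<bar>K\<bar>"
      using K[OF N] rho_pos by (intro mult_left_mono) auto
    finally show ?thesis unfolding B_def using rho_pos by (simp add: field_simps)
  qed
  have "integrable lborel ?n"
    by (rule integrable_if_interval_integrals_bounded[OF _ _ iu bd]) (use um in auto)
  thus ?thesis by (rule L2I[OF um])
qed

section \<open>Commutation, duality and the energy identity\<close>

text \<open>The commutator of the ladder operators, with the domain question included. That
  \<open>z\<close> is in the domain amounts to x u being there, which the hypotheses do not say
  directly; x u solves a first-order equation whose right side is square-integrable because
  \<open>y\<close> is in the domain, and \<open>ladder_regularity\<close> applies.\<close>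

lemma ladder_commute:
  assumes \<sigma>: "\<sigma>\<^sup>2 = 1" and u: "ladder \<sigma> u y" and y: "ladder (- \<sigma>) y k"
  defines "z \<equiv> (\<lambda>x. 2 * s * of_real x * u x - y x)"
  shows "ladder (- \<sigma>) u z" "ladder \<sigma> z (\<lambda>x. k x + 2 * of_real \<sigma> * u x)"
proof -
  show "ladder (- \<sigma>) u z" unfolding z_def by (rule ladder_other[OF u])
  have \<sigma>': "(- \<sigma>)\<^sup>2 = 1" using \<sigma> by simp
  \<comment> \<open>The ladder operator applied to x u: x times its value on \<open>u\<close>, plus
    the commutator term \<sigma> c u.\<close>
  define g where "g x = of_real x * y x + of_real \<sigma> * c * u x" for x
  have g: "g \<in> L2 lborel"
    unfolding g_def using ladder_L2[OF u \<sigma>] ladder_L2[OF y \<sigma>'] by (intro L2_add L2_cmult) auto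
  have "has_ac_deriv (\<lambda>x. of_real x * u x) (\<lambda>x. 1 * u x + ladder_deriv \<sigma> u y x * of_real x)"
    by (rule has_ac_deriv_mult[OF has_ac_deriv_of_real dom_derivD(1)[OF ladder_dom_deriv[OF u]]])
  moreover have "1 * u x + ladder_deriv \<sigma> u y x * of_real x = ladder_deriv \<sigma> (\<lambda>x. of_real x * u x) g x" for x
  proof -
    have "of_real \<sigma> * s * (of_real \<sigma> * c * u x) = of_real (\<sigma>\<^sup>2) * (s * c) * u x" by (simp add: power2_eq_square)
    hence "of_real \<sigma> * s * (of_real \<sigma> * c * u x) = u x" using \<sigma> c_s by simp
    thus ?thesis by (simp add: ladder_deriv_def g_def algebra_simps)
  qed
  ultimately have "has_ac_deriv (\<lambda>x. of_real x * u x) (ladder_deriv \<sigma> (\<lambda>x. of_real x * u x) g)" by simp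
  from ladder_regularity[OF \<sigma> this ladder_L2(3)[OF u \<sigma>] g]
  have xu: "ladder \<sigma> (\<lambda>x. of_real x * u x) g" .
  have "ladder \<sigma> y (\<lambda>x. 2 * s * of_real x * y x - k x)" using ladder_other[OF y] by simp
  from ladder_diff[OF ladder_cmult[OF xu, of "2 * s"] this]
  have "ladder \<sigma> (\<lambda>x. 2 * s * (of_real x * u x) - y x) (\<lambda>x. 2 * s * g x - (2 * s * of_real x * y x - k x))" .
  moreover have "(\<lambda>x. 2 * s * (of_real x * u x) - y x) = z" by (simp add: z_def mult.assoc)
  moreover have "2 * s * g x - (2 * s * of_real x * y x - k x) = k x + 2 * of_real \<sigma> * u x" for x
  proof -
    have "2 * s * g x = 2 * s * of_real x * y x + 2 * of_real \<sigma> * (s * c) * u x" by (simp add: g_def algebra_simps)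
    thus ?thesis using c_s by simp
  qed
  ultimately show "ladder \<sigma> z (\<lambda>x. k x + 2 * of_real \<sigma> * u x)" by (simp only:)
qed

text \<open>Without conjugation, integration by parts flips only the sign in front of c; a
  sesquilinear pairing would also conjugate c and leave the family.\<close>

lemma ladder_duality:
  assumes u: "ladder 1 u f" and w: "ladder (- 1) w g"
  shows "(LBINT x. f x * w x) = (LBINT x. u x * g x)"
proof -
  define v where "v = ladder_deriv 1 u f"
  define z where "z = ladder_deriv (-1) w g"
  have f: "f x = c * v x + s * of_real x * u x" for x using ladder_deriv_solve[of 1 f x u] by (simp add: v_def)
  have g: "g x = - c * z x + s * of_real x * w x" for x using ladder_deriv_solve[of "-1" g x w] by (simp add: z_def)
  have u': "dom_deriv u v" and w': "dom_deriv w z" using u w by (auto simp: ladder_def v_def z_def)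
  note i = L2_mult_integrable[OF dom_derivD(3)[OF u'] dom_derivD(2)[OF w']]
    L2_mult_integrable[OF dom_derivD(4)[OF u'] dom_derivD(2)[OF w']]
    L2_mult_integrable[OF dom_derivD(2)[OF u'] dom_derivD(3)[OF w']]
  have "(LBINT x. f x * w x) = (LBINT x. c * (v x * w x) + s * (of_real x * u x * w x))"
    by (simp add: f algebra_simps)
  also have "\<dots> = c * (LBINT x. v x * w x) + s * (LBINT x. of_real x * u x * w x)" using i by simp
  also have "(LBINT x. v x * w x) = - (LBINT x. u x * z x)" by (rule dom_deriv_parts[OF u' w'])
  also have "c * - (LBINT x. u x * z x) + s * (LBINT x. of_real x * u x * w x)
     = (LBINT x. (- c) * (u x * z x) + s * (of_real x * u x * w x))" using i by simp
  also have "\<dots> = (LBINT x. u x * g x)" by (simp add: g algebra_simps)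
  finally show ?thesis .
qed

text \<open>By duality \<open>b\<close> moves onto cnj(u) as \<open>a\<close> with c unconjugated.
  Hence c^2 and s^2, both of real part \<open>\<rho>\<close>, multiply the two energies, while the
  cross terms have coefficient c s = 1 and combine to x times the derivative of |u|^2, which the
  virial identity evaluates.\<close>

lemma energy_identity:
  assumes u: "ladder 1 u y" and y: "ladder (- 1) y k"
  shows "Re (LBINT x. k x * cnj (u x)) =
    \<rho> * (energy (ladder_deriv 1 u y) + energy (\<lambda>x. of_real x * u x)) - energy u"
proof -
  define v where "v = ladder_deriv 1 u y"
  have u': "dom_deriv u v" using u by (simp add: ladder_def v_def)
  note uc = dom_deriv_cnj[OF u']
  have y': "y x = c * v x + s * of_real x * u x" for x using ladder_deriv_solve[of 1 y x u] by (simp add: v_def)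
  have "ladder 1 (\<lambda>x. cnj (u x)) (\<lambda>x. c * cnj (v x) + s * of_real x * cnj (u x))"
    using ladder_of_dom_deriv[OF uc, of 1] by simp
  from ladder_duality[OF this y]
  have "(LBINT x. k x * cnj (u x)) = (LBINT x. (c * cnj (v x) + s * of_real x * cnj (u x)) * y x)"
    by (simp add: mult.commute)
  also have "\<dots> = (LBINT x. c\<^sup>2 * of_real ((norm (v x))\<^sup>2) + s\<^sup>2 * of_real ((norm (of_real x * u x))\<^sup>2)
     + of_real x * (v x * cnj (u x) + u x * cnj (v x)))"
  proof (intro Bochner_Integration.integral_cong refl)
    fix x
    have "(c * cnj (v x) + s * of_real x * cnj (u x)) * y x = c\<^sup>2 * (v x * cnj (v x))
       + s\<^sup>2 * ((of_real x * u x) * cnj (of_real x * u x)) + (c * s) * of_real x * (v x * cnj (u x) + u x * cnj (v x))"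
      by (simp add: y' algebra_simps power2_eq_square)
    thus "(c * cnj (v x) + s * of_real x * cnj (u x)) * y x = c\<^sup>2 * of_real ((norm (v x))\<^sup>2)
       + s\<^sup>2 * of_real ((norm (of_real x * u x))\<^sup>2) + of_real x * (v x * cnj (u x) + u x * cnj (v x))"
      using c_s by (simp only: complex_norm_square mult_1)
  qed
  also have "\<dots> = c\<^sup>2 * of_real (energy v) + s\<^sup>2 * of_real (energy (\<lambda>x. of_real x * u x))
     + (LBINT x. of_real x * (v x * cnj (u x) + u x * cnj (v x)))"
  proof -
    have "integrable lborel (\<lambda>x. of_real x * (v x * cnj (u x) + u x * cnj (v x)))"
      using Bochner_Integration.integrable_add[OF L2_mult_integrable[OF dom_derivD(3)[OF u'] dom_derivD(4)[OF uc]]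
        L2_mult_integrable[OF dom_derivD(4)[OF u'] dom_derivD(3)[OF uc]]] by (simp add: algebra_simps)
    moreover have "integrable lborel (\<lambda>x. complex_of_real ((norm (v x))\<^sup>2))"
      "integrable lborel (\<lambda>x. complex_of_real ((norm (of_real x * u x))\<^sup>2))"
      using L2_integrable[OF dom_derivD(3)[OF u']] L2_integrable[OF dom_derivD(4)[OF u']]
      by (auto simp only: complex_of_real_integrable_eq)
    ultimately show ?thesis
      by (simp add: energy_def del: of_real_power norm_mult flip: integral_complex_of_real)
  qed
  also have "(LBINT x. of_real x * (v x * cnj (u x) + u x * cnj (v x))) = - (LBINT x. u x * cnj (u x))"
    by (rule dom_deriv_virial[OF u' uc])
  also have "(LBINT x. u x * cnj (u x)) = of_real (energy u)"
    by (simp add: energy_def complex_norm_square[symmetric] del: of_real_power flip: integral_complex_of_real)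
  finally have "Re (LBINT x. k x * cnj (u x)) = Re (c\<^sup>2) * energy v + Re (s\<^sup>2) * energy (\<lambda>x. of_real x * u x) - energy u"
    by simp
  thus ?thesis unfolding Re_s2 by (simp add: v_def[symmetric] \<rho>_def distrib_left)
qed

lemma energy_balance:
  assumes u: "ladder 1 u y" and y: "ladder (- 1) y (\<lambda>x. w * u x + h x)" and h: "h \<in> L2 lborel"
  shows "Re w * energy u + Re (LBINT x. h x * cnj (u x)) =
    \<rho> * (energy (ladder_deriv 1 u y) + energy (\<lambda>x. of_real x * u x)) - energy u"
proof -
  have uL: "u \<in> L2 lborel" using ladder_L2[OF u] by simp
  have "(LBINT x. (w * u x + h x) * cnj (u x)) = w * of_real (energy u) + (LBINT x. h x * cnj (u x))"
    using L2_mult_integrable[OF uL L2_cnj[OF uL]] L2_mult_integrable[OF h L2_cnj[OF uL]]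
    by (simp add: distrib_right mult.assoc energy_def complex_norm_square[symmetric] del: of_real_power flip: integral_complex_of_real)
  thus ?thesis using energy_identity[OF u y] by simp
qed

text \<open>The real part of the form of \<open>ba\<close> is at least \<open>- energy u\<close>, so
  \<open>ba - w\<close> is bounded below to the left of -1. The bound also serves for uniqueness,
  with \<open>h\<close> zero.\<close>

lemma resolvent_estimate:
  assumes u: "ladder 1 u y" and y: "ladder (- 1) y (\<lambda>x. w * u x + h x)" and h: "h \<in> L2 lborel" and w: "Re w < -1"
  shows "(- 1 - Re w)\<^sup>2 * energy u \<le> energy h"
proof -
  define d where "d = - 1 - Re w"
  have d: "d > 0" using w by (simp add: d_def)
  have uL: "u \<in> L2 lborel" using ladder_L2[OF u] by simp
  note energy_balance[OF u y h]
  moreover have "0 \<le> \<rho> * (energy (ladder_deriv 1 u y) + energy (\<lambda>x. of_real x * u x))"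
    using rho_pos by (simp add: energy_nonneg)
  ultimately have "d * energy u \<le> Re (LBINT x. h x * cnj (u x))"
    by (simp add: d_def algebra_simps)
  \<comment> \<open>The weight 1/d leaves exactly half of \<open>d * energy u\<close> on the right,
    to be absorbed on the left.\<close>
  also have "\<dots> \<le> ((1 / d) * energy h + energy (\<lambda>x. cnj (u x)) / (1 / d)) / 2"
    by (rule order.trans[OF complex_Re_le_cmod L2_mult_integral_le[OF h L2_cnj[OF uL]]]) (use d in auto)
  finally have "d * energy u \<le> energy h / d" by (simp add: energy_cnj field_simps)
  thus "(- 1 - Re w)\<^sup>2 * energy u \<le> energy h" using d by (simp add: d_def[symmetric] field_simps power2_eq_square)
qed

text \<open>Valid for every w: once \<open>u\<close> itself is controlled, the energy identity
  controls its derivative and x u, and with them \<open>y\<close>.\<close>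

lemma ladder_energy_bound:
  assumes u: "ladder 1 u y" and y: "ladder (- 1) y (\<lambda>x. w * u x + h x)" and h: "h \<in> L2 lborel"
  shows "energy (\<lambda>x. of_real x * u x) \<le> ((norm w + 2) * energy u + energy h) / \<rho>"
    and "energy y \<le> 2 * ((norm w + 2) * energy u + energy h) / \<rho>"
proof -
  let ?v = "ladder_deriv 1 u y"
  have uL: "u \<in> L2 lborel" using ladder_L2[OF u] by simp
  note energy_balance[OF u y h]
  moreover have "Re w * energy u \<le> norm w * energy u"
    by (intro mult_right_mono complex_Re_le_cmod energy_nonneg)
  moreover have "Re (LBINT x. h x * cnj (u x)) \<le> (1 * energy h + energy (\<lambda>x. cnj (u x)) / 1) / 2"
    by (rule order.trans[OF complex_Re_le_cmod L2_mult_integral_le[OF h L2_cnj[OF uL]]]) auto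
  ultimately have "\<rho> * (energy ?v + energy (\<lambda>x. of_real x * u x)) \<le> (norm w + 2) * energy u + energy h"
    using energy_nonneg[of h] energy_nonneg[of u] by (simp add: energy_cnj algebra_simps)
  hence b: "energy ?v + energy (\<lambda>x. of_real x * u x) \<le> ((norm w + 2) * energy u + energy h) / \<rho>"
    using rho_pos by (simp add: field_simps)
  thus "energy (\<lambda>x. of_real x * u x) \<le> ((norm w + 2) * energy u + energy h) / \<rho>"
    using energy_nonneg[of ?v] by linarith
  have "energy (\<lambda>x. c * ?v x + s * (of_real x * u x)) \<le> 2 * energy (\<lambda>x. c * ?v x) + 2 * energy (\<lambda>x. s * (of_real x * u x))"
    using dom_derivD[OF ladder_dom_deriv[OF u]] by (intro L2_add L2_cmult)
  moreover have "(\<lambda>x. c * ?v x + s * (of_real x * u x)) = y"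
    using ladder_deriv_solve[of 1 y _ u] by (simp add: fun_eq_iff mult.assoc)
  ultimately have "energy y \<le> 2 * (energy ?v + energy (\<lambda>x. of_real x * u x))"
    by (simp add: energy_cmult norm_c norm_s)
  also have "\<dots> \<le> 2 * (((norm w + 2) * energy u + energy h) / \<rho>)"
    by (intro mult_left_mono b) auto
  finally show "energy y \<le> 2 * ((norm w + 2) * energy u + energy h) / \<rho>" by simp
qed

end

section \<open>The resolvent of the oscillator\<close>

lemma has_weak_deriv_cong_AE:
  assumes "has_weak_deriv u v" "AE x in lborel. u x = u' x" "AE x in lborel. v x = v' x"
    and [measurable]: "u \<in> borel_measurable borel" "u' \<in> borel_measurable borel"
      "v \<in> borel_measurable borel" "v' \<in> borel_measurable borel"
  shows "has_weak_deriv u' v'"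
  unfolding has_weak_deriv_def
proof (intro allI impI)
  fix \<phi> assume T: "test_function \<phi>"
  have "continuous_on UNIV \<phi>" "continuous_on UNIV (deriv \<phi>)" using test_function_props[OF T] by metis+
  hence [measurable]: "\<phi> \<in> borel_measurable borel" "deriv \<phi> \<in> borel_measurable borel"
    by (auto intro: borel_measurable_continuous_onI)
  have "(LBINT x. u x * of_real (deriv \<phi> x)) = (LBINT x. u' x * of_real (deriv \<phi> x))"
    by (rule integral_cong_AE) (use assms(2) in \<open>auto elim!: eventually_mono\<close>)
  moreover have "(LBINT x. v x * of_real (\<phi> x)) = (LBINT x. v' x * of_real (\<phi> x))"
    by (rule integral_cong_AE) (use assms(3) in \<open>auto elim!: eventually_mono\<close>)
  ultimately show "(LBINT x. u' x * of_real (deriv \<phi> x)) = - (LBINT x. v' x * of_real (\<phi> x))"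
    using assms(1) T by (simp add: has_weak_deriv_def)
qed

lemma has_ac_deriv_AE_zero:
  assumes "has_ac_deriv u v" "AE x in lborel. u x = 0" shows "AE x in lborel. v x = 0"
proof (rule has_weak_deriv_unique)
  have m: "u \<in> borel_measurable borel" "v \<in> borel_measurable borel"
    using has_ac_deriv_continuous[OF assms(1)] has_ac_derivD(1)[OF assms(1)]
    by (auto intro: borel_measurable_continuous_onI loc_integrable_measurable)
  show "has_weak_deriv (\<lambda>_. 0) v"
    by (rule has_weak_deriv_cong_AE[OF has_ac_deriv_imp_has_weak_deriv[OF assms(1)] assms(2)])
       (use m in auto)
  show "has_weak_deriv (\<lambda>_. 0) (\<lambda>_. 0)" by (simp add: has_weak_deriv_def)
qed (use assms(1) has_ac_derivD(1) in \<open>auto intro: loc_integrable_continuous\<close>)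

lemma not_AE_lborel_False: "\<not> (AE x in (lborel :: real measure). False)"
  by (simp add: eventually_False ae_filter_eq_bot_iff)

text \<open>
  The weights $r^{-n}$ make the series of squared increments summable almost everywhere, and
  Cauchy-Schwarz bounds the tails of the series of increments by it.
\<close>

lemma L2_complete:
  fixes f :: "nat \<Rightarrow> real \<Rightarrow> complex"
  assumes f: "\<And>n. f n \<in> L2 lborel" and A: "A \<ge> 0" and q: "0 \<le> q" "q < 1"
    and step: "\<And>n. energy (\<lambda>x. f (Suc n) x - f n x) \<le> A * q ^ n"
  obtains g where "g \<in> L2 lborel" "(\<lambda>n. energy (\<lambda>x. g x - f n x)) \<longlonglongrightarrow> 0"
proof -
  note fm [measurable] = L2_measurable[OF f]
  define r where "r = (q + 1) / 2"
  have r: "q < r" "r < 1" "r > 0" using q by (auto simp: r_def)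
  define d where "d n x = f (Suc n) x - f n x" for n x
  have [measurable]: "d n \<in> borel_measurable borel" for n unfolding d_def by measurable
  define D where "D n x = (norm (d n x))\<^sup>2 / r ^ n" for n x
  have [measurable]: "D n \<in> borel_measurable borel" for n unfolding D_def by measurable
  have D0: "0 \<le> D n x" for n x using r by (simp add: D_def)
  have iD: "integrable lborel (D n)" for n
    unfolding D_def d_def by (intro integrable_divide L2_integrable L2_diff f)
  have ID: "(LBINT x. D n x) \<le> A * (q / r) ^ n" for n
  proof -
    have "(LBINT x. D n x) = energy (d n) / r ^ n" by (simp add: D_def energy_def)
    also have "\<dots> \<le> A * q ^ n / r ^ n" using step[of n] r by (intro divide_right_mono) (auto simp: d_def[abs_def])
    finally show ?thesis by (simp add: power_divide)
  qed
  have sI: "summable (\<lambda>n. LBINT x. D n x)"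
  proof (rule summable_comparison_test')
    show "summable (\<lambda>n. A * (q / r) ^ n)" using q r by (intro summable_mult summable_geometric) auto
    show "norm (LBINT x. D n x) \<le> A * (q / r) ^ n" for n
      using ID[of n] D0 by (simp add: Bochner_Integration.integral_nonneg)
  qed
  have fin: "(\<integral>\<^sup>+x. (\<Sum>n. ennreal (D n x)) \<partial>lborel) = ennreal (\<Sum>n. LBINT x. D n x)"
  proof -
    have "(\<integral>\<^sup>+x. (\<Sum>n. ennreal (D n x)) \<partial>lborel) = (\<Sum>n. \<integral>\<^sup>+x. ennreal (D n x) \<partial>lborel)"
      by (rule nn_integral_suminf) auto
    also have "\<dots> = (\<Sum>n. ennreal (LBINT x. D n x))"
      by (simp add: nn_integral_eq_integral[OF iD] D0)
    also have "\<dots> = ennreal (\<Sum>n. LBINT x. D n x)"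
      by (rule suminf_ennreal2) (use sI D0 in \<open>auto intro: Bochner_Integration.integral_nonneg\<close>)
    finally show ?thesis .
  qed
  have AEs: "AE x in lborel. summable (\<lambda>n. D n x)"
  proof -
    have "AE x in lborel. (\<Sum>n. ennreal (D n x)) \<noteq> \<infinity>"
      by (rule nn_integral_PInf_AE) (use fin in auto)
    thus ?thesis by eventually_elim (use D0 in \<open>auto intro!: summable_suminf_not_top\<close>)
  qed
  define S where "S x = (\<Sum>n. D n x)" for x
  have S: "integrable lborel S"
    unfolding S_def[abs_def]
    by (rule integrable_suminf[OF iD]) (use AEs sI D0 in auto)
  have [measurable]: "S \<in> borel_measurable borel" using S by (auto dest: borel_measurable_integrable)
  have tail: "(norm (f (n + m) x - f n x))\<^sup>2 \<le> r ^ n / (1 - r) * S x" if sx: "summable (\<lambda>n. D n x)" for n m x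
  proof -
    have tele: "f (n + m) x - f n x = (\<Sum>k<m. d (n + k) x)"
      by (induction m) (auto simp: d_def algebra_simps)
    define t where "t = sqrt r"
    have t: "t > 0" "t\<^sup>2 = r" using r by (auto simp: t_def)
    have "norm (f (n + m) x - f n x) \<le> (\<Sum>k<m. norm (d (n + k) x))" unfolding tele by (rule norm_sum)
    also have "\<dots> = (\<Sum>k<m. t ^ (n + k) * (norm (d (n + k) x) / t ^ (n + k)))" using t by (intro sum.cong) auto
    finally have "(norm (f (n + m) x - f n x))\<^sup>2 \<le> (\<Sum>k<m. t ^ (n + k) * (norm (d (n + k) x) / t ^ (n + k)))\<^sup>2"
      by (intro power_mono) auto
    also have "\<dots> \<le> (\<Sum>k<m. (t ^ (n + k))\<^sup>2) * (\<Sum>k<m. (norm (d (n + k) x) / t ^ (n + k))\<^sup>2)"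
      by (rule Cauchy_Schwarz_ineq_sum)
    also have "(\<Sum>k<m. (t ^ (n + k))\<^sup>2) = r ^ n * (\<Sum>k<m. r ^ k)"
      unfolding sum_distrib_left by (intro sum.cong refl) (simp add: power_add t(2)[symmetric] power_mult_distrib power_mult[symmetric] mult.commute)
    also have "(\<Sum>k<m. (norm (d (n + k) x) / t ^ (n + k))\<^sup>2) = (\<Sum>k<m. D (n + k) x)"
      by (intro sum.cong refl) (simp add: D_def power_divide t(2)[symmetric] power_mult[symmetric] mult.commute)
    also have "r ^ n * (\<Sum>k<m. r ^ k) * (\<Sum>k<m. D (n + k) x) \<le> r ^ n * (1 / (1 - r)) * S x"
    proof (intro mult_mono)
      have "(\<Sum>k<m. r ^ k) \<le> (\<Sum>k. r ^ k)" using r by (intro sum_le_suminf summable_geometric) auto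
      thus "(\<Sum>k<m. r ^ k) \<le> 1 / (1 - r)" using r by (simp add: suminf_geometric)
      have "(\<Sum>k<m. D (n + k) x) = sum (\<lambda>k. D k x) ((+) n ` {..<m})" by (simp add: sum.reindex)
      also have "\<dots> \<le> S x" unfolding S_def by (intro sum_le_suminf sx) (use D0 in auto)
      finally show "(\<Sum>k<m. D (n + k) x) \<le> S x" .
    qed (use r D0 in \<open>auto intro!: sum_nonneg mult_nonneg_nonneg\<close>)
    finally show ?thesis by simp
  qed
  have conv: "convergent (\<lambda>n. f n x)" if sx: "summable (\<lambda>n. D n x)" for x
  proof -
    have "summable (\<lambda>n. d n x)"
    proof (rule summable_comparison_test')
      show "summable (\<lambda>n. (r ^ n + D n x) / 2)" using r by (intro summable_divide summable_add sx summable_geometric) auto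
      fix n
      have "norm (1 * d n x) \<le> (r ^ n * (norm (1::complex))\<^sup>2 + (norm (d n x))\<^sup>2 / r ^ n) / 2"
        by (rule young_mult) (use r in auto)
      thus "norm (d n x) \<le> (r ^ n + D n x) / 2" by (simp add: D_def)
    qed
    hence "convergent (\<lambda>n. \<Sum>k<n. d k x)" by (simp add: summable_iff_convergent)
    moreover have "(\<Sum>k<n. d k x) = f n x - f 0 x" for n by (induction n) (auto simp: d_def)
    ultimately have "convergent (\<lambda>n. f n x - f 0 x)" by simp
    from convergent_add[OF this convergent_const[of "f 0 x"]] show ?thesis by simp
  qed
  define g where "g x = lim (\<lambda>n. f n x)" for x
  have [measurable]: "g \<in> borel_measurable borel" unfolding g_def by measurable
  have gb: "AE x in lborel. (norm (g x - f n x))\<^sup>2 \<le> r ^ n / (1 - r) * S x" for n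
    using AEs
  proof eventually_elim
    case (elim x)
    have "(\<lambda>m. f m x) \<longlonglongrightarrow> g x" using conv[OF elim] by (simp add: g_def convergent_LIMSEQ_iff)
    hence "(\<lambda>m. f (n + m) x) \<longlonglongrightarrow> g x" using LIMSEQ_ignore_initial_segment[of _ _ n] by (simp add: add.commute)
    hence "(\<lambda>m. (norm (f (n + m) x - f n x))\<^sup>2) \<longlonglongrightarrow> (norm (g x - f n x))\<^sup>2" by (intro tendsto_intros)
    thus ?case by (rule LIMSEQ_le_const2) (use tail[OF elim] in auto)
  qed
  have gL: "(\<lambda>x. g x - f n x) \<in> L2 lborel" for n
  proof (rule L2I)
    show "integrable lborel (\<lambda>x. (norm (g x - f n x))\<^sup>2)"
    proof (rule Bochner_Integration.integrable_bound)
      show "integrable lborel (\<lambda>x. r ^ n / (1 - r) * S x)" using S by simp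
      show "AE x in lborel. norm ((norm (g x - f n x))\<^sup>2) \<le> norm (r ^ n / (1 - r) * S x)"
        using gb[of n] by eventually_elim (unfold real_norm_def abs_power2, linarith)
    qed auto
  qed auto
  have bound: "energy (\<lambda>x. g x - f n x) \<le> r ^ n * ((LBINT x. S x) / (1 - r))" for n
  proof -
    have "energy (\<lambda>x. g x - f n x) \<le> (LBINT x. r ^ n / (1 - r) * S x)"
      unfolding energy_def by (rule integral_mono_AE[OF L2_integrable[OF gL]]) (use S gb in auto)
    thus ?thesis by simp
  qed
  have "(\<lambda>n. r ^ n * ((LBINT x. S x) / (1 - r))) \<longlonglongrightarrow> 0 * ((LBINT x. S x) / (1 - r))"
    using r by (intro tendsto_mult tendsto_const LIMSEQ_realpow_zero) auto
  hence lim: "(\<lambda>n. r ^ n * ((LBINT x. S x) / (1 - r))) \<longlonglongrightarrow> 0" by simp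
  have "(\<lambda>n. energy (\<lambda>x. g x - f n x)) \<longlonglongrightarrow> 0"
    by (rule tendsto_sandwich[OF _ _ tendsto_const lim])
       (intro always_eventually allI energy_nonneg bound)+
  moreover have "g \<in> L2 lborel" using L2_add(1)[OF gL[of 0] f[of 0]] by simp
  ultimately show thesis by (rule that[rotated])
qed

section \<open>Gaussians and the range of the two first-order operators\<close>

lemma has_ac_deriv_exp_square:
  "has_ac_deriv (\<lambda>x. exp (a * (of_real x)\<^sup>2)) (\<lambda>x. 2 * a * of_real x * exp (a * (of_real x)\<^sup>2))"
proof (rule has_ac_deriv_C1)
  have "((\<lambda>z. exp (a * z\<^sup>2)) has_field_derivative (2 * a * z * exp (a * z\<^sup>2))) (at z)" for z
    by (auto intro!: derivative_eq_intros)
  thus "((\<lambda>x. exp (a * (of_real x)\<^sup>2)) has_vector_derivative 2 * a * of_real x * exp (a * (of_real x)\<^sup>2)) (at x)" for x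
    by (rule has_vector_derivative_real_field)
qed (auto intro!: continuous_intros)

context
  fixes \<kappa> N :: real assumes \<kappa>: "\<kappa> > 0" and N: "N > 0"
begin

text \<open>On the tail the factor t/N is at least 1 and turns the integrand into an exact
  derivative.\<close>

lemma gaussian_tail:
  shows "integrable lborel (\<lambda>t. indicator {N..} t * exp (- \<kappa> * t\<^sup>2))"
    "(LBINT t. indicator {N..} t * exp (- \<kappa> * t\<^sup>2)) \<le> exp (- \<kappa> * N\<^sup>2) / (2 * \<kappa> * N)"
proof -
  let ?F = "\<lambda>t. - exp (- \<kappa> * t\<^sup>2) / (2 * \<kappa> * N)"
  let ?f = "\<lambda>t. t / N * exp (- \<kappa> * t\<^sup>2)"
  have lim: "(?F \<longlongrightarrow> 0) at_top"
  proof -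
    have "filterlim (\<lambda>t::real. t\<^sup>2) at_top at_top" by (rule filterlim_pow_at_top) (auto simp: filterlim_ident)
    hence "filterlim (\<lambda>t::real. \<kappa> * t\<^sup>2) at_top at_top"
      using \<kappa> by (intro filterlim_tendsto_pos_mult_at_top[OF tendsto_const])
    hence "filterlim (\<lambda>t::real. - (\<kappa> * t\<^sup>2)) at_bot at_top" by (simp add: filterlim_uminus_at_bot)
    hence "((\<lambda>t. exp (- (\<kappa> * t\<^sup>2))) \<longlongrightarrow> 0) at_top" by (rule filterlim_compose[OF exp_at_bot])
    hence "((\<lambda>t. - exp (- (\<kappa> * t\<^sup>2)) / (2 * \<kappa> * N)) \<longlongrightarrow> - 0 / (2 * \<kappa> * N)) at_top"
      using \<kappa> N by (intro tendsto_intros) auto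
    thus ?thesis by simp
  qed
  have I: "(\<integral>\<^sup>+t. ennreal (?f t) * indicator {N..} t \<partial>lborel) = 0 - ?F N"
  proof (rule nn_integral_FTC_atLeast[OF _ _ _ lim])
    show "(?F has_real_derivative ?f x) (at x)" for x
      using \<kappa> N by (auto intro!: derivative_eq_intros simp: field_simps)
  qed (use N in auto)
  have le: "(\<integral>\<^sup>+t. ennreal (indicator {N..} t * exp (- \<kappa> * t\<^sup>2)) \<partial>lborel) \<le> ennreal (exp (- \<kappa> * N\<^sup>2) / (2 * \<kappa> * N))"
  proof -
    have "(\<integral>\<^sup>+t. ennreal (indicator {N..} t * exp (- \<kappa> * t\<^sup>2)) \<partial>lborel) \<le> (\<integral>\<^sup>+t. ennreal (?f t) * indicator {N..} t \<partial>lborel)"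
    proof (intro nn_integral_mono)
      fix t
      have "exp (- \<kappa> * t\<^sup>2) \<le> ?f t" if "t \<ge> N"
        using mult_right_mono[of 1 "t / N" "exp (- \<kappa> * t\<^sup>2)"] N that by simp
      thus "ennreal (indicator {N..} t * exp (- \<kappa> * t\<^sup>2)) \<le> ennreal (?f t) * indicator {N..} t"
        by (cases "t \<ge> N") (auto intro: ennreal_leI)
    qed
    thus ?thesis unfolding I by simp
  qed
  show i: "integrable lborel (\<lambda>t. indicator {N..} t * exp (- \<kappa> * t\<^sup>2))"
    by (rule integrableI_nonneg) (use le in \<open>auto simp: less_top[symmetric] top_unique\<close>)
  have "ennreal (LBINT t. indicator {N..} t * exp (- \<kappa> * t\<^sup>2)) \<le> ennreal (exp (- \<kappa> * N\<^sup>2) / (2 * \<kappa> * N))"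
    using le nn_integral_eq_integral[OF i] by simp
  thus "(LBINT t. indicator {N..} t * exp (- \<kappa> * t\<^sup>2)) \<le> exp (- \<kappa> * N\<^sup>2) / (2 * \<kappa> * N)"
    using \<kappa> N by (subst (asm) ennreal_le_iff) auto
qed

lemma gaussian_tail_left:
  shows "integrable lborel (\<lambda>t. indicator {..-N} t * exp (- \<kappa> * t\<^sup>2))"
    "(LBINT t. indicator {..-N} t * exp (- \<kappa> * t\<^sup>2)) \<le> exp (- \<kappa> * N\<^sup>2) / (2 * \<kappa> * N)"
proof -
  have e: "indicator {..-N} (0 + (-1) * t) * exp (- \<kappa> * (0 + (-1) * t)\<^sup>2) = indicator {N..} t * exp (- \<kappa> * t\<^sup>2)" for t
    by (auto simp: indicator_def)
  show "integrable lborel (\<lambda>t. indicator {..-N} t * exp (- \<kappa> * t\<^sup>2))"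
    by (subst lborel_integrable_real_affine_iff[of "-1" _ 0, symmetric]) (use gaussian_tail(1) e in auto)
  show "(LBINT t. indicator {..-N} t * exp (- \<kappa> * t\<^sup>2)) \<le> exp (- \<kappa> * N\<^sup>2) / (2 * \<kappa> * N)"
    by (subst lborel_integral_real_affine[of "-1" _ 0]) (use gaussian_tail(2) e in auto)
qed

end

context rotated_oscillator
begin

definition ground :: "real \<Rightarrow> complex" where "ground x = exp (- (s\<^sup>2 / 2) * (of_real x)\<^sup>2)"

lemma ground_nz: "ground x \<noteq> 0" by (simp add: ground_def)

lemma norm_ground: "norm (ground x) = exp (- (\<rho> / 2) * x\<^sup>2)"
proof -
  have "- (s\<^sup>2 / 2) * (of_real x)\<^sup>2 = of_real (x\<^sup>2) * (- (s\<^sup>2) / 2)" by simp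
  hence "Re (- (s\<^sup>2 / 2) * (of_real x)\<^sup>2) = x\<^sup>2 * (- \<rho> / 2)"
    using Re_s2 by (simp only: Re_complex_of_real Im_complex_of_real times_complex.sel) simp
  thus ?thesis by (simp add: ground_def)
qed

lemma norm_ground_sq: "(norm (ground x))\<^sup>2 = exp (- \<rho> * x\<^sup>2)"
  by (simp add: norm_ground power2_eq_square flip: exp_add)

lemma ground_ac: "has_ac_deriv ground (\<lambda>x. - (s\<^sup>2) * of_real x * ground x)"
  using has_ac_deriv_exp_square[of "- (s\<^sup>2 / 2)"] by (simp add: ground_def[abs_def])

lemma inverse_ground_ac: "has_ac_deriv (\<lambda>x. inverse (ground x)) (\<lambda>x. s\<^sup>2 * of_real x * inverse (ground x))"
  using has_ac_deriv_exp_square[of "s\<^sup>2 / 2"] by (simp add: ground_def[abs_def] exp_minus[symmetric])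

lemma ground_ladder: "ladder 1 ground (\<lambda>_. 0)"
proof -
  have ac: "has_ac_deriv ground (ladder_deriv 1 ground (\<lambda>_. 0))"
    using ground_ac by (simp add: ladder_deriv_def[abs_def] power2_eq_square mult_ac)
  have "ground \<in> L2 lborel"
    by (rule ladder_growth_imp_L2[OF _ ac L2_zero, of 0]) auto
  thus ?thesis using ladder_regularity[OF _ ac _ L2_zero] by simp
qed

text \<open>Variation of constants with the Gaussian as homogeneous solution. Any antiderivative
  \<open>U\<close> will do: for \<sigma> = 1 the boundary term in
  \<open>ladder_growth_imp_L2\<close> has the good sign, so no side condition on \<open>h\<close>
  arises.\<close>

lemma ladder_lower_surj:
  assumes h: "h \<in> L2 lborel"
  obtains y where "ladder 1 y h"
proof -
  obtain U where U: "has_ac_deriv U (\<lambda>x. h x * (s * inverse (ground x)))"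
    using ac_antiderivative loc_integrable_mult_continuous[OF L2_loc_integrable[OF h]]
      continuous_on_mult[OF continuous_on_const has_ac_deriv_continuous[OF inverse_ground_ac]] by metis
  have "has_ac_deriv (\<lambda>x. U x * ground x) (\<lambda>x. (h x * (s * inverse (ground x))) * ground x + (- (s\<^sup>2) * of_real x * ground x) * U x)"
    by (rule has_ac_deriv_mult[OF U ground_ac])
  moreover have "(h x * (s * inverse (ground x))) * ground x + (- (s\<^sup>2) * of_real x * ground x) * U x
     = ladder_deriv 1 (\<lambda>x. U x * ground x) h x" for x
    using ground_nz[of x] by (simp add: ladder_deriv_def field_simps power2_eq_square)
  ultimately have ac: "has_ac_deriv (\<lambda>x. U x * ground x) (ladder_deriv 1 (\<lambda>x. U x * ground x) h)" by simp
  have "(\<lambda>x. U x * ground x) \<in> L2 lborel"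
    by (rule ladder_growth_imp_L2[OF _ ac h, of 0]) auto
  from ladder_regularity[OF _ ac this h] show thesis by (intro that) auto
qed

text \<open>Here the homogeneous solution is the growing function 1/ground, so the antiderivative
  \<open>V\<close> has to vanish at both ends: at minus infinity by its definition, at plus infinity
  by the orthogonality. Gaussian tails then compensate the growth up to the boundary term allowed by
  \<open>ladder_growth_imp_L2\<close>.\<close>

lemma ladder_raise_surj:
  assumes y: "y \<in> L2 lborel" and orth: "(LBINT x. ground x * y x) = 0"
  obtains u where "ladder (- 1) u y"
proof -
  define p where "p x = ground x * y x" for x
  have gL: "ground \<in> L2 lborel" using ladder_L2[OF ground_ladder] by simp
  note [measurable] = L2_measurable[OF gL] L2_measurable[OF y]
  have ip: "integrable lborel p" unfolding p_def by (rule L2_mult_integrable[OF gL y])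
  have iA: "integrable lborel (\<lambda>t. indicator A t *\<^sub>R p t)" if "A \<in> sets borel" for A
    by (rule integrable_mult_indicator) (use ip that in auto)
  have pl: "loc_integrable p"
    unfolding loc_integrable_def set_integrable_def using iA borel_measurable_integrable[OF ip] by auto
  define V where "V x = (LBINT t. indicator {..x} t *\<^sub>R p t)" for x
  have V: "has_ac_deriv V p"
    unfolding has_ac_deriv_def
  proof (intro conjI allI impI pl)
    fix a b :: real assume "a \<le> b"
    have "V b - V a = (LBINT t. indicator {..b} t *\<^sub>R p t - indicator {..a} t *\<^sub>R p t)"
      unfolding V_def using iA[of "{..a}"] iA[of "{..b}"] by simp
    also have "\<dots> = (LBINT t:{a..b}. p t)"
      unfolding set_lebesgue_integral_def
    proof (rule integral_cong_AE)
      have "AE t in lborel. t \<noteq> a" by (rule AE_lborel_singleton)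
      thus "AE t in lborel. indicator {..b} t *\<^sub>R p t - indicator {..a} t *\<^sub>R p t = indicator {a..b} t *\<^sub>R p t"
        by eventually_elim (use \<open>a \<le> b\<close> in \<open>auto simp: indicator_def\<close>)
    qed (use borel_measurable_integrable[OF ip] in auto)
    finally show "(LBINT t:{a..b}. p t) = V b - V a" ..
  qed
  define u where "u x = - s * (V x * inverse (ground x))" for x
  have "has_ac_deriv u (\<lambda>x. - s * (p x * inverse (ground x) + (s\<^sup>2 * of_real x * inverse (ground x)) * V x))"
    unfolding u_def by (intro has_ac_deriv_cmult has_ac_deriv_mult V inverse_ground_ac)
  moreover have "- s * (p x * inverse (ground x) + (s\<^sup>2 * of_real x * inverse (ground x)) * V x) = ladder_deriv (- 1) u y x" for x
    using ground_nz[of x] by (simp add: ladder_deriv_def p_def u_def field_simps power2_eq_square)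
  ultimately have ac: "has_ac_deriv u (ladder_deriv (- 1) u y)" by simp
  define B where "B = (1 / (2 * \<rho>) + energy y) / 2"
  have B0: "B \<ge> 0" using rho_pos energy_nonneg[of y] by (simp add: B_def)
  \<comment> \<open>Stated for an arbitrary tail set \<open>A\<close>, so that it serves both the
    left end and the right end.\<close>
  have bd: "N * (norm (u x))\<^sup>2 \<le> B\<^sup>2"
    if N: "N > 0" and x: "\<bar>x\<bar> = N" and A: "A \<in> sets borel"
      and Vx: "norm (V x) = norm (LBINT t. indicator A t *\<^sub>R p t)"
      and tl: "integrable lborel (\<lambda>t. indicator A t * exp (- \<rho> * t\<^sup>2))"
         "(LBINT t. indicator A t * exp (- \<rho> * t\<^sup>2)) \<le> exp (- \<rho> * N\<^sup>2) / (2 * \<rho> * N)"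
    for N x A
  proof -
    define e where "e = exp (\<rho> / 2 * N\<^sup>2)"
    have "e\<^sup>2 = exp (\<rho> * N\<^sup>2)" by (simp add: e_def power2_eq_square mult_exp_exp)
    hence e2: "exp (- \<rho> * N\<^sup>2) = 1 / e\<^sup>2" by (simp add: exp_minus inverse_eq_divide)
    have "x\<^sup>2 = N\<^sup>2" using x by (metis power2_abs)
    hence e3: "norm (ground x) = 1 / e" by (simp add: norm_ground e_def exp_minus inverse_eq_divide)
    have e1: "e > 0" by (simp add: e_def)
    note e = e1 e2 e3
    \<comment> \<open>This weight makes both terms of Young's inequality multiples of
      \<open>1 / (e * sqrt N)\<close>, with sum \<open>B / (e * sqrt N)\<close>; the factor
      \<open>e\<close>, the size of 1/ground at x, then cancels.\<close>
    define \<eta> where "\<eta> = e * sqrt N"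
    have \<eta>: "\<eta> > 0" using e N by (simp add: \<eta>_def)
    have sq: "(norm (indicator A t *\<^sub>R ground t))\<^sup>2 = indicator A t * exp (- \<rho> * t\<^sup>2)" for t
      by (auto simp: indicator_def norm_ground_sq)
    have AL: "(\<lambda>t. indicator A t *\<^sub>R ground t) \<in> L2 lborel"
    proof (rule L2I)
      show "(\<lambda>t. indicator A t *\<^sub>R ground t) \<in> borel_measurable borel" using A by measurable
    qed (use tl(1) sq in simp)
    have "norm (V x) = norm (LBINT t. (indicator A t *\<^sub>R ground t) * y t)"
      unfolding Vx by (simp add: p_def)
    also have "\<dots> \<le> (\<eta> * energy (\<lambda>t. indicator A t *\<^sub>R ground t) + energy y / \<eta>) / 2"
      by (rule L2_mult_integral_le[OF AL y \<eta>])
    also have "\<dots> \<le> (\<eta> * (1 / e\<^sup>2 / (2 * \<rho> * N)) + energy y / \<eta>) / 2"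
      using tl(2) \<eta> unfolding energy_def sq e(2) by (intro divide_right_mono add_right_mono mult_left_mono) auto
    also have "\<dots> = B / (e * sqrt N)"
      using e N rho_pos by (simp add: B_def \<eta>_def power2_eq_square field_simps real_sqrt_mult_self)
    finally have "norm (V x) \<le> B / (e * sqrt N)" .
    moreover have "norm (u x) = norm (V x) * e"
      using e by (simp add: u_def norm_mult norm_s norm_inverse)
    ultimately have "norm (u x) \<le> B / (e * sqrt N) * e"
      using mult_right_mono[of "norm (V x)" "B / (e * sqrt N)" e] e(1) by simp
    also have "\<dots> = B / sqrt N" using e(1) by simp
    finally have "norm (u x) \<le> B / sqrt N" .
    hence "(norm (u x))\<^sup>2 \<le> (B / sqrt N)\<^sup>2" by (intro power_mono) auto
    also have "\<dots> = B\<^sup>2 / N" using N by (simp add: power_divide)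
    finally show ?thesis using N by (simp add: field_simps)
  qed
  have "u \<in> L2 lborel"
  proof (rule ladder_growth_imp_L2[OF _ ac y])
    fix N :: real assume N: "N > 0"
    have 1: "N * (norm (u (- N)))\<^sup>2 \<le> B\<^sup>2"
      by (rule bd[OF N, of _ "{..-N}"]) (use N gaussian_tail_left[OF rho_pos N] in \<open>auto simp: V_def\<close>)
    \<comment> \<open>The only use of the orthogonality: the integral up to N equals minus the
      integral over the right tail.\<close>
    have "V N = - (LBINT t. indicator {N..} t *\<^sub>R p t)"
    proof -
      have "V N + (LBINT t. indicator {N..} t *\<^sub>R p t) = (LBINT t. indicator {..N} t *\<^sub>R p t + indicator {N..} t *\<^sub>R p t)"
        unfolding V_def using iA[of "{..N}"] iA[of "{N..}"] by simp
      also have "\<dots> = (LBINT t. p t)"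
      proof (rule integral_cong_AE)
        have "AE t in lborel. t \<noteq> N" by (rule AE_lborel_singleton)
        thus "AE t in lborel. indicator {..N} t *\<^sub>R p t + indicator {N..} t *\<^sub>R p t = p t"
          by eventually_elim (auto simp: indicator_def)
      qed (use borel_measurable_integrable[OF ip] in auto)
      finally show ?thesis using orth by (simp add: p_def[abs_def] add_eq_0_iff)
    qed
    hence 2: "N * (norm (u N))\<^sup>2 \<le> B\<^sup>2"
      by (intro bd[OF N, of _ "{N..}"]) (use N gaussian_tail[OF rho_pos N] in auto)
    show "- (- 1) * (N * ((norm (u N))\<^sup>2 + (norm (u (- N)))\<^sup>2)) \<le> 2 * B\<^sup>2"
      using 1 2 by (simp add: distrib_left)
  qed auto
  from ladder_regularity[OF _ ac this y] show thesis by (intro that) auto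
qed

lemma ladder_AE_zero:
  assumes "ladder \<sigma> u f" "\<sigma>\<^sup>2 = 1" "AE x in lborel. u x = 0" shows "AE x in lborel. f x = 0"
proof -
  have "AE x in lborel. ladder_deriv \<sigma> u f x = 0"
    by (rule has_ac_deriv_AE_zero[OF dom_derivD(1)[OF ladder_dom_deriv[OF assms(1)]] assms(3)])
  thus ?thesis using assms(3)
    by eventually_elim (subst ladder_deriv_solve[OF assms(2), of f _ u], simp)
qed

lemma ground_square_integral_nz: "(LBINT x. ground x * ground x) \<noteq> 0"
proof
  assume z: "(LBINT x. ground x * ground x) = 0"
  have gL: "ground \<in> L2 lborel" using ladder_L2[OF ground_ladder] by simp
  obtain u where u: "ladder (- 1) u ground" using ladder_raise_surj[OF gL z] .
  note c = ladder_commute[of "-1", simplified, OF u ground_ladder]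
  have "(- 1 - Re (- 2))\<^sup>2 * energy u \<le> energy (\<lambda>_::real. 0::complex)"
    by (rule resolvent_estimate[OF c(1)]) (use c(2) in \<open>auto simp: L2_zero\<close>)
  moreover have "energy (\<lambda>_::real. 0::complex) = 0" by (simp add: energy_def)
  ultimately have "energy u = 0" using energy_nonneg[of u] by simp
  hence "AE x in lborel. u x = 0" using ladder_L2(1)[OF u] by (intro energy_eq_0_imp) auto
  hence "AE x in lborel. ground x = 0" by (rule ladder_AE_zero[OF u, rotated]) auto
  thus False using ground_nz not_AE_lborel_False by simp
qed

section \<open>From one solvable point to the whole resolvent set\<close>

text \<open>Surjectivity of \<open>ba - w\<close>, with \<open>y\<close> standing for a u.\<close>

definition solvable :: "complex \<Rightarrow> bool" where
  "solvable w \<longleftrightarrow> (\<forall>h\<in>L2 lborel. \<exists>u y. ladder 1 u y \<and> ladder (- 1) y (\<lambda>x. w * u x + h x))"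

text \<open>Solve a z = h, then b u = z. The solution \<open>z\<close> is free up to a multiple of
  ground; the coefficient \<open>a\<close> makes it orthogonal to ground, which the second equation
  requires.\<close>

lemma solvable_minus_two: "solvable (- 2)"
  unfolding solvable_def
proof
  fix h :: "real \<Rightarrow> complex" assume h: "h \<in> L2 lborel"
  have gL: "ground \<in> L2 lborel" using ladder_L2[OF ground_ladder] by simp
  obtain y0 where y0: "ladder 1 y0 h" using ladder_lower_surj[OF h] .
  have y0L: "y0 \<in> L2 lborel" using ladder_L2[OF y0] by simp
  define a where "a = (LBINT x. ground x * y0 x) / (LBINT x. ground x * ground x)"
  define z where "z x = y0 x - a * ground x" for x
  have z: "ladder 1 z h"
    using ladder_diff[OF y0 ladder_cmult[OF ground_ladder, of a]] by (simp add: z_def[abs_def])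
  have zL: "z \<in> L2 lborel" using ladder_L2[OF z] by simp
  have "(LBINT x. ground x * z x) = (LBINT x. ground x * y0 x - a * (ground x * ground x))"
    by (simp add: z_def algebra_simps)
  also have "\<dots> = 0"
    using L2_mult_integrable[OF gL y0L] L2_mult_integrable[OF gL gL] ground_square_integral_nz
    by (simp add: a_def)
  finally obtain u where u: "ladder (- 1) u z" using ladder_raise_surj[OF zL] by blast
  show "\<exists>u y. ladder 1 u y \<and> ladder (- 1) y (\<lambda>x. - 2 * u x + h x)"
    using ladder_commute[of "-1", simplified, OF u z] by (auto simp: algebra_simps)
qed

text \<open>The Neumann series as a fixed-point iteration g -> R(h + (w - w0) g). The selected
  solution map \<open>R\<close> is not known to be linear, but the resolvent estimate applied to
  differences of solutions makes the iteration a contraction.\<close>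

lemma solvable_nearby:
  assumes sol: "solvable w0" and w0: "Re w0 < - 1" and w: "norm (w - w0) < - 1 - Re w0"
  shows "solvable w"
  unfolding solvable_def
proof
  fix h :: "real \<Rightarrow> complex" assume h: "h \<in> L2 lborel"
  define d where "d = - 1 - Re w0"
  have d: "d > 0" using w0 by (simp add: d_def)
  define q where "q = (norm (w - w0) / d)\<^sup>2"
  have q: "0 \<le> q" "q < 1" using w d by (auto simp: q_def d_def abs_square_less_1)
  obtain R Y where RY: "\<And>h. h \<in> L2 lborel \<Longrightarrow> ladder 1 (R h) (Y h)"
    "\<And>h. h \<in> L2 lborel \<Longrightarrow> ladder (- 1) (Y h) (\<lambda>x. w0 * R h x + h x)"
    using sol unfolding solvable_def by metis
  have RL: "R h \<in> L2 lborel" if "h \<in> L2 lborel" for h using ladder_L2[OF RY(1)[OF that]] by simp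
  define T where "T g x = h x + (w - w0) * g x" for g x
  have TL: "T g \<in> L2 lborel" if "g \<in> L2 lborel" for g
    unfolding T_def using that by (intro L2_add L2_cmult h)
  have contr: "energy (\<lambda>x. R (T g) x - R (T g') x) \<le> q * energy (\<lambda>x. g x - g' x)"
    if g: "g \<in> L2 lborel" "g' \<in> L2 lborel" for g g'
  proof -
    have "d\<^sup>2 * energy (\<lambda>x. R (T g) x - R (T g') x) \<le> energy (\<lambda>x. T g x - T g' x)"
      unfolding d_def
    proof (rule resolvent_estimate[OF ladder_diff[OF RY(1)[OF TL[OF g(1)]] RY(1)[OF TL[OF g(2)]]] _ _ w0])
      show "ladder (- 1) (\<lambda>x. Y (T g) x - Y (T g') x) (\<lambda>x. w0 * (R (T g) x - R (T g') x) + (T g x - T g' x))"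
        using ladder_diff[OF RY(2)[OF TL[OF g(1)]] RY(2)[OF TL[OF g(2)]]] by (simp add: algebra_simps)
    qed (intro L2_diff TL g)
    also have "(\<lambda>x. T g x - T g' x) = (\<lambda>x. (w - w0) * (g x - g' x))" by (simp add: T_def fun_eq_iff algebra_simps)
    also have "energy \<dots> = (norm (w - w0))\<^sup>2 * energy (\<lambda>x. g x - g' x)" by (rule energy_cmult)
    finally show ?thesis using d by (simp add: q_def power_divide pos_le_divide_eq mult.commute)
  qed
  define F where "F n = ((\<lambda>g. R (T g)) ^^ n) (\<lambda>_. 0)" for n
  have F0: "F 0 = (\<lambda>_. 0)" and FS: "F (Suc n) = R (T (F n))" for n by (simp_all add: F_def)
  have FL: "F n \<in> L2 lborel" for n by (induction n) (auto simp: F0 FS L2_zero intro: RL TL)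
  define A where "A = energy (\<lambda>x. F (Suc 0) x - F 0 x)"
  have step: "energy (\<lambda>x. F (Suc n) x - F n x) \<le> A * q ^ n" for n
  proof (induction n)
    case (Suc n)
    have "energy (\<lambda>x. F (Suc (Suc n)) x - F (Suc n) x) \<le> q * energy (\<lambda>x. F (Suc n) x - F n x)"
      unfolding FS[of "Suc n"] using contr[OF FL[of "Suc n"] FL[of n]] by (simp add: FS)
    also have "\<dots> \<le> q * (A * q ^ n)" by (intro mult_left_mono Suc q)
    finally show ?case by (simp add: mult_ac)
  qed (simp add: A_def)
  obtain g where g: "g \<in> L2 lborel" "(\<lambda>n. energy (\<lambda>x. g x - F n x)) \<longlonglongrightarrow> 0"
    by (rule L2_complete[OF FL _ q step]) (auto simp: A_def energy_nonneg)
  define u where "u = R (T g)"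
  have uL: "u \<in> L2 lborel" unfolding u_def by (intro RL TL g)
  have "energy (\<lambda>x. u x - g x) \<le> 2 * (q * energy (\<lambda>x. g x - F n x)) + 2 * energy (\<lambda>x. g x - F (Suc n) x)" for n
  proof -
    have "energy (\<lambda>x. (u x - F (Suc n) x) - (g x - F (Suc n) x)) \<le>
       2 * energy (\<lambda>x. u x - F (Suc n) x) + 2 * energy (\<lambda>x. g x - F (Suc n) x)"
      by (intro energy_diff_le L2_diff uL g FL)
    moreover have "energy (\<lambda>x. u x - F (Suc n) x) \<le> q * energy (\<lambda>x. g x - F n x)"
      unfolding u_def FS by (intro contr g FL)
    ultimately show ?thesis by simp
  qed
  moreover have "(\<lambda>n. 2 * (q * energy (\<lambda>x. g x - F n x)) + 2 * energy (\<lambda>x. g x - F (Suc n) x)) \<longlonglongrightarrow> 2 * (q * 0) + 2 * 0"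
    by (intro tendsto_intros g LIMSEQ_Suc[OF g(2)])
  ultimately have "energy (\<lambda>x. u x - g x) \<le> 2 * (q * 0) + 2 * 0"
    by (intro LIMSEQ_le_const) auto
  hence "energy (\<lambda>x. u x - g x) = 0" using energy_nonneg[of "\<lambda>x. u x - g x"] by simp
  hence ae: "AE x in lborel. u x - g x = 0" by (intro energy_eq_0_imp L2_diff uL g)
  have y1: "ladder 1 u (Y (T g))" unfolding u_def by (intro RY TL g)
  have "ladder (- 1) (Y (T g)) (\<lambda>x. w0 * u x + T g x)" unfolding u_def by (intro RY TL g)
  hence "ladder (- 1) (Y (T g)) (\<lambda>x. w * u x + h x)"
  \<comment> \<open>The continuous representative \<open>u\<close> and the limit \<open>g\<close>
    agree only almost everywhere, so the right side is exchanged up to null sets.\<close>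
  proof (rule ladder_cong_AE)
    show "AE x in lborel. w0 * u x + T g x = w * u x + h x"
      using ae by eventually_elim (simp add: T_def algebra_simps)
    show "(\<lambda>x. w * u x + h x) \<in> borel_measurable borel"
      by (intro L2_measurable L2_add L2_cmult uL h)
  qed
  thus "\<exists>u y. ladder 1 u y \<and> ladder (- 1) y (\<lambda>x. w * u x + h x)" using y1 by blast
qed

text \<open>The centres -1 - (3/2)^k, each with a disc of radius (3/2)^k, start at -2. Every centre
  lies at half the radius from the previous one, and the discs exhaust the half-plane.\<close>

lemma solvable_half_plane:
  assumes w: "Re w < - 1" shows "solvable w"
proof -
  have seq: "solvable (of_real (- 1 - (3 / 2) ^ k))" for k :: nat
  proof (induction k)
    case 0 show ?case using solvable_minus_two by simp
  next
    case (Suc k)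
    show ?case
    proof (rule solvable_nearby[OF Suc])
      have "norm (complex_of_real (- 1 - (3 / 2) ^ Suc k) - of_real (- 1 - (3 / 2) ^ k)) = (3 / 2) ^ k / 2"
        unfolding of_real_diff[symmetric] norm_of_real by simp
      thus "norm (complex_of_real (- 1 - (3 / 2) ^ Suc k) - of_real (- 1 - (3 / 2) ^ k))
          < - 1 - Re (of_real (- 1 - (3 / 2) ^ k))" by simp
    qed simp
  qed
  define a where "a = - 1 - Re w"
  have a: "a > 0" using w by (simp add: a_def)
  obtain k where k: "(a\<^sup>2 + (Im w)\<^sup>2) / (2 * a) < (3 / 2) ^ k"
    using real_arch_pow[of "3 / 2" "(a\<^sup>2 + (Im w)\<^sup>2) / (2 * a)"] by auto
  define D :: real where "D = (3 / 2) ^ k"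
  \<comment> \<open>This says that \<open>w\<close> lies in the disc of radius \<open>D\<close>
    about -1 - D.\<close>
  have D: "a\<^sup>2 + (Im w)\<^sup>2 < 2 * a * D" using k a by (simp add: D_def field_simps)
  have D0: "D > 0" by (simp add: D_def)
  show ?thesis
  proof (rule solvable_nearby[OF seq[of k]])
    have "(norm (w - of_real (- 1 - D)))\<^sup>2 = (D - a)\<^sup>2 + (Im w)\<^sup>2"
      by (simp add: cmod_power2 a_def algebra_simps)
    also have "\<dots> < D\<^sup>2" using D by (simp add: power2_eq_square algebra_simps)
    finally have "norm (w - of_real (- 1 - D)) < D" using D0 by (meson less_imp_le power2_less_imp_less)
    thus "norm (w - of_real (- 1 - (3 / 2) ^ k)) < - 1 - Re (of_real (- 1 - (3 / 2) ^ k))"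
      by (simp add: D_def)
  qed simp
qed

text \<open>The bounds on \<open>y\<close> and on x u are carried along because the image of
  \<open>u\<close> under the other ladder operator is 2 s x u - y.\<close>

definition boundedly_solvable :: "complex \<Rightarrow> bool" where
  "boundedly_solvable w \<longleftrightarrow> (\<exists>C\<ge>0. \<forall>h\<in>L2 lborel. \<exists>u y. ladder 1 u y \<and>
     ladder (- 1) y (\<lambda>x. w * u x + h x) \<and> energy u \<le> C * energy h \<and>
     energy y \<le> C * energy h \<and> energy (\<lambda>x. of_real x * u x) \<le> C * energy h)"

lemma boundedly_solvableI:
  assumes C: "C \<ge> 0" and ex: "\<And>h. h \<in> L2 lborel \<Longrightarrow> \<exists>u y. ladder 1 u y \<and>
     ladder (- 1) y (\<lambda>x. w * u x + h x) \<and> energy u \<le> C * energy h"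
  shows "boundedly_solvable w"
proof -
  define M where "M = ((norm w + 2) * C + 1) / \<rho>"
  have M: "M \<ge> 0" using C rho_pos by (simp add: M_def)
  show ?thesis unfolding boundedly_solvable_def
  proof (intro exI[of _ "C + 2 * M"] conjI ballI)
    fix h :: "real \<Rightarrow> complex" assume h: "h \<in> L2 lborel"
    obtain u y where u: "ladder 1 u y" and y: "ladder (- 1) y (\<lambda>x. w * u x + h x)"
      and eu: "energy u \<le> C * energy h"
      using ex[OF h] by blast
    have "((norm w + 2) * energy u + energy h) / \<rho> \<le> ((norm w + 2) * (C * energy h) + energy h) / \<rho>"
      using rho_pos by (intro mult_left_mono divide_right_mono add_right_mono eu) auto
    also have "\<dots> = M * energy h" by (simp add: M_def algebra_simps add_divide_distrib)
    finally have m: "((norm w + 2) * energy u + energy h) / \<rho> \<le> M * energy h" .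
    have nn: "0 \<le> M * energy h" "0 \<le> C * energy h" using C M energy_nonneg[of h] by auto
    have split: "(C + 2 * M) * energy h = C * energy h + 2 * (M * energy h)" by (simp add: algebra_simps)
    have "energy (\<lambda>x. of_real x * u x) \<le> M * energy h"
      by (rule order.trans[OF ladder_energy_bound(1)[OF u y h] m])
    moreover have "energy y \<le> 2 * (M * energy h)"
      using ladder_energy_bound(2)[OF u y h] mult_left_mono[OF m, of 2] by simp
    ultimately have "energy u \<le> (C + 2 * M) * energy h" "energy y \<le> (C + 2 * M) * energy h"
      "energy (\<lambda>x. of_real x * u x) \<le> (C + 2 * M) * energy h"
      unfolding split using nn eu by linarith+
    thus "\<exists>u y. ladder 1 u y \<and> ladder (- 1) y (\<lambda>x. w * u x + h x) \<and> energy u \<le> (C + 2 * M) * energy h \<and>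
       energy y \<le> (C + 2 * M) * energy h \<and> energy (\<lambda>x. of_real x * u x) \<le> (C + 2 * M) * energy h"
      using u y by blast
  qed (use C M in simp)
qed

lemma boundedly_solvable_half_plane:
  assumes w: "Re w < - 1" shows "boundedly_solvable w"
proof (rule boundedly_solvableI[of "1 / (- 1 - Re w)\<^sup>2"])
  fix h :: "real \<Rightarrow> complex" assume h: "h \<in> L2 lborel"
  then obtain u y where u: "ladder 1 u y" and y: "ladder (- 1) y (\<lambda>x. w * u x + h x)"
    using solvable_half_plane[OF w] by (auto simp: solvable_def)
  have "(- 1 - Re w)\<^sup>2 * energy u \<le> energy h" by (rule resolvent_estimate[OF u y h w])
  moreover have "(- 1 - Re w)\<^sup>2 > 0" using w by simp
  ultimately have "energy u \<le> 1 / (- 1 - Re w)\<^sup>2 * energy h" by (simp add: field_simps)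
  thus "\<exists>u y. ladder 1 u y \<and> ladder (- 1) y (\<lambda>x. w * u x + h x) \<and> energy u \<le> 1 / (- 1 - Re w)\<^sup>2 * energy h"
    using u y by blast
qed simp

text \<open>By the commutation relation, ba u = (w - 2) u + h and ab u = w u + h are one equation,
  so the inverse of \<open>ab - w\<close> is the inverse of \<open>ba\<close> at w - 2.\<close>

lemma raising_resolvent:
  assumes "boundedly_solvable (w - 2)"
  shows "\<exists>C\<ge>0. \<forall>h\<in>L2 lborel. \<exists>u z. ladder (- 1) u z \<and> ladder 1 z (\<lambda>x. w * u x + h x)
     \<and> energy u \<le> C * energy h \<and> energy z \<le> C * energy h"
proof -
  obtain C where C: "C \<ge> 0" and ex: "\<And>h. h \<in> L2 lborel \<Longrightarrow> \<exists>u y. ladder 1 u y \<and>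
     ladder (- 1) y (\<lambda>x. (w - 2) * u x + h x) \<and> energy u \<le> C * energy h \<and>
     energy y \<le> C * energy h \<and> energy (\<lambda>x. of_real x * u x) \<le> C * energy h"
    using assms unfolding boundedly_solvable_def by blast
  show ?thesis
  \<comment> \<open>10 = 8 + 2: the term 2 s x u contributes 2 |2 s|^2 = 8 and \<open>y\<close>
    contributes 2.\<close>
  proof (intro exI[of _ "10 * C"] conjI ballI)
    fix h :: "real \<Rightarrow> complex" assume h: "h \<in> L2 lborel"
    obtain u y where u: "ladder 1 u y" and y: "ladder (- 1) y (\<lambda>x. (w - 2) * u x + h x)"
      and e: "energy u \<le> C * energy h" "energy y \<le> C * energy h" "energy (\<lambda>x. of_real x * u x) \<le> C * energy h"
      using ex[OF h] by blast
    define z where "z x = 2 * s * of_real x * u x - y x" for x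
    have z: "ladder (- 1) u z" "ladder 1 z (\<lambda>x. w * u x + h x)"
      using ladder_commute[of 1, simplified, OF u y] by (auto simp: z_def[abs_def] algebra_simps)
    have "energy z \<le> 2 * energy (\<lambda>x. (2 * s) * (of_real x * u x)) + 2 * energy y"
      unfolding z_def mult.assoc using ladder_L2[OF u] energy_diff_le[of "\<lambda>x. (2 * s) * (of_real x * u x)" y]
      by (simp add: L2_cmult mult.assoc)
    also have "\<dots> = 8 * energy (\<lambda>x. of_real x * u x) + 2 * energy y"
      unfolding energy_cmult by (simp add: norm_mult norm_s)
    finally have "energy z \<le> 10 * C * energy h" "energy u \<le> 10 * C * energy h"
      using e energy_nonneg[of u] by simp_all
    thus "\<exists>u z. ladder (- 1) u z \<and> ladder 1 z (\<lambda>x. w * u x + h x)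
       \<and> energy u \<le> 10 * C * energy h \<and> energy z \<le> 10 * C * energy h" using z by blast
  qed (use C in simp)
qed

text \<open>
  Write $a = c\,\partial_x + s x$ and $b = -c\,\partial_x + s x$, so that $ab = ba + 2$. If
  $(ba - w + 2) k = h$ and $(ab - w) V = 2 a k$, then $u = k + (b V - 2 k) / w$ solves
  $(ba - w) u = h$: this is $(ba - w)^{-1} = w^{-1} (b\,(ab - w)^{-1} a - 1)$, applied to
  the remainder $2k$ because \<open>h\<close> itself need not be in the domain of \<open>a\<close>.
\<close>

lemma boundedly_solvable_shift:
  assumes sol: "boundedly_solvable (w - 2)" and w: "w \<noteq> 0"
  shows "boundedly_solvable w"
proof -
  obtain C where C: "C \<ge> 0" and ex: "\<And>h. h \<in> L2 lborel \<Longrightarrow> \<exists>u y. ladder 1 u y \<and>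
     ladder (- 1) y (\<lambda>x. (w - 2) * u x + h x) \<and> energy u \<le> C * energy h \<and> energy y \<le> C * energy h"
    using sol unfolding boundedly_solvable_def by blast
  obtain D where D: "D \<ge> 0" and ex': "\<And>h. h \<in> L2 lborel \<Longrightarrow> \<exists>V z. ladder (- 1) V z \<and>
     ladder 1 z (\<lambda>x. w * V x + h x) \<and> energy z \<le> D * energy h"
    using raising_resolvent[OF sol] by blast
  \<comment> \<open>From the splitting of \<open>u\<close> below: 2 C for \<open>k\<close>, and
    twice the bound for (z - 2 k) / w, in which 8 D C is 2 D times the factor 4 C for 2 y.\<close>
  define K where "K = 2 * C + 2 * ((8 * D * C + 8 * C) / (norm w)\<^sup>2)"
  show ?thesis
  proof (rule boundedly_solvableI[of K])
    show "0 \<le> K" using C D by (simp add: K_def)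
    fix h :: "real \<Rightarrow> complex" assume h: "h \<in> L2 lborel"
    obtain k y where k: "ladder 1 k y" and y: "ladder (- 1) y (\<lambda>x. (w - 2) * k x + h x)"
      and ek: "energy k \<le> C * energy h" and ey: "energy y \<le> C * energy h"
      using ex[OF h] by blast
    have kL: "k \<in> L2 lborel" and yL: "y \<in> L2 lborel" using ladder_L2[OF k] by auto
    obtain V z where z: "ladder (- 1) V z" "ladder 1 z (\<lambda>x. w * V x + 2 * y x)"
      and ez: "energy z \<le> D * energy (\<lambda>x. 2 * y x)"
      using ex'[OF L2_cmult[OF yL, of 2]] by blast
    have zL: "z \<in> L2 lborel" using ladder_L2[OF z(2)] by simp
    define u where "u x = k x + (1 / w) * (z x - 2 * k x)" for x
    have "ladder 1 u (\<lambda>x. y x + (1 / w) * (w * V x + 2 * y x - 2 * y x))"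
      unfolding u_def by (intro ladder_add ladder_cmult ladder_diff k z)
    hence u: "ladder 1 u (\<lambda>x. y x + V x)" using w by simp
    have "ladder (- 1) (\<lambda>x. y x + V x) (\<lambda>x. ((w - 2) * k x + h x) + z x)"
      by (intro ladder_add y z)
    moreover have "((w - 2) * k x + h x) + z x = w * u x + h x" for x
      using w by (simp add: u_def field_simps)
    ultimately have u': "ladder (- 1) (\<lambda>x. y x + V x) (\<lambda>x. w * u x + h x)" by simp
    have "energy z \<le> D * (4 * (C * energy h))"
      by (rule order.trans[OF ez mult_left_mono[OF _ D]]) (use ey in \<open>simp add: energy_cmult\<close>)
    hence "2 * energy z + 8 * energy k \<le> (8 * D * C + 8 * C) * energy h"
      using ek by (simp add: algebra_simps)
    moreover have "energy (\<lambda>x. z x - 2 * k x) \<le> 2 * energy z + 2 * energy (\<lambda>x. 2 * k x)"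
      by (intro energy_diff_le L2_cmult kL zL)
    ultimately have "energy (\<lambda>x. z x - 2 * k x) \<le> (8 * D * C + 8 * C) * energy h"
      by (simp add: energy_cmult)
    hence "energy (\<lambda>x. (1 / w) * (z x - 2 * k x)) \<le> (8 * D * C + 8 * C) / (norm w)\<^sup>2 * energy h"
      unfolding energy_cmult by (simp add: norm_divide power_divide divide_right_mono)
    moreover have "energy u \<le> 2 * energy k + 2 * energy (\<lambda>x. (1 / w) * (z x - 2 * k x))"
      unfolding u_def by (intro L2_add L2_cmult L2_diff kL zL)
    moreover have "K * energy h = 2 * (C * energy h) + 2 * ((8 * D * C + 8 * C) / (norm w)\<^sup>2 * energy h)"
      by (simp add: K_def distrib_right)
    ultimately have "energy u \<le> K * energy h" using ek by linarith
    thus "\<exists>u y. ladder 1 u y \<and> ladder (- 1) y (\<lambda>x. w * u x + h x) \<and> energy u \<le> K * energy h"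
      using u u' by blast
  qed
qed

text \<open>Induction over vertical strips of width 2 starting from the half-plane. The single
  obstruction w = 0 of each shift accumulates to the even numbers 2 n.\<close>

theorem boundedly_solvable:
  assumes "\<And>n::nat. w \<noteq> 2 * of_nat n"
  shows "boundedly_solvable w"
proof -
  obtain n :: nat where "(Re w + 1) / 2 < real n" using reals_Archimedean2 by blast
  hence "Re w < 2 * real n - 1" by (simp add: field_simps)
  thus ?thesis using assms
  proof (induction n arbitrary: w)
    case 0 thus ?case by (intro boundedly_solvable_half_plane) auto
  next
    case (Suc n)
    have "boundedly_solvable (w - 2)"
    proof (rule Suc.IH)
      show "Re (w - 2) < 2 * real n - 1" using Suc.prems(1) by simp
      show "w - 2 \<noteq> 2 * of_nat k" for k
      proof
        assume "w - 2 = 2 * of_nat k"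
        hence "w = 2 * of_nat (Suc k)" by (simp add: algebra_simps)
        thus False using Suc.prems(2) by blast
      qed
    qed
    moreover have "w \<noteq> 0" using Suc.prems(2)[of 0] by simp
    ultimately show ?case by (rule boundedly_solvable_shift)
  qed
qed

end

section \<open>The Dirac operator\<close>

lemma vector_4 [simp]:
  "(vector [x, y, z, w] :: ('a::zero)^4) $ 1 = x"
  "(vector [x, y, z, w] :: ('a::zero)^4) $ 2 = y"
  "(vector [x, y, z, w] :: ('a::zero)^4) $ 3 = z"
  "(vector [x, y, z, w] :: ('a::zero)^4) $ 4 = w"
  unfolding vector_def by simp_all

text \<open>The rows are i b f4 + m f3, -i a f3 - m f4, i b f2 + m f1 and -i a f1 - m f2: components
  1 and 3 only meet \<open>a\<close>, components 2 and 4 only meet \<open>b\<close>.\<close>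

lemma dirac_op_nth:
  fixes m \<theta> x :: real and f :: "real \<Rightarrow> complex^4" and c s :: complex and W :: "4 \<Rightarrow> complex"
  defines "c \<equiv> exp (- \<i> * complex_of_real \<theta> / 2)" and "s \<equiv> exp (\<i> * complex_of_real \<theta> / 2)"
    and "W \<equiv> \<lambda>k. weak_deriv (\<lambda>y. f y $ k) x"
  shows "dirac_op m \<theta> f x $ 1 = \<i> * (- c * W 4 + s * x * f x $ 4) + m * f x $ 3"
    "dirac_op m \<theta> f x $ 2 = - \<i> * (c * W 3 + s * x * f x $ 3) - m * f x $ 4"
    "dirac_op m \<theta> f x $ 3 = \<i> * (- c * W 2 + s * x * f x $ 2) + m * f x $ 1"
    "dirac_op m \<theta> f x $ 4 = - \<i> * (c * W 1 + s * x * f x $ 1) - m * f x $ 2"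
  unfolding dirac_op_def dirac1_def dirac2_def dirac3_def off_diagonal_def pauli1_def pauli2_def pauli3_def
    matrix_vector_mult_def c_def[symmetric] s_def[symmetric] W_def
  by (simp_all add: sum_4 algebra_simps)

lemma norm_vec_sq: "(norm v)\<^sup>2 = (\<Sum>k\<in>UNIV. (norm (v $ k))\<^sup>2)" for v :: "complex^'n"
  unfolding norm_vec_def L2_set_def by (simp add: sum_nonneg)

lemma borel_measurable_vec_nth:
  fixes f :: "real \<Rightarrow> complex^'n"
  assumes "f \<in> borel_measurable borel" shows "(\<lambda>x. f x $ k) \<in> borel_measurable borel"
  by (rule measurable_compose[OF assms borel_measurable_continuous_onI]) (auto intro: continuous_intros)

lemma borel_measurable_vec_lambda:
  fixes F :: "'n::finite \<Rightarrow> real \<Rightarrow> complex"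
  assumes "\<And>k. F k \<in> borel_measurable borel" shows "(\<lambda>x. \<chi> k. F k x) \<in> borel_measurable borel"
proof (subst borel_measurable_euclidean_space, rule ballI)
  fix b :: "complex^'n" assume "b \<in> Basis"
  then obtain i e where b: "b = axis i e" by (auto simp: Basis_vec_def)
  note [measurable] = assms
  show "(\<lambda>x. (\<chi> k. F k x) \<bullet> b) \<in> borel_measurable borel"
    unfolding b inner_axis by simp
qed

lemma L2_vec_nth:
  fixes f :: "real \<Rightarrow> complex^'n"
  assumes "f \<in> L2 lborel" shows "(\<lambda>x. f x $ k) \<in> L2 lborel"
proof (rule L2_bound[OF L2_integrable[OF assms]])
  show "(norm (f x $ k))\<^sup>2 \<le> (norm (f x))\<^sup>2" for x
    by (intro power_mono Finite_Cartesian_Product.norm_nth_le) auto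
qed (intro borel_measurable_vec_nth L2_measurable assms)

lemma energy_vec_lambda:
  fixes F :: "'n::finite \<Rightarrow> real \<Rightarrow> complex"
  assumes "\<And>k. F k \<in> L2 lborel" shows "energy (\<lambda>x. \<chi> k. F k x) = (\<Sum>k\<in>UNIV. energy (F k))"
  unfolding energy_def norm_vec_sq using L2_integrable[OF assms] by simp

lemma L2_norm_lborel: "L2_norm lborel f = sqrt (energy f)"
  by (simp add: L2_norm_def energy_def)

lemma L2_density_square_iff:
  fixes u :: "real \<Rightarrow> complex"
  assumes "u \<in> borel_measurable borel"
  shows "u \<in> L2 (density lborel (\<lambda>x. ennreal (x\<^sup>2))) \<longleftrightarrow> (\<lambda>x. of_real x * u x) \<in> L2 lborel"
  unfolding L2_def using assms
  by (simp add: integrable_density norm_mult power_mult_distrib)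

lemma weak_deriv_H1:
  assumes "u \<in> H1"
  shows "weak_deriv u \<in> L2 lborel" "has_weak_deriv u (weak_deriv u)"
  using someI_ex[of "\<lambda>v. v \<in> L2 lborel \<and> has_weak_deriv u v"] assms
  unfolding H1_def weak_deriv_def[symmetric] by blast+

text \<open>The representative keeps \<open>weak_deriv u\<close> itself as its derivative, since
  that is the function \<open>dirac_op\<close> evaluates.\<close>

lemma domain_imp_dom_deriv:
  assumes u: "u \<in> H1" "u \<in> L2 (density lborel (\<lambda>x. ennreal (x\<^sup>2)))"
  obtains U where "dom_deriv U (weak_deriv u)" "AE x in lborel. u x = U x"
proof -
  have uL: "u \<in> L2 lborel" using u by (simp add: H1_def)
  note w = weak_deriv_H1[OF u(1)]
  obtain U where U: "has_ac_deriv U (weak_deriv u)" "AE x in lborel. u x = U x"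
    using has_weak_deriv_imp_has_ac_deriv[OF uL[THEN L2_loc_integrable] w(1)[THEN L2_loc_integrable] w(2)] .
  have Um: "U \<in> borel_measurable borel"
    by (rule borel_measurable_continuous_onI[OF has_ac_deriv_continuous[OF U(1)]])
  have "U \<in> L2 lborel" by (rule L2_cong_AE[OF uL U(2) Um])
  moreover have "(\<lambda>x. of_real x * U x) \<in> L2 lborel"
  proof (rule L2_cong_AE)
    show "(\<lambda>x. of_real x * u x) \<in> L2 lborel" using u(2) uL[THEN L2_measurable] by (simp add: L2_density_square_iff)
    show "AE x in lborel. of_real x * u x = of_real x * U x" using U(2) by eventually_elim simp
  qed (use Um in measurable)
  ultimately show thesis using that U w(1) by (auto simp: dom_deriv_def)
qed

lemma dom_deriv_imp_domain:
  assumes "dom_deriv u v"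
  shows "u \<in> H1 \<inter> L2 (density lborel (\<lambda>x. ennreal (x\<^sup>2)))" "AE x in lborel. weak_deriv u x = v x"
proof -
  note d = dom_derivD[OF assms]
  have w: "has_weak_deriv u v" by (rule has_ac_deriv_imp_has_weak_deriv[OF d(1)])
  hence H: "u \<in> H1" using d by (auto simp: H1_def)
  thus "u \<in> H1 \<inter> L2 (density lborel (\<lambda>x. ennreal (x\<^sup>2)))"
    using d(4) L2_measurable[OF d(2)] by (simp add: L2_density_square_iff)
  show "AE x in lborel. weak_deriv u x = v x"
    by (rule has_weak_deriv_unique[OF weak_deriv_H1(2)[OF H] w]) (intro L2_loc_integrable weak_deriv_H1[OF H] d)+
qed

section \<open>The first-order system for continuous representatives\<close>

context rotated_oscillator
begin

text \<open>
  \<open>dirac_rel m z F P\<close> states $(H_\theta - z) F = P$ for continuous representatives, the functions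
  \<open>a1, b2, a3, b4\<close> being $a F_1, b F_2, a F_3, b F_4$.
\<close>

definition dirac_expr :: "real \<Rightarrow> complex \<Rightarrow> (4 \<Rightarrow> real \<Rightarrow> complex) \<Rightarrow> (real \<Rightarrow> complex) \<Rightarrow>
    (real \<Rightarrow> complex) \<Rightarrow> (real \<Rightarrow> complex) \<Rightarrow> (real \<Rightarrow> complex) \<Rightarrow> 4 \<Rightarrow> real \<Rightarrow> complex" where
  "dirac_expr m z F a1 b2 a3 b4 k x = vector
     [\<i> * b4 x + m * F 3 x - z * F 1 x, - \<i> * a3 x - m * F 4 x - z * F 2 x,
      \<i> * b2 x + m * F 1 x - z * F 3 x, - \<i> * a1 x - m * F 2 x - z * F 4 x] $ k"

definition dirac_rel :: "real \<Rightarrow> complex \<Rightarrow> (4 \<Rightarrow> real \<Rightarrow> complex) \<Rightarrow> (4 \<Rightarrow> real \<Rightarrow> complex) \<Rightarrow> bool" where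
  "dirac_rel m z F P \<longleftrightarrow> (\<exists>a1 b2 a3 b4. ladder 1 (F 1) a1 \<and> ladder (- 1) (F 2) b2 \<and>
      ladder 1 (F 3) a3 \<and> ladder (- 1) (F 4) b4 \<and> P = dirac_expr m z F a1 b2 a3 b4)"

lemma dirac_expr_nth [simp]:
  "dirac_expr m z F a1 b2 a3 b4 1 = (\<lambda>x. \<i> * b4 x + m * F 3 x - z * F 1 x)"
  "dirac_expr m z F a1 b2 a3 b4 2 = (\<lambda>x. - \<i> * a3 x - m * F 4 x - z * F 2 x)"
  "dirac_expr m z F a1 b2 a3 b4 3 = (\<lambda>x. \<i> * b2 x + m * F 1 x - z * F 3 x)"
  "dirac_expr m z F a1 b2 a3 b4 4 = (\<lambda>x. - \<i> * a1 x - m * F 2 x - z * F 4 x)"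
  by (simp_all add: dirac_expr_def fun_eq_iff)

lemma dirac_relE:
  assumes "dirac_rel m z F P"
  obtains a1 b2 a3 b4 where "ladder 1 (F 1) a1" "ladder (- 1) (F 2) b2" "ladder 1 (F 3) a3"
    "ladder (- 1) (F 4) b4" "P = dirac_expr m z F a1 b2 a3 b4"
  using assms unfolding dirac_rel_def by blast

lemma dirac_relI:
  assumes "ladder 1 (F 1) a1" "ladder (- 1) (F 2) b2" "ladder 1 (F 3) a3" "ladder (- 1) (F 4) b4"
    and "\<And>k x. P k x = dirac_expr m z F a1 b2 a3 b4 k x"
  shows "dirac_rel m z F P"
proof -
  have "P = dirac_expr m z F a1 b2 a3 b4" using assms(5) by blast
  thus ?thesis using assms(1-4) unfolding dirac_rel_def by blast
qed

lemma dirac_rel_L2: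
  assumes "dirac_rel m z F P" shows "F k \<in> L2 lborel" "P k \<in> L2 lborel"
proof -
  from assms obtain a1 b2 a3 b4 where l: "ladder 1 (F 1) a1" "ladder (- 1) (F 2) b2"
    "ladder 1 (F 3) a3" "ladder (- 1) (F 4) b4" and P: "P = dirac_expr m z F a1 b2 a3 b4"
    by (rule dirac_relE)
  have L: "F 1 \<in> L2 lborel" "F 2 \<in> L2 lborel" "F 3 \<in> L2 lborel" "F 4 \<in> L2 lborel"
    "a1 \<in> L2 lborel" "b2 \<in> L2 lborel" "a3 \<in> L2 lborel" "b4 \<in> L2 lborel"
    using l[THEN ladder_L2(1)] l[THEN ladder_L2(2)] by auto
  show "F k \<in> L2 lborel" using exhaust_4[of k] L by auto
  have "P 1 \<in> L2 lborel" "P 2 \<in> L2 lborel" "P 3 \<in> L2 lborel" "P 4 \<in> L2 lborel"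
    unfolding P dirac_expr_nth by (intro L2_add L2_diff L2_cmult L)+
  thus "P k \<in> L2 lborel" using exhaust_4[of k] by auto
qed

lemma dirac_rel_diff:
  assumes "dirac_rel m z F P" "dirac_rel m z G Q"
  shows "dirac_rel m z (\<lambda>k x. F k x - G k x) (\<lambda>k x. P k x - Q k x)"
proof -
  from assms(1) obtain a1 b2 a3 b4 where l: "ladder 1 (F 1) a1" "ladder (- 1) (F 2) b2"
    "ladder 1 (F 3) a3" "ladder (- 1) (F 4) b4" and P: "P = dirac_expr m z F a1 b2 a3 b4"
    by (rule dirac_relE)
  from assms(2) obtain a1' b2' a3' b4' where l': "ladder 1 (G 1) a1'" "ladder (- 1) (G 2) b2'"
    "ladder 1 (G 3) a3'" "ladder (- 1) (G 4) b4'" and Q: "Q = dirac_expr m z G a1' b2' a3' b4'"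
    by (rule dirac_relE)
  show ?thesis
  proof (rule dirac_relI)
    fix k :: 4 and x
    show "P k x - Q k x = dirac_expr m z (\<lambda>k x. F k x - G k x) (\<lambda>x. a1 x - a1' x)
        (\<lambda>x. b2 x - b2' x) (\<lambda>x. a3 x - a3' x) (\<lambda>x. b4 x - b4' x) k x"
      using exhaust_4[of k] by (auto simp: P Q algebra_simps)
  qed (intro ladder_diff l l')+
qed

lemma energy_combination_le:
  fixes p q r :: complex and f g h :: "real \<Rightarrow> complex"
  assumes "f \<in> L2 lborel" "g \<in> L2 lborel" "h \<in> L2 lborel" "norm p \<le> K" "norm q \<le> K" "norm r \<le> K"
    and "energy f \<le> B" "energy g \<le> B" "energy h \<le> B"
  shows "energy (\<lambda>x. p * f x + q * g x + r * h x) \<le> 10 * K\<^sup>2 * B"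
proof -
  have 1: "energy (\<lambda>x. a * k x) \<le> K\<^sup>2 * B" if "norm a \<le> K" "energy k \<le> B" for a :: complex and k :: "real \<Rightarrow> complex"
    unfolding energy_cmult using that by (intro mult_mono power_mono energy_nonneg) auto
  have "energy (\<lambda>x. p * f x + q * g x + r * h x) \<le> 2 * energy (\<lambda>x. p * f x + q * g x) + 2 * energy (\<lambda>x. r * h x)"
    by (intro L2_add L2_cmult[OF assms(1)] L2_cmult[OF assms(2)] L2_cmult[OF assms(3)])
  also have "energy (\<lambda>x. p * f x + q * g x) \<le> 2 * energy (\<lambda>x. p * f x) + 2 * energy (\<lambda>x. q * g x)"
    by (intro L2_add L2_cmult[OF assms(1)] L2_cmult[OF assms(2)] L2_cmult[OF assms(3)])
  finally show ?thesis using 1[of p f] 1[of q g] 1[of r h] assms by simp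
qed

text \<open>With w = z^2 - m^2, the inverse of H^2 - z^2 acts by (ba - w)^{-1} on components 1, 3
  and by (ab - w)^{-1} on 2, 4. The result \<open>g\<close> is mapped by H + z; this stays in the
  domain because the intermediate functions a g and b g do.\<close>

lemma dirac_surj:
  fixes m :: real and z :: complex
  assumes z: "\<And>n::nat. z\<^sup>2 - m\<^sup>2 \<noteq> 2 * of_nat n"
  shows "\<exists>C\<ge>0. \<forall>H. (\<forall>k. H k \<in> L2 lborel) \<longrightarrow>
     (\<exists>F. dirac_rel m z F H \<and> (\<Sum>k\<in>UNIV. energy (F k)) \<le> C * (\<Sum>k\<in>UNIV. energy (H k)))"
proof -
  define w where "w = z\<^sup>2 - m\<^sup>2"
  have w: "w \<noteq> 2 * of_nat n" for n :: nat using z by (simp add: w_def)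
  have w2: "w - 2 \<noteq> 2 * of_nat n" for n :: nat using w[of "Suc n"] by (simp add: algebra_simps)
  obtain C1 where C1: "C1 \<ge> 0" "\<And>h. h \<in> L2 lborel \<Longrightarrow> \<exists>u y. ladder 1 u y \<and> ladder (- 1) y (\<lambda>x. w * u x + h x)
     \<and> energy u \<le> C1 * energy h \<and> energy y \<le> C1 * energy h" using boundedly_solvable[OF w] unfolding boundedly_solvable_def by blast
  obtain C2 where C2: "C2 \<ge> 0" "\<And>h. h \<in> L2 lborel \<Longrightarrow> \<exists>u y. ladder (- 1) u y \<and> ladder 1 y (\<lambda>x. w * u x + h x)
     \<and> energy u \<le> C2 * energy h \<and> energy y \<le> C2 * energy h" using raising_resolvent[OF boundedly_solvable[OF w2]] by blast
  define K where "K = norm z + \<bar>m\<bar> + 1"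
  have K: "norm z \<le> K" "norm (complex_of_real m) \<le> K" "norm (- complex_of_real m) \<le> K" "norm \<i> \<le> K" "norm (- \<i>) \<le> K" by (auto simp: K_def)
  define C where "C = 40 * K\<^sup>2 * (C1 + C2)"
  show ?thesis
  proof (intro exI[of _ C] conjI allI impI)
    show "C \<ge> 0" using C1 C2 by (simp add: C_def)
    fix H :: "4 \<Rightarrow> real \<Rightarrow> complex" assume "\<forall>k. H k \<in> L2 lborel"
    hence H: "H k \<in> L2 lborel" for k by blast
    define E where "E = (\<Sum>k\<in>UNIV. energy (H k))"
    have E: "energy (H k) \<le> E" for k unfolding E_def by (rule member_le_sum) (auto simp: energy_nonneg)
    have E0: "E \<ge> 0" unfolding E_def by (intro sum_nonneg energy_nonneg)
    define B where "B = (C1 + C2) * E"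
    have B: "C1 * energy (H k) \<le> B" "C2 * energy (H k) \<le> B" for k
      unfolding B_def using C1 C2 E[of k] E0 energy_nonneg[of "H k"] by (auto intro!: mult_mono)
    obtain g1 y1 where 1: "ladder 1 g1 y1" "ladder (- 1) y1 (\<lambda>x. w * g1 x + H 1 x)" "energy g1 \<le> B" "energy y1 \<le> B"
      using C1(2)[OF H[of 1]] B[of 1] order.trans by metis
    obtain g3 y3 where 3: "ladder 1 g3 y3" "ladder (- 1) y3 (\<lambda>x. w * g3 x + H 3 x)" "energy g3 \<le> B" "energy y3 \<le> B"
      using C1(2)[OF H[of 3]] B[of 3] order.trans by metis
    obtain g2 z2 where 2: "ladder (- 1) g2 z2" "ladder 1 z2 (\<lambda>x. w * g2 x + H 2 x)" "energy g2 \<le> B" "energy z2 \<le> B"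
      using C2(2)[OF H[of 2]] B[of 2] order.trans by metis
    obtain g4 z4 where 4: "ladder (- 1) g4 z4" "ladder 1 z4 (\<lambda>x. w * g4 x + H 4 x)" "energy g4 \<le> B" "energy z4 \<le> B"
      using C2(2)[OF H[of 4]] B[of 4] order.trans by metis
    \<comment> \<open>\<open>f1\<close> to \<open>f4\<close> are the components of (H + z) g, with
      \<open>y1\<close>, \<open>z2\<close>, \<open>y3\<close>, \<open>z4\<close> standing for a g1,
      b g2, a g3, b g4.\<close>
    define f1 where "f1 x = z * g1 x + m * g3 x + \<i> * z4 x" for x
    define f2 where "f2 x = z * g2 x + (- \<i>) * y3 x + (- of_real m) * g4 x" for x
    define f3 where "f3 x = z * g3 x + m * g1 x + \<i> * z2 x" for x
    define f4 where "f4 x = z * g4 x + (- \<i>) * y1 x + (- of_real m) * g2 x" for x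
    have l1: "ladder 1 f1 (\<lambda>x. z * y1 x + m * y3 x + \<i> * (w * g4 x + H 4 x))"
      unfolding f1_def by (intro ladder_add ladder_cmult 1 2 3 4)
    have l2: "ladder (- 1) f2 (\<lambda>x. z * z2 x + (- \<i>) * (w * g3 x + H 3 x) + (- of_real m) * z4 x)"
      unfolding f2_def by (intro ladder_add ladder_cmult 1 2 3 4)
    have l3: "ladder 1 f3 (\<lambda>x. z * y3 x + m * y1 x + \<i> * (w * g2 x + H 2 x))"
      unfolding f3_def by (intro ladder_add ladder_cmult 1 2 3 4)
    have l4: "ladder (- 1) f4 (\<lambda>x. z * z4 x + (- \<i>) * (w * g1 x + H 1 x) + (- of_real m) * z2 x)"
      unfolding f4_def by (intro ladder_add ladder_cmult 1 2 3 4)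
    define F :: "4 \<Rightarrow> real \<Rightarrow> complex" where "F k = (if k = 1 then f1 else if k = 2 then f2 else if k = 3 then f3 else f4)" for k
    have F: "F 1 = f1" "F 2 = f2" "F 3 = f3" "F 4 = f4" by (simp_all add: F_def)
    have "dirac_rel m z F H"
    proof (rule dirac_relI, unfold F, rule l1, rule l2, rule l3, rule l4)
      show "H k x = dirac_expr m z F (\<lambda>x. z * y1 x + m * y3 x + \<i> * (w * g4 x + H 4 x))
          (\<lambda>x. z * z2 x + (- \<i>) * (w * g3 x + H 3 x) + (- of_real m) * z4 x)
          (\<lambda>x. z * y3 x + m * y1 x + \<i> * (w * g2 x + H 2 x))
          (\<lambda>x. z * z4 x + (- \<i>) * (w * g1 x + H 1 x) + (- of_real m) * z2 x) k x" for k x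
        using exhaust_4[of k]
        by (auto simp: F f1_def f2_def f3_def f4_def w_def algebra_simps power2_eq_square)
    qed
    moreover have "energy f1 \<le> 10 * K\<^sup>2 * B" "energy f2 \<le> 10 * K\<^sup>2 * B" "energy f3 \<le> 10 * K\<^sup>2 * B" "energy f4 \<le> 10 * K\<^sup>2 * B"
      unfolding f1_def f2_def f3_def f4_def
      by (rule energy_combination_le; use K 1 2 3 4 ladder_L2 in auto)+
    hence "(\<Sum>k\<in>UNIV. energy (F k)) \<le> C * E" by (simp add: sum_4 F C_def B_def)
    ultimately show "\<exists>F. dirac_rel m z F H \<and> (\<Sum>k\<in>UNIV. energy (F k)) \<le> C * (\<Sum>k\<in>UNIV. energy (H k))"
      unfolding E_def by blast
  qed
qed

text \<open>
  With $J = \mathrm{diag}(1, -1, 1, -1)$ the transpose of $H$ for the bilinear pairing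
  $\int f \cdot g$ is $J H J$.
\<close>

lemma dirac_duality:
  assumes "dirac_rel m z F P" "dirac_rel m z G H"
  shows "(LBINT x. F 1 x * H 1 x - F 2 x * H 2 x + F 3 x * H 3 x - F 4 x * H 4 x) =
    (LBINT x. P 1 x * G 1 x - P 2 x * G 2 x + P 3 x * G 3 x - P 4 x * G 4 x)"
proof -
  from assms(1) obtain a1 b2 a3 b4 where l: "ladder 1 (F 1) a1" "ladder (- 1) (F 2) b2"
    "ladder 1 (F 3) a3" "ladder (- 1) (F 4) b4" and P: "P = dirac_expr m z F a1 b2 a3 b4"
    by (rule dirac_relE)
  from assms(2) obtain a1' b2' a3' b4' where l': "ladder 1 (G 1) a1'" "ladder (- 1) (G 2) b2'"
    "ladder 1 (G 3) a3'" "ladder (- 1) (G 4) b4'" and H: "H = dirac_expr m z G a1' b2' a3' b4'"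
    by (rule dirac_relE)
  note L = l[THEN ladder_L2(1)] l[THEN ladder_L2(2)] l'[THEN ladder_L2(1)] l'[THEN ladder_L2(2)]
  define Z where "Z x = m * (F 1 x * G 3 x + F 3 x * G 1 x + F 2 x * G 4 x + F 4 x * G 2 x)
    - z * (F 1 x * G 1 x - F 2 x * G 2 x + F 3 x * G 3 x - F 4 x * G 4 x)" for x
  define X where "X x = \<i> * (F 1 x * b4' x + F 2 x * a3' x + F 3 x * b2' x + F 4 x * a1' x)" for x
  define Y where "Y x = \<i> * (b4 x * G 1 x + a3 x * G 2 x + b2 x * G 3 x + a1 x * G 4 x)" for x
  note I = L2_mult_integrable
  have iZ: "integrable lborel Z" unfolding Z_def
    by (intro integrable_mult_right Bochner_Integration.integrable_add Bochner_Integration.integrable_diff I) (use L in auto)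
  have i8: "integrable lborel (\<lambda>x. F 1 x * b4' x)" "integrable lborel (\<lambda>x. F 2 x * a3' x)"
    "integrable lborel (\<lambda>x. F 3 x * b2' x)" "integrable lborel (\<lambda>x. F 4 x * a1' x)"
    "integrable lborel (\<lambda>x. b4 x * G 1 x)" "integrable lborel (\<lambda>x. a3 x * G 2 x)"
    "integrable lborel (\<lambda>x. b2 x * G 3 x)" "integrable lborel (\<lambda>x. a1 x * G 4 x)"
    by (intro I; use L in auto)+
  have iX: "integrable lborel X" and iY: "integrable lborel Y" unfolding X_def Y_def
    by (intro integrable_mult_right Bochner_Integration.integrable_add i8)+
  have d: "(LBINT x. a1 x * G 4 x) = (LBINT x. F 1 x * b4' x)"
     "(LBINT x. a3 x * G 2 x) = (LBINT x. F 3 x * b2' x)"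
     "(LBINT x. b4 x * G 1 x) = (LBINT x. F 4 x * a1' x)"
     "(LBINT x. b2 x * G 3 x) = (LBINT x. F 2 x * a3' x)"
    using ladder_duality[OF l(1) l'(4)] ladder_duality[OF l(3) l'(2)]
      ladder_duality[OF l'(1) l(4)] ladder_duality[OF l'(3) l(2)] by (simp_all add: mult.commute)
  have "(LBINT x. X x) = (LBINT x. Y x)"
    unfolding X_def Y_def using i8 d by simp
  hence "(LBINT x. X x + Z x) = (LBINT x. Y x + Z x)" using iX iY iZ by simp
  moreover have "F 1 x * H 1 x - F 2 x * H 2 x + F 3 x * H 3 x - F 4 x * H 4 x = X x + Z x" for x
    by (simp add: H X_def Z_def algebra_simps)
  moreover have "P 1 x * G 1 x - P 2 x * G 2 x + P 3 x * G 3 x - P 4 x * G 4 x = Y x + Z x" for x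
    by (simp add: P Y_def Z_def algebra_simps)
  ultimately show ?thesis by simp
qed

lemma le_of_le_average: "x \<le> (a + b) / 2 \<Longrightarrow> b \<le> x \<Longrightarrow> x \<le> a" for a b x :: real
  by simp

text \<open>A duality argument: solvability with a bound, fed with a right side built from
  \<open>F\<close>, bounds every element of the domain and not just the solutions constructed. This
  gives both injectivity and the bounded inverse.\<close>

lemma dirac_bound:
  assumes C: "C \<ge> 0" and surj: "\<forall>H. (\<forall>k. H k \<in> L2 lborel) \<longrightarrow>
     (\<exists>F. dirac_rel m z F H \<and> (\<Sum>k\<in>UNIV. energy (F k)) \<le> C * (\<Sum>k\<in>UNIV. energy (H k)))"
    and F: "dirac_rel m z F P"
  shows "(\<Sum>k\<in>UNIV. energy (F k)) \<le> (C + 1) * (\<Sum>k\<in>UNIV. energy (P k))"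
proof -
  note FL = dirac_rel_L2(1)[OF F] and PL = dirac_rel_L2(2)[OF F]
  \<comment> \<open>J applied to the conjugate of \<open>F\<close>, so that the alternating pairing
    of \<open>dirac_duality\<close> returns the sum of the |F_k|^2.\<close>
  define H :: "4 \<Rightarrow> real \<Rightarrow> complex" where "H k x = (if k = 1 \<or> k = 3 then cnj (F k x) else - cnj (F k x))" for k x
  have H: "H 1 = (\<lambda>x. cnj (F 1 x))" "H 2 = (\<lambda>x. - cnj (F 2 x))" "H 3 = (\<lambda>x. cnj (F 3 x))" "H 4 = (\<lambda>x. - cnj (F 4 x))"
    by (simp_all add: H_def[abs_def])
  have HL: "H k \<in> L2 lborel" for k
    using exhaust_4[of k] L2_cnj[OF FL] L2_minus[OF L2_cnj[OF FL]] by (auto simp: H)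
  have EH: "energy (H k) = energy (F k)" for k
    by (cases "k = 1 \<or> k = 3") (auto simp: H_def energy_def)
  obtain G where G: "dirac_rel m z G H" "(\<Sum>k\<in>UNIV. energy (G k)) \<le> C * (\<Sum>k\<in>UNIV. energy (H k))"
    using surj HL by blast
  note GL = dirac_rel_L2(1)[OF G(1)]
  define EF where "EF = (\<Sum>k\<in>UNIV. energy (F k))"
  define EP where "EP = (\<Sum>k\<in>UNIV. energy (P k))"
  have EF0: "EF \<ge> 0" unfolding EF_def by (intro sum_nonneg energy_nonneg)
  have iF: "integrable lborel (\<lambda>x. complex_of_real ((norm (F k x))\<^sup>2))" for k
    using L2_integrable[OF FL] by (simp only: complex_of_real_integrable_eq)
  have "(LBINT x. F 1 x * H 1 x - F 2 x * H 2 x + F 3 x * H 3 x - F 4 x * H 4 x)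
    = (LBINT x. complex_of_real ((norm (F 1 x))\<^sup>2) + complex_of_real ((norm (F 2 x))\<^sup>2) + complex_of_real ((norm (F 3 x))\<^sup>2)
       + complex_of_real ((norm (F 4 x))\<^sup>2))"
    by (simp add: H complex_norm_square del: of_real_power)
  also have "\<dots> = of_real EF"
    using iF by (simp add: EF_def sum_4 energy_def del: of_real_power)
  finally have "complex_of_real EF = (LBINT x. P 1 x * G 1 x - P 2 x * G 2 x + P 3 x * G 3 x - P 4 x * G 4 x)"
    using dirac_duality[OF F G(1)] by simp
  also have "\<dots> = (LBINT x. P 1 x * G 1 x) - (LBINT x. P 2 x * G 2 x)
     + (LBINT x. P 3 x * G 3 x) - (LBINT x. P 4 x * G 4 x)"
    using L2_mult_integrable[OF PL GL] by simp
  finally have e: "complex_of_real EF = (LBINT x. P 1 x * G 1 x) - (LBINT x. P 2 x * G 2 x)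
     + (LBINT x. P 3 x * G 3 x) - (LBINT x. P 4 x * G 4 x)" .
  have "EF = norm (complex_of_real EF)" using EF0 by simp
  also have "\<dots> \<le> norm (LBINT x. P 1 x * G 1 x) + norm (LBINT x. P 2 x * G 2 x)
     + norm (LBINT x. P 3 x * G 3 x) + norm (LBINT x. P 4 x * G 4 x)"
    unfolding e by (intro order.trans[OF norm_triangle_ineq4] add_right_mono order.trans[OF norm_triangle_ineq] order.refl)
  \<comment> \<open>The weight C + 1 makes the share of \<open>G\<close> at most half of
    \<open>EF\<close>, which is absorbed; adding 1 keeps the weight positive when C = 0.\<close>
  also have "\<dots> \<le> (\<Sum>k\<in>UNIV. ((C + 1) * energy (P k) + energy (G k) / (C + 1)) / 2)"
    unfolding sum_4 by (intro add_mono L2_mult_integral_le PL GL) (use C in auto)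
  also have "\<dots> = ((C + 1) * EP + (\<Sum>k\<in>UNIV. energy (G k)) / (C + 1)) / 2"
    by (simp add: EP_def sum_4 add_divide_distrib distrib_left)
  finally have "EF \<le> ((C + 1) * EP + (\<Sum>k\<in>UNIV. energy (G k)) / (C + 1)) / 2" .
  moreover have "(\<Sum>k\<in>UNIV. energy (G k)) / (C + 1) \<le> EF"
  proof -
    have "(\<Sum>k\<in>UNIV. energy (G k)) \<le> C * EF" using G(2) by (simp add: EH EF_def)
    also have "\<dots> \<le> EF * (C + 1)" using EF0 by (simp add: algebra_simps)
    finally show ?thesis using C by (simp add: pos_divide_le_eq)
  qed
  ultimately have "EF \<le> (C + 1) * EP" by (rule le_of_le_average)
  thus ?thesis unfolding EF_def EP_def .
qed

section \<open>Hermite functions and eigenvectors\<close>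

text \<open>The functions b^n ground, given by a recurrence: b u = 2 s x u - a u, and
  \<open>a\<close> sends the n-th function to 2 n times its predecessor. At n = 0 the truncated
  \<open>n - 1\<close> is multiplied by 0.\<close>

fun hermite :: "nat \<Rightarrow> real \<Rightarrow> complex" where
  "hermite 0 = ground"
| "hermite (Suc n) = (\<lambda>x. 2 * s * of_real x * hermite n x - 2 * of_nat n * hermite (n - 1) x)"

declare hermite.simps [simp del]

lemma ladder_raise_hermite_aux:
  assumes "ladder 1 (hermite n) (\<lambda>x. 2 * of_nat n * hermite (n - 1) x)"
  shows "ladder (- 1) (hermite n) (hermite (Suc n))"
  using ladder_other[OF assms] by (simp add: hermite.simps)

text \<open>For n = k + 1 the commutation relation gives a b h_k = b a h_k + 2 h_k = (2 k + 2) h_k.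
  The middle step raises h_{k-1}, one index lower still, hence the strong induction.\<close>

lemma ladder_lower_hermite: "ladder 1 (hermite n) (\<lambda>x. 2 * of_nat n * hermite (n - 1) x)"
proof (induction n rule: less_induct)
  case (less n)
  show ?case
  proof (cases n)
    case 0 thus ?thesis using ground_ladder by (simp add: hermite.simps)
  next
    case (Suc k)
    have Lk: "ladder 1 (hermite k) (\<lambda>x. 2 * of_nat k * hermite (k - 1) x)" using less.IH[of k] Suc by simp
    have "ladder (- 1) (\<lambda>x. 2 * of_nat k * hermite (k - 1) x) (\<lambda>x. 2 * of_nat k * hermite k x)"
    proof (cases k)
      case 0
      thus ?thesis using ladder_cmult[OF ladder_raise_hermite_aux[OF Lk], of 0] by simp
    next
      case (Suc j)
      have "ladder (- 1) (hermite j) (hermite k)" unfolding Suc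
        by (rule ladder_raise_hermite_aux, rule less.IH) (use Suc \<open>n = Suc k\<close> in auto)
      from ladder_cmult[OF this, of "2 * of_nat k"] show ?thesis using Suc by simp
    qed
    from ladder_commute(2)[of 1, simplified, OF Lk this] show ?thesis
      by (simp add: Suc hermite.simps algebra_simps)
  qed
qed

lemmas ladder_raise_hermite = ladder_raise_hermite_aux[OF ladder_lower_hermite]

text \<open>Lowering recovers a nonzero multiple of the previous function, so vanishing would
  descend to the Gaussian.\<close>

lemma hermite_nz: "\<not> (AE x in lborel. hermite n x = 0)"
proof (induction n)
  case 0
  show ?case using ground_nz not_AE_lborel_False by (simp add: hermite.simps)
next
  case (Suc n)
  show ?case
  proof
    assume "AE x in lborel. hermite (Suc n) x = 0"
    from ladder_AE_zero[OF ladder_lower_hermite _ this]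
    have "AE x in lborel. 2 * of_nat (Suc n) * hermite n x = 0" by simp
    hence "AE x in lborel. hermite n x = 0" by eventually_elim (simp del: of_nat_Suc)
    thus False using Suc by blast
  qed
qed

text \<open>The system is symmetric under exchanging components (1,2) with (3,4), so the ansatz
  takes the second pair to be \<epsilon> times the first. Row 1 then fixes i \<beta> = l - m, and
  row 4 holds because l^2 - m^2 = 2 n.\<close>

lemma dirac_eigenvector:
  fixes m \<epsilon> :: real and n :: nat
  assumes m: "m \<ge> 0" and \<epsilon>: "\<epsilon>\<^sup>2 = 1"
  obtains F where "dirac_rel m (of_real (\<epsilon> * sqrt (2 * real n + m\<^sup>2))) F (\<lambda>_ _. 0)" "\<not> (AE x in lborel. F 1 x = 0)"
proof -
  define G where "G = hermite"
  note G = ladder_lower_hermite[folded G_def] ladder_raise_hermite[folded G_def] hermite_nz[folded G_def]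
  define l where "l = sqrt (2 * real n + m\<^sup>2)"
  have l2: "l * l = 2 * real n + m * m" by (simp add: l_def power2_eq_square)
  have l2': "complex_of_real l * of_real l = 2 * of_nat n + of_real m * of_real m"
    using arg_cong[OF l2, of complex_of_real] by simp
  define \<beta> where "\<beta> = - \<i> * (complex_of_real l - of_real m)"
  have b: "ladder (- 1) (\<lambda>x. \<beta> * G (n - 1) x) (\<lambda>x. \<beta> * G n x)"
  proof (cases n)
    case 0
    \<comment> \<open>For n = 0 the sign of m matters: l = sqrt(m^2) = m. With \<beta> = 0 the
      default value \<open>n - 1 = 0\<close> does no harm.\<close>
    hence "\<beta> = 0" using m by (simp add: \<beta>_def l_def)
    thus ?thesis using ladder_cmult[OF G(2)[of 0], of 0] by simp
  next
    case (Suc j)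
    thus ?thesis using ladder_cmult[OF G(2)[of j], of \<beta>] by simp
  qed
  define e where "e = complex_of_real \<epsilon>"
  have ee: "e * (e * x) = x" for x using arg_cong[OF \<epsilon>, of complex_of_real] by (simp add: e_def power2_eq_square mult.assoc[symmetric])
  define F :: "4 \<Rightarrow> real \<Rightarrow> complex" where
    "F k = (if k = 1 then G n else if k = 2 then (\<lambda>x. \<beta> * G (n - 1) x) else if k = 3 then (\<lambda>x. e * G n x) else (\<lambda>x. e * (\<beta> * G (n - 1) x)))" for k
  have F: "F 1 = G n" "F 2 = (\<lambda>x. \<beta> * G (n - 1) x)" "F 3 = (\<lambda>x. e * G n x)" "F 4 = (\<lambda>x. e * (\<beta> * G (n - 1) x))"
    by (simp_all add: F_def)
  have i: "\<i> * \<beta> = of_real l - of_real m" by (simp add: \<beta>_def mult.assoc[symmetric])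
  have 1: "\<i> * (\<beta> * g) + of_real m * g - of_real l * g = 0" for g
    unfolding mult.assoc[symmetric] i by (simp add: algebra_simps)
  have 2: "- \<i> * (2 * of_nat n * g) - of_real m * (\<beta> * g) - of_real l * (\<beta> * g) = 0" for g
  proof -
    have "- \<i> * (2 * of_nat n * g) - of_real m * (\<beta> * g) - of_real l * (\<beta> * g)
      = \<i> * g * (of_real l * of_real l - of_real m * of_real m - 2 * of_nat n)"
      by (simp add: \<beta>_def algebra_simps)
    thus ?thesis by (simp add: l2')
  qed
  have "dirac_rel m (e * of_real l) F (\<lambda>_ _. 0)"
  proof (rule dirac_relI, unfold F)
    show "ladder 1 (G n) (\<lambda>x. 2 * of_nat n * G (n - 1) x)" by (rule G)
    show "ladder (- 1) (\<lambda>x. \<beta> * G (n - 1) x) (\<lambda>x. \<beta> * G n x)" by (rule b)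
    show "ladder 1 (\<lambda>x. e * G n x) (\<lambda>x. e * (2 * of_nat n * G (n - 1) x))" by (intro ladder_cmult G)
    show "ladder (- 1) (\<lambda>x. e * (\<beta> * G (n - 1) x)) (\<lambda>x. e * (\<beta> * G n x))" by (intro ladder_cmult b)
    fix k :: 4 and x
    let ?g = "G n x" and ?h = "G (n - 1) x"
    have "\<i> * (e * (\<beta> * ?g)) + of_real m * (e * ?g) - e * of_real l * ?g = 0"
      using arg_cong[OF 1[of ?g], of "\<lambda>y. e * y"] by (simp add: algebra_simps)
    moreover have "- \<i> * (e * (2 * of_nat n * ?h)) - of_real m * (e * (\<beta> * ?h)) - e * of_real l * (\<beta> * ?h) = 0"
      using arg_cong[OF 2[of ?h], of "\<lambda>y. e * y"] by (simp add: algebra_simps)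
    moreover have "e * of_real l * (e * y) = of_real l * y" for y
      using ee[of "of_real l * y"] by (simp add: mult_ac)
    ultimately show "0 = dirac_expr m (e * of_real l) F (\<lambda>x. 2 * of_nat n * G (n - 1) x) (\<lambda>x. \<beta> * G n x)
        (\<lambda>x. e * (2 * of_nat n * G (n - 1) x)) (\<lambda>x. e * (\<beta> * G n x)) k x"
      using exhaust_4[of k] 1[of ?g] 2[of ?h] by (elim disjE) (simp_all only: dirac_expr_nth F)
  qed
  hence "dirac_rel m (of_real (\<epsilon> * l)) F (\<lambda>_ _. 0)" by (simp add: e_def)
  thus thesis using G(3)[of n] by (intro that[of F]) (auto simp: l_def F)
qed

lemma dirac_rel_zero: "dirac_rel m z (\<lambda>_ _. 0) (\<lambda>_ _. 0)"
proof -
  have "ladder \<sigma> (\<lambda>_. 0) (\<lambda>_. 0)" if "\<sigma> = 1 \<or> \<sigma> = -1" for \<sigma>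
    using that ladder_cmult[OF ground_ladder, of 0] ladder_cmult[OF ladder_other[OF ground_ladder], of 0] by auto
  thus ?thesis
  proof (intro dirac_relI)
    show "0 = dirac_expr m z (\<lambda>_ _. 0) (\<lambda>_. 0) (\<lambda>_. 0) (\<lambda>_. 0) (\<lambda>_. 0) k x" for k x
      using exhaust_4[of k] by auto
  qed auto
qed

end

section \<open>Return to \<open>dirac_op\<close> and its resolvent set\<close>

context rotated_oscillator
begin

context
  fixes \<theta> :: real assumes c_exp: "c = exp (- \<i> * complex_of_real \<theta> / 2)"
begin

lemma s_exp: "s = exp (\<i> * complex_of_real \<theta> / 2)"
  unfolding s_def unfolding c_exp by (simp add: exp_cnj)

lemmas dirac_op_ladder_nth = dirac_op_nth[where \<theta> = \<theta>, folded c_exp s_exp]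

lemma dirac_domain_imp_rel:
  assumes "f \<in> dirac_domain"
  obtains F P where "dirac_rel m z F P" "AE x in lborel. f x = (\<chi> k. F k x)"
    "AE x in lborel. dirac_op m \<theta> f x - z *s f x = (\<chi> k. P k x)"
proof -
  define W where "W k = weak_deriv (\<lambda>y. f y $ k)" for k
  have "\<exists>U. dom_deriv U (W k) \<and> (AE x in lborel. f x $ k = U x)" for k
    using assms domain_imp_dom_deriv[of "\<lambda>x. f x $ k"] unfolding dirac_domain_def W_def by blast
  then obtain F where F: "\<And>k. dom_deriv (F k) (W k)" "\<And>k. AE x in lborel. f x $ k = F k x" by metis
  define up where "up k x = c * W k x + s * of_real x * F k x" for k x
  define dn where "dn k x = - c * W k x + s * of_real x * F k x" for k x
  have up: "ladder 1 (F k) (up k)" and dn: "ladder (- 1) (F k) (dn k)" for k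
    using ladder_of_dom_deriv[OF F(1)[of k], of 1] ladder_of_dom_deriv[OF F(1)[of k], of "-1"]
    by (simp_all add: up_def[abs_def] dn_def[abs_def])
  define P where "P = dirac_expr m z F (up 1) (dn 2) (up 3) (dn 4)"
  have "dirac_rel m z F P" by (rule dirac_relI[OF up dn up dn]) (simp add: P_def)
  moreover have ae: "AE x in lborel. \<forall>k. f x $ k = F k x"
    using F(2) by (intro AE_finite_allI[of UNIV, simplified]) auto
  hence "AE x in lborel. f x = (\<chi> k. F k x)" by eventually_elim (simp add: vec_eq_iff)
  moreover have "AE x in lborel. dirac_op m \<theta> f x - z *s f x = (\<chi> k. P k x)"
    using ae by eventually_elim
      (simp add: vec_eq_iff forall_4 dirac_op_ladder_nth W_def[symmetric] P_def up_def dn_def)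
  ultimately show thesis by (rule that)
qed

text \<open>The chosen \<open>weak_deriv\<close> agrees with the derivative of the representative
  only almost everywhere, so the equation is recovered in that sense.\<close>

lemma dirac_rel_imp_domain:
  assumes "dirac_rel m z F P"
  shows "(\<lambda>x. \<chi> k. F k x) \<in> dirac_domain"
    "AE x in lborel. dirac_op m \<theta> (\<lambda>x. \<chi> k. F k x) x - z *s (\<chi> k. F k x) = (\<chi> k. P k x)"
proof -
  from assms obtain a1 b2 a3 b4 where l: "ladder 1 (F 1) a1" "ladder (- 1) (F 2) b2"
    "ladder 1 (F 3) a3" "ladder (- 1) (F 4) b4" and P: "P = dirac_expr m z F a1 b2 a3 b4"
    by (rule dirac_relE)
  note d = l[THEN ladder_dom_deriv]
  have "F k \<in> H1 \<inter> L2 (density lborel (\<lambda>x. ennreal (x\<^sup>2)))" for k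
    using exhaust_4[of k] d[THEN dom_deriv_imp_domain(1)] by auto
  thus "(\<lambda>x. \<chi> k. F k x) \<in> dirac_domain" by (simp add: dirac_domain_def)
  have w: "AE x in lborel. weak_deriv (F 1) x = ladder_deriv 1 (F 1) a1 x"
    "AE x in lborel. weak_deriv (F 2) x = ladder_deriv (- 1) (F 2) b2 x"
    "AE x in lborel. weak_deriv (F 3) x = ladder_deriv 1 (F 3) a3 x"
    "AE x in lborel. weak_deriv (F 4) x = ladder_deriv (- 1) (F 4) b4 x"
    using d[THEN dom_deriv_imp_domain(2)] by auto
  have e: "a1 x = c * ladder_deriv 1 (F 1) a1 x + s * of_real x * F 1 x"
    "b2 x = s * of_real x * F 2 x - c * ladder_deriv (- 1) (F 2) b2 x"
    "a3 x = c * ladder_deriv 1 (F 3) a3 x + s * of_real x * F 3 x"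
    "b4 x = s * of_real x * F 4 x - c * ladder_deriv (- 1) (F 4) b4 x" for x
    using ladder_deriv_solve[of 1 a1 x "F 1"] ladder_deriv_solve[of "-1" b2 x "F 2"]
      ladder_deriv_solve[of 1 a3 x "F 3"] ladder_deriv_solve[of "-1" b4 x "F 4"] by simp_all
  show "AE x in lborel. dirac_op m \<theta> (\<lambda>x. \<chi> k. F k x) x - z *s (\<chi> k. F k x) = (\<chi> k. P k x)"
    using w
  proof eventually_elim
    case (elim x)
    show ?case
      unfolding vec_eq_iff forall_4
      by (simp add: dirac_op_ladder_nth P elim) (simp flip: e)
  qed
qed

text \<open>Surjectivity comes from \<open>dirac_surj\<close>; the other two clauses come from
  \<open>dirac_bound\<close>, the first by applying it to a difference whose right side has energy
  0.\<close>

lemma dirac_resolvent_setI: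
  fixes m :: real and z :: complex
  assumes z: "\<And>n::nat. z\<^sup>2 - (complex_of_real m)\<^sup>2 \<noteq> 2 * of_nat n"
  shows "z \<in> resolvent_set lborel dirac_domain (dirac_op m \<theta>)"
proof -
  obtain C where C: "C \<ge> 0" and surj: "\<forall>H. (\<forall>k. H k \<in> L2 lborel) \<longrightarrow>
     (\<exists>F. dirac_rel m z F H \<and> (\<Sum>k\<in>UNIV. energy (F k)) \<le> C * (\<Sum>k\<in>UNIV. energy (H k)))"
    using dirac_surj[of z m] z by auto
  note bound = dirac_bound[OF C surj]
  show ?thesis unfolding resolvent_set_def
  proof (intro CollectI conjI ballI impI exI[of _ "sqrt (C + 1)"])
    fix f g assume f: "f \<in> dirac_domain" and g: "g \<in> dirac_domain"
      and eq: "AE x in lborel. dirac_op m \<theta> f x - z *s f x = dirac_op m \<theta> g x - z *s g x"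
    obtain F P where F: "dirac_rel m z F P" "AE x in lborel. f x = (\<chi> k. F k x)"
      "AE x in lborel. dirac_op m \<theta> f x - z *s f x = (\<chi> k. P k x)" by (rule dirac_domain_imp_rel[OF f])
    obtain G Q where G: "dirac_rel m z G Q" "AE x in lborel. g x = (\<chi> k. G k x)"
      "AE x in lborel. dirac_op m \<theta> g x - z *s g x = (\<chi> k. Q k x)" by (rule dirac_domain_imp_rel[OF g])
    note d = dirac_rel_diff[OF F(1) G(1)]
    note dL = dirac_rel_L2[OF d]
    have "AE x in lborel. P k x - Q k x = 0" for k
      using eq F(3) G(3) by eventually_elim (simp add: vec_eq_iff)
    hence "energy (\<lambda>x. P k x - Q k x) = energy (\<lambda>_::real. 0::complex)" for k
      by (rule energy_cong_AE) (use L2_measurable[OF dL(2)[of k]] in auto)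
    hence "(\<Sum>k\<in>UNIV. energy (\<lambda>x. F k x - G k x)) \<le> 0"
      using bound[OF d] by (simp add: energy_def)
    moreover have "energy (\<lambda>x. F k x - G k x) \<le> (\<Sum>k\<in>UNIV. energy (\<lambda>x. F k x - G k x))" for k
      by (rule member_le_sum) (auto simp: energy_nonneg)
    ultimately have "energy (\<lambda>x. F k x - G k x) = 0" for k
      using energy_nonneg[of "\<lambda>x. F k x - G k x"] by (meson order.antisym order.trans)
    hence "AE x in lborel. F k x - G k x = 0" for k by (intro energy_eq_0_imp dL(1)[of k])
    hence "AE x in lborel. \<forall>k. F k x - G k x = 0" by (intro AE_finite_allI[of UNIV, simplified]) auto
    thus "AE x in lborel. f x = g x" using F(2) G(2) by eventually_elim (simp add: vec_eq_iff)
  next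
    fix h :: "real \<Rightarrow> complex^4" assume "h \<in> L2 lborel"
    then obtain F where "dirac_rel m z F (\<lambda>k x. h x $ k)" using surj[rule_format, of "\<lambda>k x. h x $ k"] L2_vec_nth by blast
    from dirac_rel_imp_domain[OF this]
    show "\<exists>f\<in>dirac_domain. AE x in lborel. dirac_op m \<theta> f x - z *s f x = h x" by auto
  next
    fix f assume f: "f \<in> dirac_domain"
    obtain F P where F: "dirac_rel m z F P" "AE x in lborel. f x = (\<chi> k. F k x)"
      "AE x in lborel. dirac_op m \<theta> f x - z *s f x = (\<chi> k. P k x)" by (rule dirac_domain_imp_rel[OF f])
    note FL = dirac_rel_L2[OF F(1)]
    have comp: "(\<lambda>x. f x $ k) \<in> L2 lborel" "weak_deriv (\<lambda>x. f x $ k) \<in> L2 lborel" for k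
      using f weak_deriv_H1 by (auto simp: dirac_domain_def H1_def)
    have fm: "f \<in> borel_measurable borel"
      using borel_measurable_vec_lambda[of "\<lambda>k x. f x $ k", OF L2_measurable[OF comp(1)]] by simp
    have "(\<lambda>x. (dirac_op m \<theta> f x - z *s f x) $ k) \<in> borel_measurable borel" for k
      using exhaust_4[of k] L2_measurable[OF comp(1)] L2_measurable[OF comp(2)]
      by (auto simp: dirac_op_nth)
    hence om: "(\<lambda>x. dirac_op m \<theta> f x - z *s f x) \<in> borel_measurable borel"
      using borel_measurable_vec_lambda[of "\<lambda>k x. (dirac_op m \<theta> f x - z *s f x) $ k"] by (simp only: vec_lambda_eta)
    have "energy f = (\<Sum>k\<in>UNIV. energy (F k))"
      unfolding energy_vec_lambda[OF FL(1), symmetric]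
      by (rule energy_cong_AE[OF F(2) fm]) (intro borel_measurable_vec_lambda L2_measurable FL)
    also have "\<dots> \<le> (C + 1) * (\<Sum>k\<in>UNIV. energy (P k))" by (rule bound[OF F(1)])
    also have "(\<Sum>k\<in>UNIV. energy (P k)) = energy (\<lambda>x. dirac_op m \<theta> f x - z *s f x)"
      unfolding energy_vec_lambda[OF FL(2), symmetric]
      by (rule energy_cong_AE[symmetric, OF F(3) om]) (intro borel_measurable_vec_lambda L2_measurable FL)
    finally show "L2_norm lborel f \<le> sqrt (C + 1) * L2_norm lborel (\<lambda>x. dirac_op m \<theta> f x - z *s f x)"
      unfolding L2_norm_lborel real_sqrt_mult[symmetric] by (rule real_sqrt_le_mono)
  qed
qed

text \<open>The eigenvector and the zero function have the same image, which contradicts the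
  injectivity clause of \<open>resolvent_set\<close>.\<close>

lemma dirac_eigenvalue:
  fixes m \<epsilon> :: real and n :: nat
  assumes "m \<ge> 0" "\<epsilon>\<^sup>2 = 1"
  shows "complex_of_real (\<epsilon> * sqrt (2 * real n + m\<^sup>2)) \<notin> resolvent_set lborel dirac_domain (dirac_op m \<theta>)"
    (is "?z \<notin> _")
proof
  assume r: "?z \<in> resolvent_set lborel dirac_domain (dirac_op m \<theta>)"
  obtain F where F: "dirac_rel m ?z F (\<lambda>_ _. 0)" "\<not> (AE x in lborel. F 1 x = 0)"
    by (rule dirac_eigenvector[OF assms])
  let ?f = "\<lambda>x. \<chi> k. F k x" and ?g = "\<lambda>x::real. (\<chi> k. 0) :: complex^4"
  note f = dirac_rel_imp_domain[OF F(1)] and g = dirac_rel_imp_domain[OF dirac_rel_zero[of m ?z]]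
  have "AE x in lborel. dirac_op m \<theta> ?f x - ?z *s ?f x = dirac_op m \<theta> ?g x - ?z *s ?g x"
    using f(2) g(2) by eventually_elim (simp only:)
  hence "AE x in lborel. ?f x = ?g x" using r f(1) g(1) unfolding resolvent_set_def by blast
  hence "AE x in lborel. F 1 x = 0" by eventually_elim (simp add: vec_eq_iff)
  thus False using F(2) by blast
qed

end

end

theorem mainTheorem4:
  fixes m \<theta> :: real
  assumes "0 \<le> m" and "- (pi / 2) < \<theta>" and "\<theta> < pi / 2"
  shows "spectrum lborel dirac_domain (dirac_op m \<theta>) =
    (\<Union>n::nat. {complex_of_real (- sqrt (2 * real n + m\<^sup>2)),
                complex_of_real (sqrt (2 * real n + m\<^sup>2))})"
proof -
  define c where "c = exp (- \<i> * complex_of_real \<theta> / 2)"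
  interpret rotated_oscillator c
  proof
    show "norm c = 1" by (simp add: c_def)
    \<comment> \<open>The half angle in the operator doubles, so the real part is cos \<theta>,
      positive exactly by the bound on the angle.\<close>
    have "c\<^sup>2 = exp (\<i> * complex_of_real (- \<theta>))" by (simp add: c_def flip: exp_double)
    thus "Re (c\<^sup>2) > 0" using assms cos_gt_zero_pi[of \<theta>] by (simp add: Re_exp)
  qed
  show ?thesis
  proof (intro equalityI subsetI)
    fix z assume "z \<in> spectrum lborel dirac_domain (dirac_op m \<theta>)"
    hence "z \<notin> resolvent_set lborel dirac_domain (dirac_op m \<theta>)" by (simp add: spectrum_def)
    then obtain n :: nat where n: "z\<^sup>2 - (complex_of_real m)\<^sup>2 = 2 * of_nat n"
      using dirac_resolvent_setI[OF c_def, of z m] by auto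
    define l where "l = sqrt (2 * real n + m\<^sup>2)"
    have "z\<^sup>2 = complex_of_real (2 * real n + m\<^sup>2)" using n by (simp add: algebra_simps)
    also have "2 * real n + m\<^sup>2 = l\<^sup>2" by (simp add: l_def)
    finally have "z\<^sup>2 = (complex_of_real l)\<^sup>2" by simp
    hence "z = of_real l \<or> z = of_real (- l)" by (simp add: power2_eq_iff)
    thus "z \<in> (\<Union>n::nat. {complex_of_real (- sqrt (2 * real n + m\<^sup>2)), complex_of_real (sqrt (2 * real n + m\<^sup>2))})"
      by (auto simp: l_def)
  next
    fix z assume "z \<in> (\<Union>n::nat. {complex_of_real (- sqrt (2 * real n + m\<^sup>2)), complex_of_real (sqrt (2 * real n + m\<^sup>2))})"
    then obtain n where "z = of_real ((- 1) * sqrt (2 * real n + m\<^sup>2)) \<or> z = of_real (1 * sqrt (2 * real n + m\<^sup>2))" by auto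
    thus "z \<in> spectrum lborel dirac_domain (dirac_op m \<theta>)"
      using dirac_eigenvalue[OF c_def assms(1), of "- 1" n] dirac_eigenvalue[OF c_def assms(1), of 1 n]
      by (auto simp: spectrum_def)
  qed
qed

end
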